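(* Let $1\le p<\infty$, let $\gamma:\mathbb R\to\mathbb R^n$ be a curve and let $K$ be a kernel on $\mathbb R$. (i) If, for some constant $B$, the operator $K_\gamma$ is bounded on $L^p(\mathbb R^n)$ with $\|K_\gamma\|_{L^p\to L^p}\le B$, then for every $t\in\mathbb R$ the functions of $\xi\in\mathbb R^n$ $$\int_{\mathbb R}e^{it\cos(\gamma(u)\cdot\xi)}K(u)\,du\quad\text{and}\quad\int_{\mathbb R}e^{it\sin(\gamma(u)\cdot\xi)}K(u)\,du$$ belong to $\mathcal M_p$ with norm at most $Be^{|t|}$. (ii) Conversely, if $K\in L^1(\mathbb R)$ and, for some $0<s<1$ and some universal constant $B$, for every $t\in\mathbb R$ both functions displayed in (i) belong to $\mathcal M_p$ with norm at most $Be^{|t|^s}$, then $K_\gamma$ is bounded on $L^p(\mathbb R^n)$ with $\|K_\gamma\|_{L^p\to L^p}\le C$, where the constant $C$ is independent of $\|K\|_1$ (for fixed $p,n,\gamma,s,B$ the same $C$ works for all $K\in L^1(\mathbb R)$ satisfying the hypothesis).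
   Context: $K_\gamma f(x)=\mathrm{p.v.}\int_{\mathbb R}f(x-\gamma(u))K(u)\,du$ for $x\in\mathbb R^n$ and $f$ a test function. When $K$ is not integrable, all integrals against $K$ are understood in the principal value sense (limit as $\varepsilon\to0^+$ of the integrals over $\varepsilon<|u|<1/\varepsilon$), and are understood to exist. For $1\le p<\infty$, $\mathcal M_p=\mathcal M_p(\mathbb R^n)$ is the space of functions $m$ such that the operator $T_mf(x)=\int_{\mathbb R^n}m(\xi)\hat f(\xi)e^{ix\cdot\xi}\,d\xi$ (initially defined on test functions, Fourier transform normalized so that $T_1$ is the identity) extends to a bounded operator on $L^p(\mathbb R^n)$, with norm $\|m\|_{\mathcal M_p}=\|T_m\|_{L^p\to L^p}$.
   Formalization: In (i), for non-integrable K, it is also assumed that the truncated integrals of e^{-iγ(u)·ξ}K(u) are polynomially bounded in ξ uniformly in ε, and that |p.v.∫K| is at most the essential supremum of the p.v. symbol; with mere existence of the principal values (i) is false. *)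

theory Defs
  imports "HOL-Analysis.Analysis"
begin

section \<open>Test functions\<close>

definition partial_deriv :: "'n::finite \<Rightarrow> (real ^ 'n \<Rightarrow> complex) \<Rightarrow> real ^ 'n \<Rightarrow> complex" where
  "partial_deriv i f x = frechet_derivative f (at x) (axis i 1)"

text \<open>Smoothness: all iterated partial derivatives exist and are again differentiable
  (hence also continuous) on the whole space.\<close>

definition smooth :: "(real ^ 'n::finite \<Rightarrow> complex) \<Rightarrow> bool" where
  "smooth f \<longleftrightarrow> (\<forall>is. foldr partial_deriv is f differentiable_on UNIV)"

definition test_function :: "(real ^ 'n::finite \<Rightarrow> complex) \<Rightarrow> bool" where
  "test_function f \<longleftrightarrow> smooth f \<and> compact (closure {x. f x \<noteq> 0})"


section \<open>Bounded operators on \<open>L\<^sup>p\<close>\<close>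

text \<open>Elements of \<open>L\<^sup>p(\<real>\<^sup>n)\<close> are represented by functions; equality in \<open>L\<^sup>p\<close> is equality
  almost everywhere.\<close>

definition Lp :: "real \<Rightarrow> (real ^ 'n::finite \<Rightarrow> complex) set" where
  "Lp p = {f \<in> borel_measurable borel. integrable lborel (\<lambda>x. cmod (f x) powr p)}"

definition Lp_norm :: "real \<Rightarrow> (real ^ 'n::finite \<Rightarrow> complex) \<Rightarrow> real" where
  "Lp_norm p f = (LINT x|lborel. cmod (f x) powr p) powr (1 / p)"

text \<open>\<open>S\<close> is a linear operator on \<open>L\<^sup>p\<close> that extends \<open>T\<close>, where only the values of \<open>T\<close> on test
  functions are relevant.\<close>

definition Lp_extension ::
  "real \<Rightarrow> ((real ^ 'n::finite \<Rightarrow> complex) \<Rightarrow> real ^ 'n \<Rightarrow> complex)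
        \<Rightarrow> ((real ^ 'n \<Rightarrow> complex) \<Rightarrow> real ^ 'n \<Rightarrow> complex) \<Rightarrow> bool" where
  "Lp_extension p T S \<longleftrightarrow>
     (\<forall>f \<in> Lp p. S f \<in> Lp p) \<and>
     (\<forall>f \<in> Lp p. \<forall>g \<in> Lp p. \<forall>a b.
        AE x in lborel. S (\<lambda>y. a * f y + b * g y) x = a * S f x + b * S g x) \<and>
     (\<forall>f. test_function f \<longrightarrow> (AE x in lborel. S f x = T f x))"

definition Lp_bounds ::
  "real \<Rightarrow> ((real ^ 'n::finite \<Rightarrow> complex) \<Rightarrow> real ^ 'n \<Rightarrow> complex) \<Rightarrow> real set" where
  "Lp_bounds p T =
     {C. 0 \<le> C \<and> (\<exists>S. Lp_extension p T S \<and> (\<forall>f \<in> Lp p. Lp_norm p (S f) \<le> C * Lp_norm p f))}"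

definition bounded_on_Lp ::
  "real \<Rightarrow> ((real ^ 'n::finite \<Rightarrow> complex) \<Rightarrow> real ^ 'n \<Rightarrow> complex) \<Rightarrow> bool" where
  "bounded_on_Lp p T \<longleftrightarrow> Lp_bounds p T \<noteq> {}"

text \<open>As test functions are dense in \<open>L\<^sup>p\<close> for \<open>1 \<le> p < \<infinity>\<close>, a bounded extension is unique, and
  the infimum is its operator norm. The value is only meaningful together with
  \<^const>\<open>bounded_on_Lp\<close>.\<close>

definition Lp_opnorm ::
  "real \<Rightarrow> ((real ^ 'n::finite \<Rightarrow> complex) \<Rightarrow> real ^ 'n \<Rightarrow> complex) \<Rightarrow> real" where
  "Lp_opnorm p T = Inf (Lp_bounds p T)"


section \<open>Fourier multipliers\<close>

text \<open>The factor \<open>(2\<pi>)\<^sup>-\<^sup>n\<close> sits in the transform, so that the multiplier operator below is the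
  identity for the symbol \<open>1\<close>.\<close>

definition fourier :: "(real ^ 'n::finite \<Rightarrow> complex) \<Rightarrow> real ^ 'n \<Rightarrow> complex" where
  "fourier f \<xi> =
     complex_of_real ((1 / (2 * pi)) ^ CARD('n)) * (LINT x|lborel. f x * cis (- (x \<bullet> \<xi>)))"

definition multiplier_op ::
  "(real ^ 'n::finite \<Rightarrow> complex) \<Rightarrow> (real ^ 'n \<Rightarrow> complex) \<Rightarrow> real ^ 'n \<Rightarrow> complex" where
  "multiplier_op m f x = (LINT \<xi>|lborel. m \<xi> * fourier f \<xi> * cis (x \<bullet> \<xi>))"

definition Mp :: "real \<Rightarrow> (real ^ 'n::finite \<Rightarrow> complex) set" where
  "Mp p = {m \<in> borel_measurable borel.
     (\<forall>f. test_function f \<longrightarrow> integrable lborel (\<lambda>\<xi>. m \<xi> * fourier f \<xi>)) \<and>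
     bounded_on_Lp p (multiplier_op m)}"

definition Mp_norm :: "real \<Rightarrow> (real ^ 'n::finite \<Rightarrow> complex) \<Rightarrow> real" where
  "Mp_norm p m = Lp_opnorm p (multiplier_op m)"


section \<open>Principal values\<close>

abbreviation annulus :: "real \<Rightarrow> real set" where
  "annulus \<epsilon> \<equiv> {u. \<epsilon> < \<bar>u\<bar> \<and> \<bar>u\<bar> < 1 / \<epsilon>}"

definition pv_exists :: "(real \<Rightarrow> complex) \<Rightarrow> bool" where
  "pv_exists g \<longleftrightarrow>
     (\<forall>\<epsilon>>0. set_integrable lborel (annulus \<epsilon>) g) \<and>
     (\<exists>l. ((\<lambda>\<epsilon>. LINT u:annulus \<epsilon>|lborel. g u) \<longlongrightarrow> l) (at_right 0))"

definition pv_integral :: "(real \<Rightarrow> complex) \<Rightarrow> complex" where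
  "pv_integral g = Lim (at_right 0) (\<lambda>\<epsilon>. LINT u:annulus \<epsilon>|lborel. g u)"

text \<open>For integrable integrands the principal value is the Lebesgue integral, so a single
  notation serves both kinds of kernels.\<close>

lemma pv_of_integrable:
  assumes g: "integrable lborel g"
  shows "pv_exists g" and "pv_integral g = (LINT u|lborel. g u)"
proof -
  have si: "set_integrable lborel (annulus \<epsilon>) g" for \<epsilon>
    unfolding set_integrable_def
    by (rule integrable_mult_indicator[OF _ g]) simp
  have lim: "((\<lambda>\<epsilon>. LINT u:annulus \<epsilon>|lborel. g u) \<longlongrightarrow> (LINT u|lborel. g u)) (at_right 0)"
    unfolding set_lebesgue_integral_def
  proof (rule tendsto_at_right_sequentially[where b = 1])
    fix S :: "nat \<Rightarrow> real"
    assume S: "\<And>n. 0 < S n" "S \<longlonglongrightarrow> 0"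
    show "(\<lambda>n. LINT u|lborel. indicator (annulus (S n)) u *\<^sub>R g u) \<longlonglongrightarrow> (LINT u|lborel. g u)"
    proof (rule integral_dominated_convergence[where w = "\<lambda>u. norm (g u)"])
      show "AE u in lborel. (\<lambda>n. indicator (annulus (S n)) u *\<^sub>R g u) \<longlonglongrightarrow> g u"
      proof (rule AE_mp[OF AE_lborel_singleton[of 0]], rule AE_I2, rule impI)
        fix u :: real
        assume u: "u \<noteq> 0"
        have "eventually (\<lambda>n. S n < min \<bar>u\<bar> (1 / \<bar>u\<bar>)) sequentially"
          using u by (intro order_tendstoD(2)[OF S(2)]) simp
        then have "eventually (\<lambda>n. indicator (annulus (S n)) u *\<^sub>R g u = g u) sequentially"
        proof eventually_elim
          case (elim n)
          then have "S n < \<bar>u\<bar>" "S n * \<bar>u\<bar> < 1"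
            using u by (auto simp: field_simps)
          then have "u \<in> annulus (S n)"
            using S(1)[of n] by (auto simp: field_simps)
          then show ?case by simp
        qed
        then show "(\<lambda>n. indicator (annulus (S n)) u *\<^sub>R g u) \<longlonglongrightarrow> g u"
          by (rule tendsto_eventually)
      qed
    qed (use g in \<open>auto simp: indicator_def\<close>)
  qed simp
  show "pv_exists g"
    unfolding pv_exists_def using si lim by blast
  show "pv_integral g = (LINT u|lborel. g u)"
    unfolding pv_integral_def using lim by (intro tendsto_Lim) auto
qed


section \<open>The operator along a curve\<close>

definition curve_op ::
  "(real \<Rightarrow> real ^ 'n::finite) \<Rightarrow> (real \<Rightarrow> complex) \<Rightarrow> (real ^ 'n \<Rightarrow> complex) \<Rightarrow> real ^ 'n \<Rightarrow> complex"
  where "curve_op \<gamma> K f x = pv_integral (\<lambda>u. f (x - \<gamma> u) * K u)"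

definition cos_mult ::
  "(real \<Rightarrow> real ^ 'n::finite) \<Rightarrow> (real \<Rightarrow> complex) \<Rightarrow> real \<Rightarrow> real ^ 'n \<Rightarrow> complex" where
  "cos_mult \<gamma> K t \<xi> = pv_integral (\<lambda>u. exp (\<i> * of_real (t * cos (\<gamma> u \<bullet> \<xi>))) * K u)"

definition sin_mult ::
  "(real \<Rightarrow> real ^ 'n::finite) \<Rightarrow> (real \<Rightarrow> complex) \<Rightarrow> real \<Rightarrow> real ^ 'n \<Rightarrow> complex" where
  "sin_mult \<gamma> K t \<xi> = pv_integral (\<lambda>u. exp (\<i> * of_real (t * sin (\<gamma> u \<bullet> \<xi>))) * K u)"

text \<open>The integral that defines the symbol of \<^const>\<open>curve_op\<close>.\<close>

definition curve_symbol ::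
  "(real \<Rightarrow> real ^ 'n::finite) \<Rightarrow> (real \<Rightarrow> complex) \<Rightarrow> real ^ 'n \<Rightarrow> complex" where
  "curve_symbol \<gamma> K \<xi> = pv_integral (\<lambda>u. cis (- (\<gamma> u \<bullet> \<xi>)) * K u)"

text \<open>The standing convention for a kernel \<open>K\<close> that is not integrable: the integrals against \<open>K\<close>
  that occur exist as principal values.\<close>

definition pv_integrals_exist ::
  "(real \<Rightarrow> real ^ 'n::finite) \<Rightarrow> (real \<Rightarrow> complex) \<Rightarrow> bool" where
  "pv_integrals_exist \<gamma> K \<longleftrightarrow>
     (\<forall>f x. test_function f \<longrightarrow> pv_exists (\<lambda>u. f (x - \<gamma> u) * K u)) \<and>
     (\<forall>t \<xi>. pv_exists (\<lambda>u. exp (\<i> * of_real (t * cos (\<gamma> u \<bullet> \<xi>))) * K u)) \<and>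
     (\<forall>t \<xi>. pv_exists (\<lambda>u. exp (\<i> * of_real (t * sin (\<gamma> u \<bullet> \<xi>))) * K u)) \<and>
     (\<forall>\<xi>. pv_exists (\<lambda>u. cis (- (\<gamma> u \<bullet> \<xi>)) * K u))"

text \<open>
  Bare pointwise existence of these limits does not tie the operator to its symbol, so the
  convention is read to include two qualitative properties, both automatic for integrable \<open>K\<close>.

  First, the truncated symbols grow at most polynomially, uniformly in the truncation, so that the
  limits may be taken under integrals against Fourier transforms of test functions.

  Second, the value of the symbol at frequency \<open>0\<close>, which is the principal value integral of \<open>K\<close>
  itself, does not exceed the essential supremum of the symbol. The operator cannot see this
  single value, but \<open>cos_mult \<gamma> K 0\<close> is constantly equal to it. The condition is automatic if \<open>K\<close>
  is odd (the value is then \<open>0\<close>), or if the symbol is continuous at \<open>0\<close>.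

  The second property cannot be dropped. Let \<open>n = 1\<close> and let \<open>\<rho>\<^sub>j\<close> be the uniform probability
  density on \<open>[-j, j]\<close>, with \<open>\<rho>\<^sub>0 = 0\<close>. For every natural number \<open>j\<close>, on \<open>[j, j + 1/2]\<close> let \<open>\<gamma>\<close>
  run linearly from \<open>-(j + 1)\<close> to \<open>j + 1\<close> and let \<open>K = 4 (j + 1) (\<rho>\<^sub>j\<^sub>+\<^sub>1 - \<rho>\<^sub>j) \<circ> \<gamma>\<close>; on
  \<open>[j + 1/2, j + 1]\<close> let \<open>\<gamma>\<close> move on to the next starting point and let \<open>K = 0\<close>; on the negative
  half-line let \<open>\<gamma>\<close> be constant and \<open>K = 0\<close>. The image of \<open>K du\<close> on \<open>[0, j]\<close> under \<open>\<gamma>\<close> has density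
  \<open>\<rho>\<^sub>j\<close>. Hence all principal values exist and \<open>curve_op \<gamma> K f = 0\<close> for every test function \<open>f\<close>, but
  \<open>cos_mult \<gamma> K 0\<close> is the constant \<open>1\<close>.
\<close>

definition pv_symbol_regular ::
  "(real \<Rightarrow> real ^ 'n::finite) \<Rightarrow> (real \<Rightarrow> complex) \<Rightarrow> bool" where
  "pv_symbol_regular \<gamma> K \<longleftrightarrow>
     (\<exists>A N. \<forall>\<epsilon>>0. \<forall>\<xi>.
        cmod (LINT u:annulus \<epsilon>|lborel. cis (- (\<gamma> u \<bullet> \<xi>)) * K u) \<le> A * (1 + norm \<xi>) ^ N) \<and>
     (\<forall>A. (AE \<xi> in lborel. cmod (curve_symbol \<gamma> K \<xi>) \<le> A) \<longrightarrow> cmod (curve_symbol \<gamma> K 0) \<le> A)"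

text \<open>A kernel is either integrable, or its integrals are understood as principal values.\<close>

definition admissible_kernel ::
  "(real \<Rightarrow> real ^ 'n::finite) \<Rightarrow> (real \<Rightarrow> complex) \<Rightarrow> bool" where
  "admissible_kernel \<gamma> K \<longleftrightarrow>
     integrable lborel K \<or> (pv_integrals_exist \<gamma> K \<and> pv_symbol_regular \<gamma> K)"

end

theory Submission
  imports Defs "HOL-Probability.Probability" "HOL-Real_Asymp.Real_Asymp"
begin

text \<open>
  By Fourier inversion \<open>curve_op \<gamma> K\<close> is the multiplier operator of its symbol
  \<open>m \<xi> = \<integral> cis (- (\<gamma> u \<bullet> \<xi>)) * K u\<close>, and all dilations \<open>m (k *\<^sub>R \<xi>)\<close> with \<open>k \<noteq> 0\<close> have the same
  multiplier norm as \<open>m\<close>.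

  For (i), write \<open>cos \<theta>\<close> or \<open>sin \<theta>\<close> as \<open>\<alpha> * cis (- \<theta>) + \<beta> * cis \<theta>\<close> with \<open>\<bar>\<alpha>\<bar> = \<bar>\<beta>\<bar> = 1 / 2\<close>. The
  binomial theorem turns the symbol of its \<open>n\<close>-th power into a combination of dilations of \<open>m\<close> whose
  coefficients have total mass \<open>1\<close>, and the exponential series gives the factor \<open>exp \<bar>t\<bar>\<close>. The term
  with \<open>k = 0\<close> is the constant \<open>m 0\<close>, which is controlled because multipliers are essentially bounded
  by their norm.

  For (ii), there is a non-quasianalytic expansion \<open>x = (\<Sum>i. c i * cis (\<tau> i * x))\<close> on \<open>[-1, 1]\<close>
  with \<open>(\<Sum>i. \<bar>c i\<bar> * exp (\<bar>\<tau> i\<bar> powr s)) < \<infinity>\<close>: start from the absolutely convergent expansion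
  that results from \<open>x = arcsin (sin x)\<close> and average it over infinitely many intervals of summable
  lengths. Inserting \<open>x = cos (\<gamma> u \<bullet> \<xi>)\<close> and \<open>x = sin (\<gamma> u \<bullet> \<xi>)\<close> recovers \<open>m\<close> from the given
  multipliers.
\<close>

section \<open>Series of bounded operators\<close>

text \<open>A principal value symbol need not be continuous and is not known in advance to be
  bounded; it is only a pointwise limit of continuous symbols of uniformly polynomial growth.
  Interchanges of limits, series and integrals therefore run through bounds
  \<open>A * (1 + norm \<xi>) ^ N\<close>, which the decay of Fourier transforms of test functions
  beats. Dilation by \<open>k\<close> worsens such a bound by at most
  \<open>(1 + \<bar>k\<bar>) ^ N\<close>, harmless against the factorials, while the operator norms
  lose nothing.

  In (ii) the integral of \<open>cmod (K u)\<close> only justifies interchanges, so it never enters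
  the constant. The series for \<open>x\<close> must converge against the weights
  \<open>exp (\<bar>\<tau> i\<bar> powr s)\<close>, but has to be exact only on [-1, 1], the range
  of cos and sin. The expansion obtained from arcsin holds for
  \<open>\<bar>x\<bar> < pi / 2\<close>, and \<open>pi / 2 - 1 > 1 / 2\<close>, so averages of total
  half-width \<open>1 / 2\<close> can be spent on damping the coefficients. Half-widths like
  \<open>(j + 1) powr (- q)\<close> with \<open>q > 1\<close> damp like
  \<open>exp (- d * \<bar>t\<bar> powr (1 / q))\<close>; here \<open>1 / q\<close> can be any number
  below 1, which is where \<open>s < 1\<close> enters.\<close>

lemma powr_sum_le:
  fixes w y :: "'a \<Rightarrow> real"
  assumes p: "1 \<le> p" and I: "finite I" and w: "\<And>i. i \<in> I \<Longrightarrow> 0 \<le> w i" and y: "\<And>i. i \<in> I \<Longrightarrow> 0 \<le> y i"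
  shows "(\<Sum>i\<in>I. w i * y i) powr p \<le> (\<Sum>i\<in>I. w i) powr (p - 1) * (\<Sum>i\<in>I. w i * y i powr p)"
proof -
  \<comment> \<open>Vanishing terms are dropped: Jensen is then applied at strictly positive points,
    and the total weight can be normalised to 1. Undoing the normalisation produces the power
    \<open>p - 1\<close>.\<close>
  define J where "J = {i\<in>I. 0 < y i \<and> 0 < w i}"
  define W where "W = (\<Sum>i\<in>J. w i)"
  have J: "finite J" "J \<subseteq> I" using I by (auto simp: J_def)
  have 1: "(\<Sum>i\<in>I. w i * y i) = (\<Sum>i\<in>J. w i * y i)"
    by (rule sum.mono_neutral_right) (use I w y in \<open>force simp: J_def\<close>)+
  have 2: "(\<Sum>i\<in>I. w i * y i powr p) = (\<Sum>i\<in>J. w i * y i powr p)"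
    by (rule sum.mono_neutral_right) (use I w y p in \<open>force simp: J_def\<close>)+
  have 3: "W \<le> (\<Sum>i\<in>I. w i)"
    unfolding W_def using I w by (intro sum_mono2) (auto simp: J_def)
  have nn: "0 \<le> (\<Sum>i\<in>J. w i * y i powr p)"
    by (intro sum_nonneg) (auto simp: J_def)
  show ?thesis
  proof (cases "J = {}")
    case True
    then show ?thesis unfolding 1 2 by simp
  next
    case False
    have W: "0 < W" unfolding W_def using False J by (intro sum_pos) (auto simp: J_def)
    have "(\<Sum>i\<in>J. w i * y i) powr p = (W * (\<Sum>i\<in>J. (w i / W) *\<^sub>R y i)) powr p"
      using W by (simp add: sum_distrib_left)
    also have "\<dots> = W powr p * (\<Sum>i\<in>J. (w i / W) *\<^sub>R y i) powr p"
      by (rule powr_mult)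
    also have "\<dots> \<le> W powr p * (\<Sum>i\<in>J. (w i / W) * y i powr p)"
      using W J False
      by (intro mult_left_mono convex_on_sum[OF _ _ powr_convex[OF p]])
         (auto simp: J_def W_def sum_divide_distrib[symmetric])
    also have "\<dots> = W powr (p - 1) * (\<Sum>i\<in>J. w i * y i powr p)"
      using W by (simp add: sum_divide_distrib[symmetric] powr_diff)
    also have "\<dots> \<le> (\<Sum>i\<in>I. w i) powr (p - 1) * (\<Sum>i\<in>J. w i * y i powr p)"
      using 3 W p nn by (intro mult_right_mono powr_mono2) auto
    finally show ?thesis unfolding 1 2 .
  qed
qed

lemma Lp_norm_le_iff:
  assumes p: "0 < p" and C: "0 \<le> C"
  shows "Lp_norm p g \<le> C * Lp_norm p f \<longleftrightarrow>
    (LINT x|lborel. cmod (g x) powr p) \<le> C powr p * (LINT x|lborel. cmod (f x) powr p)"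
proof -
  define a b where "a = (LINT x|lborel. cmod (g x) powr p)" and "b = (LINT x|lborel. cmod (f x) powr p)"
  have ab: "0 \<le> a" "0 \<le> b" by (simp_all add: a_def b_def)
  have "C * b powr (1 / p) = (C powr p * b) powr (1 / p)"
    using ab C p by (simp add: powr_mult powr_powr)
  moreover have "a powr (1 / p) \<le> (C powr p * b) powr (1 / p) \<longleftrightarrow> a \<le> C powr p * b"
    using ab p by (metis powr_mono2 powr_less_mono2 linorder_not_le less_eq_real_def zero_less_divide_1_iff mult_nonneg_nonneg powr_ge_zero)
  ultimately show ?thesis
    unfolding Lp_norm_def a_def[symmetric] b_def[symmetric] by simp
qed

lemma Lp_linear:
  assumes p: "1 \<le> p" and f: "f \<in> Lp p" and g: "g \<in> Lp p"
  shows "(\<lambda>x. a * f x + b * g x) \<in> Lp p"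
proof -
  have [measurable]: "f \<in> borel_measurable borel" "g \<in> borel_measurable borel"
    using f g by (auto simp: Lp_def)
  have "integrable lborel (\<lambda>x. (cmod a + cmod b) powr (p - 1) *
      (cmod a * cmod (f x) powr p + cmod b * cmod (g x) powr p))"
    using f g by (auto simp: Lp_def)
  then have "integrable lborel (\<lambda>x. cmod (a * f x + b * g x) powr p)"
  proof (rule Bochner_Integration.integrable_bound)
    show "AE x in lborel. norm (cmod (a * f x + b * g x) powr p) \<le>
      norm ((cmod a + cmod b) powr (p - 1) * (cmod a * cmod (f x) powr p + cmod b * cmod (g x) powr p))"
    proof (rule AE_I2)
      fix x
      have "cmod (a * f x + b * g x) powr p \<le> (cmod a * cmod (f x) + cmod b * cmod (g x)) powr p"
        using p by (intro powr_mono2) (auto simp: norm_mult intro: order_trans[OF norm_triangle_ineq])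
      also have "\<dots> \<le> (cmod a + cmod b) powr (p - 1) * (cmod a * cmod (f x) powr p + cmod b * cmod (g x) powr p)"
        using powr_sum_le[OF p, of "UNIV :: bool set" "\<lambda>i. if i then cmod a else cmod b" "\<lambda>i. if i then cmod (f x) else cmod (g x)"]
        by (simp add: UNIV_bool add_ac)
      finally show "norm (cmod (a * f x + b * g x) powr p) \<le>
        norm ((cmod a + cmod b) powr (p - 1) * (cmod a * cmod (f x) powr p + cmod b * cmod (g x) powr p))"
        by simp
    qed
  qed simp
  then show ?thesis by (simp add: Lp_def)
qed

lemma Lp_bounds_mono:
  assumes "C \<in> Lp_bounds p T" "C \<le> D"
  shows "D \<in> Lp_bounds p T"
proof -
  have "C * Lp_norm p f \<le> D * Lp_norm p f" for f :: "real ^ 'a \<Rightarrow> complex"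
    using assms(2) by (intro mult_right_mono) (auto simp: Lp_norm_def)
  then show ?thesis
    using assms order_trans unfolding Lp_bounds_def by (smt (verit, best) mem_Collect_eq)
qed

lemma Lp_bounds_cong:
  assumes "\<And>f x. test_function f \<Longrightarrow> T f x = T' f x"
  shows "Lp_bounds p T = Lp_bounds p T'"
  using assms by (simp add: Lp_bounds_def Lp_extension_def)

lemma Lp_opnorm_nonneg: "bounded_on_Lp p T \<Longrightarrow> 0 \<le> Lp_opnorm p T"
  unfolding bounded_on_Lp_def Lp_opnorm_def
  by (rule cInf_greatest) (auto simp: Lp_bounds_def)

text \<open>The infimum is not known to be attained, so estimates are proved for every
  \<open>C > B\<close>, and the slack is removed only here.\<close>

lemma Lp_opnorm_le:
  assumes "\<And>C. B < C \<Longrightarrow> C * r \<in> Lp_bounds p T" and r: "0 < r"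
  shows "bounded_on_Lp p T" and "Lp_opnorm p T \<le> B * r"
proof -
  show "bounded_on_Lp p T"
    using assms(1)[of "B + 1"] by (auto simp: bounded_on_Lp_def)
  have bdd: "bdd_below (Lp_bounds p T)"
    by (rule bdd_belowI[of _ 0]) (auto simp: Lp_bounds_def)
  show "Lp_opnorm p T \<le> B * r"
  proof (rule field_le_epsilon)
    fix e :: real assume "0 < e"
    then have "(B + e / r) * r \<in> Lp_bounds p T"
      using r by (intro assms(1)) simp
    then have "Lp_opnorm p T \<le> (B + e / r) * r"
      unfolding Lp_opnorm_def by (rule cInf_lower) fact
    also have "(B + e / r) * r = B * r + e"
      using r by (simp add: field_simps)
    finally show "Lp_opnorm p T \<le> B * r + e" .
  qed
qed

lemma Lp_bounds_of_opnorm_less: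
  assumes "bounded_on_Lp p T" "Lp_opnorm p T < C"
  shows "C \<in> Lp_bounds p T"
proof -
  obtain D where "D \<in> Lp_bounds p T" "D < C"
    using assms cInf_lessD unfolding bounded_on_Lp_def Lp_opnorm_def by blast
  then show ?thesis using Lp_bounds_mono by force
qed

text \<open>Jensen's inequality for \<open>x powr p\<close> with the weights \<open>cmod (c i) * C i\<close> gives the
  triangle inequality for the series without Minkowski's inequality and the completeness of \<open>Lp\<close>.\<close>

lemma Lp_sums:
  fixes g :: "nat \<Rightarrow> real ^ 'n::finite \<Rightarrow> complex"
  assumes p: "1 \<le> p" and C: "\<And>i. 0 < C i"
    and g: "\<And>i. g i \<in> Lp p" and f: "f \<in> Lp p"
    and bd: "\<And>i. Lp_norm p (g i) \<le> C i * Lp_norm p f"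
    and sm: "summable (\<lambda>i. cmod (c i) * C i)"
  shows "AE x in lborel. summable (\<lambda>i. c i * g i x)"
    and "(\<lambda>x. \<Sum>i. c i * g i x) \<in> Lp p"
    and "Lp_norm p (\<lambda>x. \<Sum>i. c i * g i x) \<le> (\<Sum>i. cmod (c i) * C i) * Lp_norm p f"
proof -
  let ?h = "\<lambda>i x. c i * g i x"
  define N where "N = (LINT x|lborel. cmod (f x) powr p)"
  define D where "D = (\<Sum>i. cmod (c i) * C i)"
  define w where "w i = cmod (c i) * C i" for i
  \<comment> \<open>The division by \<open>C i\<close> brings the integral of \<open>q i\<close>
    down to at most \<open>w i * N\<close>, so the series of the \<open>q i\<close> is integrable.
    Jensen makes \<open>D powr (p - 1)\<close> times this series the majorant of everything
    below.\<close>
  define q where "q i x = w i * (cmod (g i x) / C i) powr p" for i x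
  have w0: "0 \<le> w i" for i using C[of i] by (simp add: w_def)
  have smw: "summable w" using sm by (simp add: w_def[abs_def])
  have q0: "0 \<le> q i x" for i x using w0 by (simp add: q_def)
  have N0: "0 \<le> N" by (simp add: N_def)
  have D0: "0 \<le> D" unfolding D_def using sm w0 by (intro suminf_nonneg) (auto simp: w_def)
  have [measurable]: "g i \<in> borel_measurable borel" for i
    using g by (auto simp: Lp_def)
  have gi: "integrable lborel (\<lambda>x. cmod (g i x) powr p)" for i
    using g by (auto simp: Lp_def)
  have qe: "q i x = w i * C i powr (- p) * cmod (g i x) powr p" for i x
    using C[of i] by (simp add: q_def powr_divide powr_minus divide_simps)
  have qi: "integrable lborel (q i)" for i
    unfolding qe[abs_def] using gi by simp
  have qN: "(LINT x|lborel. q i x) \<le> w i * N" for i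
  proof -
    have "(LINT x|lborel. cmod (g i x) powr p) \<le> C i powr p * N"
      using bd[of i] p C[of i] unfolding N_def by (subst (asm) Lp_norm_le_iff) auto
    then have "w i * C i powr (- p) * (LINT x|lborel. cmod (g i x) powr p) \<le> w i * C i powr (- p) * (C i powr p * N)"
      using w0 by (intro mult_left_mono) auto
    also have "\<dots> = w i * N * (C i powr (- p) * C i powr p)" by (simp add: algebra_simps)
    also have "C i powr (- p) * C i powr p = 1" using C[of i] by (simp add: powr_minus)
    finally show ?thesis unfolding qe[abs_def] by simp
  qed
  have sI: "summable (\<lambda>i. LINT x|lborel. q i x)"
    by (rule summable_comparison_test'[OF summable_mult2[OF smw, of N], of 0])
       (use qN q0 in \<open>auto simp: integral_nonneg_AE\<close>)
  have aeq: "AE x in lborel. summable (\<lambda>i. q i x)"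
  proof -
    have "(\<integral>\<^sup>+x. (\<Sum>i. ennreal (q i x)) \<partial>lborel) = (\<Sum>i. \<integral>\<^sup>+x. ennreal (q i x) \<partial>lborel)"
      using qi by (intro nn_integral_suminf) auto
    also have "\<dots> = (\<Sum>i. ennreal (LINT x|lborel. q i x))"
      using qi q0 by (simp add: nn_integral_eq_integral)
    also have "\<dots> = ennreal (\<Sum>i. LINT x|lborel. q i x)"
      using sI q0 by (intro suminf_ennreal2) (auto simp: integral_nonneg_AE)
    finally have "(\<integral>\<^sup>+x. (\<Sum>i. ennreal (q i x)) \<partial>lborel) \<noteq> \<infinity>" by simp
    then have "AE x in lborel. (\<Sum>i. ennreal (q i x)) \<noteq> \<infinity>"
      using qi by (intro nn_integral_PInf_AE) auto
    then show ?thesis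
      by eventually_elim (use q0 in \<open>auto intro!: summable_suminf_not_top\<close>)
  qed
  have part: "(\<Sum>i<n. cmod (?h i x)) powr p \<le> D powr (p - 1) * (\<Sum>i. q i x)"
    if x: "summable (\<lambda>i. q i x)" for n x
  proof -
    have "(\<Sum>i<n. cmod (?h i x)) = (\<Sum>i<n. w i * (cmod (g i x) / C i))"
      using C by (intro sum.cong) (auto simp: w_def norm_mult less_imp_neq[symmetric])
    then have "(\<Sum>i<n. cmod (?h i x)) powr p \<le> (\<Sum>i<n. w i) powr (p - 1) * (\<Sum>i<n. q i x)"
      unfolding q_def using w0 C by (simp only:) (intro powr_sum_le[OF p], auto simp: less_imp_le)
    also have "\<dots> \<le> D powr (p - 1) * (\<Sum>i. q i x)"
      using x q0 w0 smw p unfolding D_def w_def[symmetric]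
      by (intro mult_mono powr_mono2 sum_le_suminf sum_nonneg) auto
    finally show ?thesis .
  qed
  have sums: "summable (\<lambda>i. cmod (?h i x))" if x: "summable (\<lambda>i. q i x)" for x
  proof (rule summableI_nonneg_bounded)
    fix n
    have "(\<Sum>i<n. cmod (?h i x)) = ((\<Sum>i<n. cmod (?h i x)) powr p) powr (1 / p)"
      using p by (simp add: powr_powr sum_nonneg)
    also have "\<dots> \<le> (D powr (p - 1) * (\<Sum>i. q i x)) powr (1 / p)"
      using p by (intro powr_mono2 part x) auto
    finally show "(\<Sum>i<n. cmod (?h i x)) \<le> (D powr (p - 1) * (\<Sum>i. q i x)) powr (1 / p)" .
  qed simp
  show "AE x in lborel. summable (\<lambda>i. ?h i x)"
    using aeq by eventually_elim (rule summable_norm_cancel[OF sums])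
  have bound: "cmod (\<Sum>i. ?h i x) powr p \<le> D powr (p - 1) * (\<Sum>i. q i x)"
    if x: "summable (\<lambda>i. q i x)" for x
  proof -
    have "(\<lambda>n. (\<Sum>i<n. cmod (?h i x)) powr p) \<longlonglongrightarrow> (\<Sum>i. cmod (?h i x)) powr p"
      using p by (intro tendsto_powr2 summable_LIMSEQ sums x tendsto_const always_eventually allI sum_nonneg) auto
    then have "(\<Sum>i. cmod (?h i x)) powr p \<le> D powr (p - 1) * (\<Sum>i. q i x)"
      by (rule LIMSEQ_le_const2) (use part[OF x] in auto)
    moreover have "cmod (\<Sum>i. ?h i x) powr p \<le> (\<Sum>i. cmod (?h i x)) powr p"
      using p by (intro powr_mono2 summable_norm sums x) auto
    ultimately show ?thesis by simp
  qed
  have aen: "AE x in lborel. summable (\<lambda>i. norm (q i x))" using aeq q0 by simp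
  have sIn: "summable (\<lambda>i. LINT x|lborel. norm (q i x))" using sI q0 by simp
  have Qi: "integrable lborel (\<lambda>x. D powr (p - 1) * (\<Sum>i. q i x))"
    by (intro integrable_mult_right integrable_suminf qi aen sIn)
  have Ii: "integrable lborel (\<lambda>x. cmod (\<Sum>i. ?h i x) powr p)"
    by (rule Bochner_Integration.integrable_bound[OF Qi])
       (use aeq in \<open>auto elim!: eventually_mono intro: order_trans[OF bound]\<close>)
  then show "(\<lambda>x. \<Sum>i. ?h i x) \<in> Lp p" by (simp add: Lp_def)
  have "(LINT x|lborel. cmod (\<Sum>i. ?h i x) powr p) \<le> (LINT x|lborel. D powr (p - 1) * (\<Sum>i. q i x))"
    by (rule integral_mono_AE[OF Ii Qi]) (use aeq in \<open>auto elim!: eventually_mono intro: bound\<close>)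
  also have "\<dots> = D powr (p - 1) * (\<Sum>i. LINT x|lborel. q i x)"
    by (simp add: integral_suminf[OF qi aen sIn])
  also have "\<dots> \<le> D powr (p - 1) * (\<Sum>i. w i * N)"
    using qN by (intro mult_left_mono suminf_le sI summable_mult2 smw) auto
  also have "(\<Sum>i. w i * N) = D * N"
    unfolding D_def w_def[symmetric] by (rule suminf_mult2[OF smw, symmetric])
  also have "D powr (p - 1) * (D * N) = D powr p * N"
    using D0 by (cases "D = 0") (use p in \<open>auto simp: powr_diff\<close>)
  finally show "Lp_norm p (\<lambda>x. \<Sum>i. ?h i x) \<le> (\<Sum>i. cmod (c i) * C i) * Lp_norm p f"
    using D0 p unfolding D_def N_def by (subst Lp_norm_le_iff) auto
qed

text \<open>The series of the extensions is again an extension: linearity and agreement on test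
  functions hold almost everywhere for each \<open>i\<close>, and countably many null sets form a
  null set. Finite sums are treated as series with vanishing coefficients, so \<open>C i\<close> has
  to be positive but \<open>c i\<close> may be 0.\<close>

lemma Lp_bounds_sums:
  fixes T :: "nat \<Rightarrow> (real ^ 'n::finite \<Rightarrow> complex) \<Rightarrow> real ^ 'n \<Rightarrow> complex"
  assumes p: "1 \<le> p" and C: "\<And>i. 0 < C i" and T: "\<And>i. C i \<in> Lp_bounds p (T i)"
    and sm: "summable (\<lambda>i. cmod (c i) * C i)"
    and U: "\<And>f x. test_function f \<Longrightarrow> (\<lambda>i. c i * T i f x) sums U f x"
  shows "(\<Sum>i. cmod (c i) * C i) \<in> Lp_bounds p U"
proof -
  have "\<forall>i. \<exists>S. Lp_extension p (T i) S \<and> (\<forall>f \<in> Lp p. Lp_norm p (S f) \<le> C i * Lp_norm p f)"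
    using T by (auto simp: Lp_bounds_def)
  then obtain S where S: "\<And>i. Lp_extension p (T i) (S i)"
    "\<And>i f. f \<in> Lp p \<Longrightarrow> Lp_norm p (S i f) \<le> C i * Lp_norm p f"
    by metis
  have SL: "S i f \<in> Lp p" if "f \<in> Lp p" for i f
    using S(1) that by (auto simp: Lp_extension_def)
  define V where "V f x = (\<Sum>i. c i * S i f x)" for f x
  have sums: "AE x in lborel. summable (\<lambda>i. c i * S i f x)" "V f \<in> Lp p"
    "Lp_norm p (V f) \<le> (\<Sum>i. cmod (c i) * C i) * Lp_norm p f" if f: "f \<in> Lp p" for f
    using Lp_sums[where g = "\<lambda>i. S i f", OF p C SL[OF f] f S(2)[OF f] sm]
    by (simp_all add: V_def[abs_def])
  have "Lp_extension p U V"
    unfolding Lp_extension_def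
  proof (intro conjI ballI allI impI)
    show "V f \<in> Lp p" if "f \<in> Lp p" for f
      using sums(2) that .
    show "AE x in lborel. V (\<lambda>y. a * f y + b * g y) x = a * V f x + b * V g x"
      if f: "f \<in> Lp p" and g: "g \<in> Lp p" for f g a b
    proof -
      have "AE x in lborel. \<forall>i. S i (\<lambda>y. a * f y + b * g y) x = a * S i f x + b * S i g x"
        using S(1) f g by (subst AE_all_countable) (auto simp: Lp_extension_def)
      moreover have "AE x in lborel. summable (\<lambda>i. c i * S i f x)" "AE x in lborel. summable (\<lambda>i. c i * S i g x)"
        using sums(1) f g by auto
      ultimately show ?thesis
      proof eventually_elim
        case (elim x)
        have "(\<lambda>i. a * (c i * S i f x) + b * (c i * S i g x)) sums (a * V f x + b * V g x)"
          unfolding V_def using elim by (intro sums_add sums_mult summable_sums)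
        then show ?case
          using elim(1) unfolding V_def by (intro sums_unique[symmetric]) (simp add: algebra_simps)
      qed
    qed
    show "AE x in lborel. V f x = U f x" if f: "test_function f" for f
    proof -
      have "AE x in lborel. \<forall>i. S i f x = T i f x"
        using S(1) f by (subst AE_all_countable) (auto simp: Lp_extension_def)
      then show ?thesis
        by eventually_elim (use U[OF f] in \<open>auto simp: V_def sums_iff\<close>)
    qed
  qed
  moreover have "Lp_norm p (V f) \<le> (\<Sum>i. cmod (c i) * C i) * Lp_norm p f" if "f \<in> Lp p" for f
    using sums(3) that .
  moreover have "0 \<le> (\<Sum>i. cmod (c i) * C i)"
    using C by (intro suminf_nonneg sm) (auto simp: less_imp_le)
  ultimately show ?thesis by (auto simp: Lp_bounds_def)
qed

section \<open>Test functions\<close>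

lemma smooth_iff: "smooth f \<longleftrightarrow> f differentiable_on UNIV \<and> (\<forall>i. smooth (partial_deriv i f))"
proof
  assume f: "smooth f"
  have "smooth (partial_deriv i f)" for i
    unfolding smooth_def
  proof
    fix js
    show "foldr partial_deriv js (partial_deriv i f) differentiable_on UNIV"
      using f[unfolded smooth_def, rule_format, of "js @ [i]"] by simp
  qed
  then show "f differentiable_on UNIV \<and> (\<forall>i. smooth (partial_deriv i f))"
    using f[unfolded smooth_def, rule_format, of "[]"] by simp
next
  assume f: "f differentiable_on UNIV \<and> (\<forall>i. smooth (partial_deriv i f))"
  show "smooth f"
    unfolding smooth_def
  proof
    fix js
    show "foldr partial_deriv js f differentiable_on UNIV"
      using f by (cases js rule: rev_cases) (auto simp: smooth_def)
  qed
qed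

text \<open>Coinduction replaces formulas for iterated derivatives: it suffices to find a class of
  differentiable functions that is closed under first partial derivatives.\<close>

lemma smooth_coinduct:
  assumes "f \<in> Q" and "\<And>f. f \<in> Q \<Longrightarrow> f differentiable_on UNIV"
    and "\<And>f i. f \<in> Q \<Longrightarrow> partial_deriv i f \<in> Q"
  shows "smooth f"
proof -
  have "foldr partial_deriv js f \<in> Q" for js
    using assms(1,3) by (induction js) auto
  then show ?thesis using assms(2) by (auto simp: smooth_def)
qed

lemma partial_deriv_eqI:
  assumes "(f has_derivative D) (at x)"
  shows "partial_deriv i f x = D (axis i 1)"
  unfolding partial_deriv_def using frechet_derivative_at[OF assms] by simp

lemma smooth_has_derivative:
  "smooth f \<Longrightarrow> (f has_derivative frechet_derivative f (at x)) (at x)"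
  using smooth_iff[of f] by (auto simp: differentiable_on_def frechet_derivative_works[symmetric])

lemma smooth_add_mult:
  assumes "smooth f" "smooth g"
  shows "smooth (\<lambda>x. a * f x + b * g x)"
proof (rule smooth_coinduct[where Q = "{\<lambda>x. a * f x + b * g x |f g. smooth f \<and> smooth g}"])
  fix h assume "h \<in> {\<lambda>x. a * f x + b * g x |f g. smooth f \<and> smooth g}"
  then obtain f g where h: "h = (\<lambda>x. a * f x + b * g x)" and fg: "smooth f" "smooth g" by auto
  have D: "(h has_derivative (\<lambda>v. a * frechet_derivative f (at x) v + b * frechet_derivative g (at x) v)) (at x)" for x
    unfolding h by (intro has_derivative_add has_derivative_mult_right smooth_has_derivative fg)
  then show "h differentiable_on UNIV"
    by (auto simp: differentiable_on_def differentiable_def)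
  show "partial_deriv i h \<in> {\<lambda>x. a * f x + b * g x |f g. smooth f \<and> smooth g}" for i
    using fg smooth_iff[of f] smooth_iff[of g]
    by (intro CollectI exI[of _ "partial_deriv i f"] exI[of _ "partial_deriv i g"] conjI ext)
       (simp_all only: partial_deriv_eqI[OF D] partial_deriv_def[of i f] partial_deriv_def[of i g])
qed (use assms in auto)

lemma smooth_modulate:
  assumes "smooth f"
  shows "smooth (\<lambda>x. cis (x \<bullet> v) * f x)"
proof (rule smooth_coinduct[where Q = "{\<lambda>x. cis (x \<bullet> v) * f x |f. smooth f}"])
  fix h assume "h \<in> {\<lambda>x. cis (x \<bullet> v) * f x |f. smooth f}"
  then obtain f where h: "h = (\<lambda>x. cis (x \<bullet> v) * f x)" and f: "smooth f" by auto
  have D: "(h has_derivative (\<lambda>w. cis (x \<bullet> v) * frechet_derivative f (at x) w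
     + (\<i> * of_real (w \<bullet> v) * cis (x \<bullet> v)) * f x)) (at x)" for x
    unfolding h
    by (auto intro!: derivative_eq_intros smooth_has_derivative[OF f] simp: scaleR_conv_of_real)
  then show "h differentiable_on UNIV"
    by (auto simp: differentiable_on_def differentiable_def)
  \<comment> \<open>By the product rule the derivative is again the character times a smooth
    function; the factor \<open>1\<close> gives that function the form required by
    \<open>smooth_add_mult\<close>.\<close>
  have "partial_deriv i h = (\<lambda>x. cis (x \<bullet> v) * (1 * partial_deriv i f x + (\<i> * of_real (axis i 1 \<bullet> v)) * f x))" for i
    by (rule ext) (simp only: partial_deriv_eqI[OF D] partial_deriv_def[of i f], simp add: algebra_simps)
  then show "partial_deriv i h \<in> {\<lambda>x. cis (x \<bullet> v) * f x |f. smooth f}" for i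
    using f smooth_iff[of f]
    by (simp only:, intro CollectI exI[of _ "\<lambda>x. 1 * partial_deriv i f x + (\<i> * of_real (axis i 1 \<bullet> v)) * f x"]
        conjI refl smooth_add_mult) auto
qed (use assms in auto)

lemma smooth_scale:
  fixes f :: "real ^ 'n::finite \<Rightarrow> complex"
  assumes "smooth f"
  shows "smooth (\<lambda>x. f (k *\<^sub>R x))"
\<comment> \<open>The constant \<open>a\<close> in the class absorbs the factor \<open>k\<close>
  that each derivative of a dilation produces.\<close>
proof (rule smooth_coinduct[where Q = "{\<lambda>x. a * f (k *\<^sub>R x) |f a. smooth f}"])
  fix h :: "real ^ 'n \<Rightarrow> complex" assume "h \<in> {\<lambda>x. a * f (k *\<^sub>R x) |f a. smooth f}"
  then obtain f a where h: "h = (\<lambda>x. a * f (k *\<^sub>R x))" and f: "smooth f" by auto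
  have D: "(h has_derivative (\<lambda>w. a * frechet_derivative f (at (k *\<^sub>R x)) (k *\<^sub>R w))) (at x)" for x
    unfolding h
    by (intro has_derivative_mult_right has_derivative_compose[OF _ smooth_has_derivative[OF f], of "\<lambda>x. k *\<^sub>R x"]
        derivative_intros)
  then show "h differentiable_on UNIV"
    by (auto simp: differentiable_on_def differentiable_def)
  have "linear (frechet_derivative f (at (k *\<^sub>R x)))" for x
    using smooth_has_derivative[OF f] has_derivative_linear by blast
  then have "partial_deriv i h = (\<lambda>x. (a * of_real k) * partial_deriv i f (k *\<^sub>R x))" for i
    by (intro ext) (simp only: partial_deriv_eqI[OF D] partial_deriv_def[of i f] linear_cmul,
        simp add: scaleR_conv_of_real[where 'a = complex])
  then show "partial_deriv i h \<in> {\<lambda>x. a * f (k *\<^sub>R x) |f a. smooth f}" for i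
    using f smooth_iff[of f] by blast
next
  show "(\<lambda>x. f (k *\<^sub>R x)) \<in> {\<lambda>x. a * f (k *\<^sub>R x) |f a. smooth f}"
    using assms by (intro CollectI exI[of _ f] exI[of _ 1]) auto
qed

lemma test_function_iff: "test_function f \<longleftrightarrow> smooth f \<and> bounded {x. f x \<noteq> 0}"
  by (simp add: test_function_def)

lemma test_function_modulate: "test_function f \<Longrightarrow> test_function (\<lambda>x. cis (x \<bullet> v) * f x)"
  by (simp add: test_function_iff smooth_modulate)

lemma test_function_scale:
  assumes f: "test_function f" and k: "k \<noteq> 0"
  shows "test_function (\<lambda>x. f (k *\<^sub>R x))"
proof -
  have "{x. f (k *\<^sub>R x) \<noteq> 0} = (\<lambda>x. inverse k *\<^sub>R x) ` {x. f x \<noteq> 0}"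
    using k by (force simp: image_iff)
  then show ?thesis
    using f by (auto simp: test_function_iff smooth_scale intro: bounded_scaling)
qed

lemma test_function_partial_deriv:
  assumes f: "test_function f"
  shows "test_function (partial_deriv i f)"
proof -
  have "partial_deriv i f x = 0" if x: "x \<notin> closure {x. f x \<noteq> 0}" for x
  proof -
    have "(f has_derivative (\<lambda>_. 0)) (at x)"
    proof (rule has_derivative_transform_within_open[of "\<lambda>_. 0"])
      show "open (- closure {x. f x \<noteq> 0})" by (intro open_Compl closed_closure)
    qed (use x closure_subset[of "{x. f x \<noteq> 0}"] in auto)
    then show ?thesis by (simp add: partial_deriv_eqI)
  qed
  then have "{x. partial_deriv i f x \<noteq> 0} \<subseteq> closure {x. f x \<noteq> 0}" by blast
  then show ?thesis
    using f smooth_iff[of f] by (auto simp: test_function_iff intro: bounded_subset[OF bounded_closure])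
qed

lemma test_function_continuous: "test_function f \<Longrightarrow> continuous_on UNIV f"
  using smooth_iff[of f] by (auto simp: test_function_iff intro: differentiable_imp_continuous_on)

lemma test_function_measurable: "test_function f \<Longrightarrow> f \<in> borel_measurable borel"
  by (intro borel_measurable_continuous_onI test_function_continuous)

lemma test_function_bounded:
  fixes f :: "real ^ 'n::finite \<Rightarrow> complex"
  assumes f: "test_function f"
  obtains M R where "0 \<le> M" "\<And>x. cmod (f x) \<le> M * indicator (cball 0 R) x"
proof -
  obtain R where R: "\<And>x. f x \<noteq> 0 \<Longrightarrow> norm x \<le> R"
    using f by (auto simp: test_function_iff bounded_iff)
  have "compact (f ` cball 0 R)"
    using f by (intro compact_continuous_image continuous_on_subset[OF test_function_continuous]) auto
  then obtain M where M: "\<And>x. norm x \<le> R \<Longrightarrow> cmod (f x) \<le> M"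
    by (force dest!: compact_imp_bounded simp: bounded_iff)
  have "cmod (f x) \<le> max M 0 * indicator (cball 0 R) x" for x
    using R[of x] M[of x] order_trans[OF M max.cobounded1[of M 0]] by (cases "f x = 0") (auto simp: indicator_def)
  then show ?thesis by (intro that[of "max M 0" R]) simp_all
qed

lemma test_function_norm_le:
  assumes f: "test_function f"
  obtains M where "\<And>x. cmod (f x) \<le> M"
proof -
  obtain M R where M: "0 \<le> M" "\<And>x. cmod (f x) \<le> M * indicator (cball 0 R) x"
    using test_function_bounded[OF f] by metis
  have "cmod (f x) \<le> M" for x using M(2)[of x] M(1) by (cases "x \<in> cball 0 R") auto
  then show ?thesis by (rule that)
qed

lemma integrable_indicator_cball [simp]:
  "integrable lborel (indicat_real (cball (a::'a::euclidean_space) R))"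
  using emeasure_lborel_cball_finite[of a R]
  by (intro integrable_real_indicator) (auto simp: top.not_eq_extremum)

lemma test_function_integrable:
  assumes f: "test_function f"
  shows "integrable lborel f"
proof -
  obtain M R where M: "\<And>x. cmod (f x) \<le> M * indicator (cball 0 R) x"
    using test_function_bounded[OF f] by metis
  show ?thesis
  proof (rule Bochner_Integration.integrable_bound[where f = "\<lambda>x. M * indicator (cball 0 R) x"])
    show "AE x in lborel. norm (f x) \<le> norm (M * indicator (cball 0 R) x)"
      using M order_trans[OF M abs_ge_self] by (intro AE_I2) (simp only: real_norm_def)
  qed (use test_function_measurable[OF f] in simp_all)
qed

lemma test_function_Lp:
  assumes f: "test_function f" and p: "0 < p"
  shows "f \<in> Lp p"
proof -
  obtain M R where M: "0 \<le> M" "\<And>x. cmod (f x) \<le> M * indicator (cball 0 R) x"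
    using test_function_bounded[OF f] by metis
  have [measurable]: "f \<in> borel_measurable borel" using f by (rule test_function_measurable)
  have *: "cmod (f x) powr p \<le> M powr p * indicator (cball 0 R) x" for x
    using M(2)[of x] p M(1) by (auto simp: indicator_def powr_mono2 split: if_splits)
  have "integrable lborel (\<lambda>x. cmod (f x) powr p)"
  proof (rule Bochner_Integration.integrable_bound[where f = "\<lambda>x. M powr p * indicator (cball 0 R) x"])
    show "AE x in lborel. norm (cmod (f x) powr p) \<le> norm (M powr p * indicator (cball 0 R) x)"
      using order_trans[OF * abs_ge_self] by (intro AE_I2) simp
  qed simp_all
  then show ?thesis by (simp add: Lp_def)
qed

section \<open>Affine changes of variables for Lebesgue measure\<close>

lemma lborel_nn_integral_affine:
  fixes t :: "'a::euclidean_space"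
  assumes [measurable]: "f \<in> borel_measurable borel" and c: "c \<noteq> 0"
  shows "(\<integral>\<^sup>+x. f x \<partial>lborel) = ennreal (\<bar>c\<bar> ^ DIM('a)) * (\<integral>\<^sup>+x. f (t + c *\<^sub>R x) \<partial>lborel)"
  by (subst lborel_affine[OF c, of t])
     (simp add: nn_integral_density nn_integral_distr nn_integral_cmult ennreal_power)

lemma lborel_integrable_affine:
  fixes f :: "'a::euclidean_space \<Rightarrow> 'b :: {banach, second_countable_topology}"
  assumes f: "integrable lborel f" and c: "c \<noteq> 0"
  shows "integrable lborel (\<lambda>x. f (t + c *\<^sub>R x))"
proof -
  have [measurable]: "f \<in> borel_measurable borel" using f by auto
  have "ennreal (\<bar>c\<bar> ^ DIM('a)) * (\<integral>\<^sup>+x. norm (f (t + c *\<^sub>R x)) \<partial>lborel) < \<infinity>"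
    using f unfolding integrable_iff_bounded by (subst (asm) lborel_nn_integral_affine[OF _ c, of _ t]) auto
  then show ?thesis
    using c unfolding integrable_iff_bounded by (auto simp: ennreal_mult_less_top)
qed

lemma lborel_integral_affine:
  fixes f :: "'a::euclidean_space \<Rightarrow> 'b :: {banach, second_countable_topology}"
  assumes c: "c \<noteq> 0"
  shows "(LINT x|lborel. f x) = (\<bar>c\<bar> ^ DIM('a)) *\<^sub>R (LINT x|lborel. f (t + c *\<^sub>R x))"
proof (cases "integrable lborel f")
  case f[measurable]: True
  then show ?thesis
    using lborel_integrable_affine[OF f c, of t] borel_measurable_integrable[OF f]
    by (subst lborel_affine[OF c, of t]) (simp add: integral_density integral_distr ennreal_power)
next
  \<comment> \<open>Integrability transfers in both directions, so both integrals take the default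
    value 0 here.\<close>
  case False
  moreover have "\<not> integrable lborel (\<lambda>x. f (t + c *\<^sub>R x))"
  proof
    assume "integrable lborel (\<lambda>x. f (t + c *\<^sub>R x))"
    from lborel_integrable_affine[OF this, of "inverse c" "- inverse c *\<^sub>R t"] c False
    show False by (simp add: algebra_simps)
  qed
  ultimately show ?thesis by (simp add: not_integrable_integral_eq)
qed

lemma AE_lborel_affine:
  fixes t :: "'a::euclidean_space"
  assumes c: "c \<noteq> 0" and P: "AE x in lborel. P x"
  shows "AE x in lborel. P (t + c *\<^sub>R x)"
proof -
  obtain N where N: "N \<in> null_sets lborel" "{x. \<not> P x} \<subseteq> N"
    using P by (auto simp: eventually_ae_filter)
  have [measurable]: "N \<in> sets borel" using N by auto
  have "AE x in lborel. x \<notin> N" by (rule AE_not_in[OF N(1)])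
  then have "AE x in density (distr lborel borel (\<lambda>x. t + c *\<^sub>R x)) (\<lambda>_. ennreal (\<bar>c\<bar> ^ DIM('a))). x \<notin> N"
    by (subst (asm) lborel_affine[OF c, of t]) (simp add: ennreal_power)
  then have "AE x in lborel. t + c *\<^sub>R x \<notin> N"
    using c by (simp add: AE_density AE_distr_iff)
  then show ?thesis by eventually_elim (use N in blast)
qed

text \<open>Dominated convergence works with sequences, so the derivative is needed as a limit of
  difference quotients along one.\<close>

lemma has_vector_derivative_sequentially:
  fixes f :: "real \<Rightarrow> 'a::real_normed_vector"
  assumes f: "(f has_vector_derivative d) (at 0)" and h: "h \<longlonglongrightarrow> 0" "\<And>k. h k \<noteq> 0"
  shows "(\<lambda>k. (f (h k) - f 0) /\<^sub>R h k) \<longlonglongrightarrow> d"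
proof -
  have "((\<lambda>s. norm (f s - f 0 - s *\<^sub>R d) / \<bar>s\<bar>) \<longlongrightarrow> 0) (at 0)"
    using f by (simp add: has_vector_derivative_def has_derivative_at)
  then have "(\<lambda>k. norm (f (h k) - f 0 - h k *\<^sub>R d) / \<bar>h k\<bar>) \<longlonglongrightarrow> 0"
    by (rule filterlim_compose) (use h in \<open>auto simp: filterlim_at\<close>)
  also have "(\<lambda>k. norm (f (h k) - f 0 - h k *\<^sub>R d) / \<bar>h k\<bar>) = (\<lambda>k. norm ((f (h k) - f 0) /\<^sub>R h k - d))"
  proof
    fix k
    have "(f (h k) - f 0) /\<^sub>R h k - d = (f (h k) - f 0 - h k *\<^sub>R d) /\<^sub>R h k"
      using h(2)[of k] by (simp add: scaleR_diff_right)
    then show "norm (f (h k) - f 0 - h k *\<^sub>R d) / \<bar>h k\<bar> = norm ((f (h k) - f 0) /\<^sub>R h k - d)"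
      by (simp add: divide_inverse mult.commute)
  qed
  finally show ?thesis by (simp add: tendsto_norm_zero_iff LIM_zero_cancel)
qed

lemma integrable_mult_cis:
  assumes "integrable M f" "g \<in> borel_measurable M"
  shows "integrable M (\<lambda>x. f x * cis (g x))"
proof (rule Bochner_Integration.integrable_bound[OF assms(1)])
  have [measurable]: "f \<in> borel_measurable M" "g \<in> borel_measurable M" using assms by auto
  show "(\<lambda>x. f x * cis (g x)) \<in> borel_measurable M" unfolding cis_conv_exp by measurable
qed (simp add: norm_mult)

text \<open>Difference quotients take the place of integration by parts: a translation by
  \<open>h k *\<^sub>R e\<close> multiplies the transform by \<open>cis (h k * \<xi> $ i)\<close>,
  and both the quotients of \<open>f\<close> and those of this factor converge as \<open>h k\<close>
  tends to 0.\<close>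

lemma fourier_partial_deriv:
  fixes f :: "real ^ 'n::finite \<Rightarrow> complex"
  assumes f: "test_function f"
  shows "fourier (partial_deriv i f) \<xi> = \<i> * of_real (\<xi> $ i) * fourier f \<xi>"
proof -
  let ?F = "LINT x|lborel. f x * cis (- (x \<bullet> \<xi>))"
  define e where "e = (axis i 1 :: real ^ 'n)"
  define h where "h k = inverse (real (Suc k))" for k
  have h: "0 < h k" "h k \<le> 1" for k by (simp_all add: h_def field_simps)
  have h0: "h \<longlonglongrightarrow> 0" unfolding h_def[abs_def] by (rule LIMSEQ_inverse_real_of_nat)
  define q where "q k x = (f (x + h k *\<^sub>R e) - f x) / of_real (h k)" for k x
  have [simp]: "norm e = 1" by (simp add: e_def)
  have [measurable]: "f \<in> borel_measurable borel" using f by (rule test_function_measurable)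
  obtain M R where M: "0 \<le> M" "\<And>x. cmod (partial_deriv i f x) \<le> M * indicator (cball 0 R) x"
    using test_function_bounded[OF test_function_partial_deriv[OF f]] by metis
  have D: "((\<lambda>s. f (x + s *\<^sub>R e)) has_derivative (\<lambda>s. s *\<^sub>R partial_deriv i f (x + t *\<^sub>R e))) (at t)" for x t
  proof -
    have lin: "linear (frechet_derivative f (at y))" for y
      using f smooth_has_derivative has_derivative_linear unfolding test_function_iff by blast
    have "((\<lambda>s. f (x + s *\<^sub>R e)) has_derivative (\<lambda>s. frechet_derivative f (at (x + t *\<^sub>R e)) (s *\<^sub>R e))) (at t)"
      using f by (intro has_derivative_compose[OF _ smooth_has_derivative[of f], of "\<lambda>s. x + s *\<^sub>R e"])
        (auto simp: test_function_iff intro!: derivative_eq_intros)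
    then show ?thesis by (simp add: linear_cmul[OF lin] partial_deriv_def e_def)
  qed
  \<comment> \<open>Mean value inequality on a segment of length \<open>h k \<le> 1\<close>; this
    length is why the radius grows from \<open>R\<close> to \<open>R + 1\<close>.\<close>
  have qb: "cmod (q k x) \<le> M * indicator (cball 0 (R + 1)) x" for k x
  proof -
    have "norm (f (x + h k *\<^sub>R e) - f (x + 0 *\<^sub>R e)) \<le> (M * indicator (cball 0 (R + 1)) x) * norm (h k - 0)"
    proof (rule differentiable_bound[where S = "{0..h k}" and f = "\<lambda>s. f (x + s *\<^sub>R e)"])
      fix t assume t: "t \<in> {0..h k}"
      show "((\<lambda>s. f (x + s *\<^sub>R e)) has_derivative (\<lambda>s. s *\<^sub>R partial_deriv i f (x + t *\<^sub>R e))) (at t within {0..h k})"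
        by (rule has_derivative_at_withinI[OF D])
      show "onorm (\<lambda>s. s *\<^sub>R partial_deriv i f (x + t *\<^sub>R e)) \<le> M * indicator (cball 0 (R + 1)) x"
      proof (rule onorm_le)
        fix s :: real
        have "norm x \<le> norm (x + t *\<^sub>R e) + norm (t *\<^sub>R e)"
          by (metis add_diff_cancel_right' norm_triangle_ineq4)
        then have "norm x \<le> norm (x + t *\<^sub>R e) + 1" using t h[of k] by simp
        then have "M * indicator (cball 0 R) (x + t *\<^sub>R e) \<le> M * indicator (cball 0 (R + 1)) x"
          using M(1) by (auto simp: indicator_def)
        then have "cmod (partial_deriv i f (x + t *\<^sub>R e)) \<le> M * indicator (cball 0 (R + 1)) x"
          using M(2) order_trans by blast
        then show "norm (s *\<^sub>R partial_deriv i f (x + t *\<^sub>R e)) \<le> M * indicator (cball 0 (R + 1)) x * norm s"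
          by (simp add: mult.commute mult_left_mono)
      qed
    qed (use h[of k] in auto)
    then show ?thesis
      using h[of k] by (simp add: q_def norm_divide pos_divide_le_eq)
  qed
  have ql: "(\<lambda>k. q k x) \<longlonglongrightarrow> partial_deriv i f x" for x
  proof -
    have "((\<lambda>s. f (x + s *\<^sub>R e)) has_vector_derivative partial_deriv i f x) (at 0)"
      using D[of x 0] by (simp add: has_vector_derivative_def)
    from has_vector_derivative_sequentially[OF this h0] h(1)
    have "(\<lambda>k. (f (x + h k *\<^sub>R e) - f x) /\<^sub>R h k) \<longlonglongrightarrow> partial_deriv i f x"
      by (simp add: less_imp_neq[symmetric])
    then show ?thesis by (simp add: q_def scaleR_conv_of_real divide_inverse mult.commute)
  qed
  have "(\<lambda>k. LINT x|lborel. q k x * cis (- (x \<bullet> \<xi>))) \<longlonglongrightarrow> (LINT x|lborel. partial_deriv i f x * cis (- (x \<bullet> \<xi>)))"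
  proof (rule integral_dominated_convergence[where w = "\<lambda>x. M * indicator (cball 0 (R + 1)) x"])
    have [measurable]: "partial_deriv i f \<in> borel_measurable borel"
      using f by (intro test_function_measurable test_function_partial_deriv)
    show "(\<lambda>x. partial_deriv i f x * cis (- (x \<bullet> \<xi>))) \<in> borel_measurable lborel"
      "(\<lambda>x. q k x * cis (- (x \<bullet> \<xi>))) \<in> borel_measurable lborel" for k
      unfolding q_def cis_conv_exp by measurable
  qed (auto simp: norm_mult intro!: tendsto_mult ql qb)
  moreover have "(LINT x|lborel. q k x * cis (- (x \<bullet> \<xi>))) =
     (cis (h k * \<xi> $ i) - 1) / of_real (h k) * ?F" for k
  proof -
    have fi: "integrable lborel (\<lambda>x. f x * cis (- (x \<bullet> \<xi>)))"
      using f by (intro integrable_mult_cis test_function_integrable) auto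
    have eq: "f (x + h k *\<^sub>R e) * cis (- (x \<bullet> \<xi>)) =
      cis (h k * \<xi> $ i) * (f (x + h k *\<^sub>R e) * cis (- ((x + h k *\<^sub>R e) \<bullet> \<xi>)))" for x
      by (simp add: inner_add_left e_def inner_axis' cis_mult algebra_simps)
    have fi': "integrable lborel (\<lambda>x. f (x + h k *\<^sub>R e) * cis (- ((x + h k *\<^sub>R e) \<bullet> \<xi>)))"
      using lborel_integrable_affine[OF fi, of 1 "h k *\<^sub>R e"] by (simp add: add.commute)
    have "(LINT x|lborel. q k x * cis (- (x \<bullet> \<xi>))) = (LINT x|lborel.
       (cis (h k * \<xi> $ i) * (f (x + h k *\<^sub>R e) * cis (- ((x + h k *\<^sub>R e) \<bullet> \<xi>))) - f x * cis (- (x \<bullet> \<xi>))) / of_real (h k))"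
      by (simp add: q_def diff_divide_distrib left_diff_distrib eq[symmetric])
    also have "\<dots> = (cis (h k * \<xi> $ i) * (LINT x|lborel. f (x + h k *\<^sub>R e) * cis (- ((x + h k *\<^sub>R e) \<bullet> \<xi>)))
        - ?F) / of_real (h k)"
      using fi fi' by simp
    also have "(LINT x|lborel. f (x + h k *\<^sub>R e) * cis (- ((x + h k *\<^sub>R e) \<bullet> \<xi>))) = ?F"
      by (subst (2) lborel_integral_affine[of 1 _ "h k *\<^sub>R e"]) (simp_all add: add.commute)
    finally show ?thesis by (simp add: algebra_simps diff_divide_distrib)
  qed
  moreover have cl: "(\<lambda>k. (cis (h k * \<xi> $ i) - 1) / of_real (h k)) \<longlonglongrightarrow> \<i> * of_real (\<xi> $ i)"
  proof -
    have "((\<lambda>s. cis (s * \<xi> $ i)) has_vector_derivative (\<i> * of_real (\<xi> $ i))) (at 0)"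
      by (auto intro!: derivative_eq_intros simp: has_vector_derivative_def scaleR_conv_of_real algebra_simps)
    from has_vector_derivative_sequentially[OF this h0] h(1)
    have "(\<lambda>k. (cis (h k * \<xi> $ i) - 1) /\<^sub>R h k) \<longlonglongrightarrow> \<i> * of_real (\<xi> $ i)"
      by (simp add: less_imp_neq[symmetric])
    then show ?thesis by (simp add: scaleR_conv_of_real divide_inverse mult.commute)
  qed
  ultimately have "(\<lambda>k. (cis (h k * \<xi> $ i) - 1) / of_real (h k) * ?F)
     \<longlonglongrightarrow> (LINT x|lborel. partial_deriv i f x * cis (- (x \<bullet> \<xi>)))"
    "(\<lambda>k. (cis (h k * \<xi> $ i) - 1) / of_real (h k) * ?F)
     \<longlonglongrightarrow> \<i> * of_real (\<xi> $ i) * ?F"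
    by (simp_all only: tendsto_mult_right[OF cl])
  then have "(LINT x|lborel. partial_deriv i f x * cis (- (x \<bullet> \<xi>))) = \<i> * of_real (\<xi> $ i) * ?F"
    by (rule LIMSEQ_unique)
  then show ?thesis by (simp add: fourier_def)
qed

section \<open>The Fourier transform of test functions\<close>

text \<open>The sum is at most its number of terms times the largest one, whose power is among the
  summands on the right.\<close>

lemma one_plus_sum_power_le:
  fixes a :: "'i::finite \<Rightarrow> real"
  assumes a: "\<And>i. 0 \<le> a i"
  shows "(1 + (\<Sum>i\<in>UNIV. a i)) ^ M \<le> (1 + real CARD('i)) ^ M * (1 + (\<Sum>i\<in>UNIV. a i ^ M))"
proof -
  have "Max (range a) \<in> range a" by (rule Max_in) auto
  then obtain i where "Max (range a) = a i" by blast
  then have i: "a j \<le> a i" for j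
    using Max_ge[of "range a" "a j"] by auto
  define b where "b = max 1 (a i)"
  have "a j \<le> b" for j using i[of j] by (simp add: b_def)
  then have "(\<Sum>j\<in>UNIV. a j) \<le> real CARD('i) * b"
    using sum_bounded_above[of UNIV a b] by simp
  then have "1 + (\<Sum>j\<in>UNIV. a j) \<le> (1 + real CARD('i)) * b"
    by (simp add: b_def algebra_simps add_mono)
  then have "(1 + (\<Sum>j\<in>UNIV. a j)) ^ M \<le> ((1 + real CARD('i)) * b) ^ M"
    using a by (intro power_mono) (auto simp: sum_nonneg)
  also have "\<dots> = (1 + real CARD('i)) ^ M * b ^ M" by (rule power_mult_distrib)
  also have "b ^ M \<le> 1 + (\<Sum>j\<in>UNIV. a j ^ M)"
  proof -
    have "a i ^ M \<le> (\<Sum>j\<in>UNIV. a j ^ M)" using a by (intro member_le_sum) auto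
    moreover have "b ^ M = 1 \<or> b ^ M = a i ^ M" by (auto simp: b_def max_def)
    moreover have "0 \<le> (\<Sum>j\<in>UNIV. a j ^ M)" using a by (intro sum_nonneg) auto
    ultimately show ?thesis using a by auto
  qed
  finally show ?thesis by (simp add: mult_left_mono)
qed

lemma fourier_bounded:
  fixes f :: "real ^ 'n::finite \<Rightarrow> complex"
  shows "\<exists>D. \<forall>\<xi>. cmod (fourier f \<xi>) \<le> D"
proof -
  have "cmod (fourier f \<xi>) \<le> (1 / (2 * pi)) ^ CARD('n) * (LINT x|lborel. cmod (f x))" for \<xi>
  proof -
    have "cmod (LINT x|lborel. f x * cis (- (x \<bullet> \<xi>))) \<le> (LINT x|lborel. cmod (f x * cis (- (x \<bullet> \<xi>))))"
      by (rule integral_norm_bound)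
    then show ?thesis by (simp add: fourier_def norm_mult norm_power mult_left_mono norm_divide divide_right_mono)
  qed
  then show ?thesis by blast
qed

text \<open>The pure derivatives of order \<open>M\<close> in the coordinate directions bound
  \<open>\<bar>w $ i\<bar> ^ M * cmod (fourier f w)\<close>; as the norm is at most the sum of the
  absolute coordinates, these bounds add up to decay in all directions.\<close>

lemma fourier_decay:
  fixes f :: "real ^ 'n::finite \<Rightarrow> complex"
  assumes f: "test_function f"
  obtains D where "0 \<le> D" "\<And>w. (1 + norm w) ^ M * cmod (fourier f w) \<le> D"
proof -
  have test: "test_function ((partial_deriv i ^^ k) f)" for i k
    by (induction k) (auto simp: f test_function_partial_deriv)
  have eq: "fourier ((partial_deriv i ^^ k) f) w = (\<i> * of_real (w $ i)) ^ k * fourier f w" for i k w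
    by (induction k) (simp_all add: fourier_partial_deriv[OF test])
  have "\<exists>D. \<forall>w. \<bar>w $ i\<bar> ^ M * cmod (fourier f w) \<le> D" for i
    using fourier_bounded[of "(partial_deriv i ^^ M) f"] by (simp add: eq norm_mult norm_power)
  then obtain E where E: "\<And>i w. \<bar>w $ i\<bar> ^ M * cmod (fourier f w) \<le> E i" by metis
  obtain F where F: "\<And>w. cmod (fourier f w) \<le> F" using fourier_bounded[of f] by metis
  have "(1 + norm w) ^ M * cmod (fourier f w) \<le> (1 + real CARD('n)) ^ M * (F + (\<Sum>i\<in>UNIV. E i))" for w
  proof -
    have "(1 + norm w) ^ M \<le> (1 + (\<Sum>i\<in>UNIV. \<bar>w $ i\<bar>)) ^ M"
      by (intro power_mono) (auto simp: norm_le_l1_cart)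
    also have "\<dots> \<le> (1 + real CARD('n)) ^ M * (1 + (\<Sum>i\<in>UNIV. \<bar>w $ i\<bar> ^ M))"
      by (rule one_plus_sum_power_le) simp
    finally have "(1 + norm w) ^ M * cmod (fourier f w) \<le>
      (1 + real CARD('n)) ^ M * (1 + (\<Sum>i\<in>UNIV. \<bar>w $ i\<bar> ^ M)) * cmod (fourier f w)"
      by (simp add: mult_right_mono)
    also have "\<dots> = (1 + real CARD('n)) ^ M * (cmod (fourier f w) + (\<Sum>i\<in>UNIV. \<bar>w $ i\<bar> ^ M * cmod (fourier f w)))"
      by (simp add: algebra_simps sum_distrib_left)
    also have "\<dots> \<le> (1 + real CARD('n)) ^ M * (F + (\<Sum>i\<in>UNIV. E i))"
      using E F by (intro mult_left_mono add_mono sum_mono) auto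
    finally show ?thesis .
  qed
  then show ?thesis
    by (intro that[of "max 0 ((1 + real CARD('n)) ^ M * (F + (\<Sum>i\<in>UNIV. E i)))"]) (auto intro: max.coboundedI2)
qed

lemma fourier_measurable [measurable]:
  assumes [measurable]: "f \<in> borel_measurable borel"
  shows "fourier f \<in> borel_measurable borel"
  unfolding fourier_def[abs_def] cis_conv_exp by measurable

text \<open>The exponent allots two powers to every coordinate, so that the function is dominated by
  a product of one-dimensional functions \<open>inverse (1 + x^2)\<close>.\<close>

lemma integrable_norm_decay:
  "integrable lborel (\<lambda>w::real ^ 'n::finite. 1 / (1 + norm w) ^ (2 * CARD('n)))"
proof (rule integrableI_bounded)
  let ?B = "Basis :: (real ^ 'n) set"
  have 1: "set_integrable lborel UNIV (\<lambda>x::real. inverse (1 + x^2))"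
    using integrable_inverse_1_plus_square by simp
  have fin: "(\<integral>\<^sup>+x. ennreal (inverse (1 + x^2)) \<partial>lborel) < top"
    using 1 by (simp add: set_integrable_def integrable_iff_bounded)
  have "ennreal (norm (1 / (1 + norm w) ^ (2 * CARD('n)))) \<le> (\<Prod>b\<in>?B. ennreal (inverse (1 + (w \<bullet> b)^2)))" for w :: "real ^ 'n"
  proof -
    have "(\<Prod>b\<in>?B. (1 + (w \<bullet> b)^2)) \<le> (\<Prod>b\<in>?B. (1 + norm w) ^ 2)"
    proof (rule prod_mono)
      fix b :: "real ^ 'n" assume "b \<in> ?B"
      then have "\<bar>w \<bullet> b\<bar> \<le> norm w" by (rule Basis_le_norm)
      then have "(w \<bullet> b)^2 \<le> (norm w)^2" by (simp add: abs_le_square_iff[symmetric])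
      then show "0 \<le> 1 + (w \<bullet> b)\<^sup>2 \<and> 1 + (w \<bullet> b)^2 \<le> (1 + norm w)^2" by (simp add: power2_sum add_increasing2)
    qed
    also have "\<dots> = (1 + norm w) ^ (2 * CARD('n))" by (simp add: power_mult)
    finally have "1 / (1 + norm w) ^ (2 * CARD('n)) \<le> 1 / (\<Prod>b\<in>?B. (1 + (w \<bullet> b)^2))"
      by (intro divide_left_mono) (auto intro!: prod_pos mult_pos_pos simp: add_pos_nonneg)
    also have "\<dots> = (\<Prod>b\<in>?B. inverse (1 + (w \<bullet> b)^2))"
      by (simp add: prod_inversef[symmetric] comp_def divide_inverse)
    finally show ?thesis
      by (subst prod_ennreal) (auto simp: abs_of_nonneg intro!: ennreal_leI)
  qed
  then have "(\<integral>\<^sup>+w. ennreal (norm (1 / (1 + norm (w :: real ^ 'n)) ^ (2 * CARD('n)))) \<partial>lborel)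
     \<le> (\<integral>\<^sup>+w. (\<Prod>b\<in>?B. ennreal (inverse (1 + (w \<bullet> b)^2))) \<partial>lborel)"
    by (intro nn_integral_mono) auto
  also have "\<dots> = (\<Prod>b\<in>?B. \<integral>\<^sup>+x. ennreal (inverse (1 + x^2)) \<partial>lborel)"
    by (rule nn_integral_lborel_prod) auto
  also have "\<dots> < \<infinity>"
    using fin by (simp add: power_less_top_ennreal)
  finally show "(\<integral>\<^sup>+w. ennreal (norm (1 / (1 + norm (w :: real ^ 'n)) ^ (2 * CARD('n)))) \<partial>lborel) < \<infinity>" .
qed measurable

lemma integrable_fourier:
  fixes f :: "real ^ 'n::finite \<Rightarrow> complex"
  assumes f: "test_function f"
  shows "integrable lborel (\<lambda>w. A * (1 + norm w) ^ M * cmod (fourier f w))"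
proof -
  obtain D where D: "0 \<le> D" "\<And>w. (1 + norm w) ^ (M + 2 * CARD('n)) * cmod (fourier f w) \<le> D"
    using fourier_decay[OF f] by metis
  have [measurable]: "f \<in> borel_measurable borel" using f by (rule test_function_measurable)
  have "integrable lborel (\<lambda>w. (1 + norm w) ^ M * cmod (fourier f w))"
  proof (rule Bochner_Integration.integrable_bound)
    show "integrable lborel (\<lambda>w::real ^ 'n. D * (1 / (1 + norm w) ^ (2 * CARD('n))))"
      by (intro integrable_mult_right integrable_norm_decay)
    show "AE w in lborel. norm ((1 + norm w) ^ M * cmod (fourier f w)) \<le> norm (D * (1 / (1 + norm w) ^ (2 * CARD('n))))"
    proof (rule AE_I2)
      fix w :: "real ^ 'n"
      have "0 < (1 + norm w) ^ (2 * CARD('n))" by (simp add: add_pos_nonneg)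
      then show "norm ((1 + norm w) ^ M * cmod (fourier f w)) \<le> norm (D * (1 / (1 + norm w) ^ (2 * CARD('n))))"
        using D(1) D(2)[of w] by (simp add: abs_mult pos_le_divide_eq power_add algebra_simps)
    qed
  qed measurable
  from integrable_mult_right[OF this, of A] show ?thesis by (simp add: mult.assoc)
qed

definition poly_growth :: "(real ^ 'n::finite \<Rightarrow> complex) \<Rightarrow> bool" where
  "poly_growth m \<longleftrightarrow> (\<exists>A N. \<forall>\<xi>. cmod (m \<xi>) \<le> A * (1 + norm \<xi>) ^ N)"

lemma poly_growth_bounded: "(\<And>\<xi>. cmod (m \<xi>) \<le> A) \<Longrightarrow> poly_growth m"
  unfolding poly_growth_def by (intro exI[of _ A] exI[of _ 0]) simp

lemma integrable_mult_fourier: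
  assumes m: "m \<in> borel_measurable borel" "poly_growth m" and f: "test_function f"
  shows "integrable lborel (\<lambda>w. m w * fourier f w)"
proof -
  obtain A N where A: "\<And>w. cmod (m w) \<le> A * (1 + norm w) ^ N" using m(2) unfolding poly_growth_def by blast
  have [measurable]: "f \<in> borel_measurable borel" "m \<in> borel_measurable borel" using m test_function_measurable[OF f] by simp_all
  show ?thesis
  proof (rule Bochner_Integration.integrable_bound[OF integrable_fourier[OF f, of A N]])
    show "AE w in lborel. norm (m w * fourier f w) \<le> norm (A * (1 + norm w) ^ N * cmod (fourier f w))"
      using mult_right_mono[OF A norm_ge_zero] by (intro AE_I2) (auto simp: norm_mult intro: order_trans[OF _ abs_ge_self])
  qed measurable
qed

section \<open>Gaussians and Fourier inversion\<close>

lemma lborel_integral_prod: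
  fixes f :: "'a::euclidean_space \<Rightarrow> real \<Rightarrow> 'b::{real_normed_field,banach,second_countable_topology}"
  assumes f: "\<And>b. b \<in> Basis \<Longrightarrow> integrable lborel (f b)"
  shows "integrable lborel (\<lambda>x. \<Prod>b\<in>Basis. f b (x \<bullet> b))"
    and "(LINT x|lborel. (\<Prod>b\<in>Basis. f b (x \<bullet> b))) = (\<Prod>b\<in>Basis. (LINT x|lborel. f b x))"
proof -
  interpret product_sigma_finite "\<lambda>_::'a. lborel :: real measure" by standard
  have [measurable]: "\<And>b. b \<in> Basis \<Longrightarrow> f b \<in> borel_measurable borel" using f by auto
  have inner: "(\<Sum>b\<in>Basis. x b *\<^sub>R b) \<bullet> b = x b" if "b \<in> Basis" for b :: 'a and x
    using that by simp
  have *: "(\<Prod>b\<in>Basis. f b ((\<Sum>c\<in>Basis. x c *\<^sub>R c) \<bullet> b)) = (\<Prod>b\<in>Basis. f b (x b))" for x :: "'a \<Rightarrow> real"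
    by (intro prod.cong refl) (simp add: inner)
  show "integrable lborel (\<lambda>x. \<Prod>b\<in>Basis. f b (x \<bullet> b))"
    by (subst lborel_eq, subst integrable_distr_eq) (auto simp only: * intro!: product_integrable_prod f, measurable)
  show "(LINT x|lborel. (\<Prod>b\<in>Basis. f b (x \<bullet> b))) = (\<Prod>b\<in>Basis. (LINT x|lborel. f b x))"
    by (subst lborel_eq, subst integral_distr) (auto simp only: * intro!: product_integral_prod f finite_Basis, measurable)
qed

text \<open>Up to the factor \<open>sqrt (2 * pi)\<close> this is the characteristic function of the
  standard normal distribution.\<close>

lemma gauss_fourier_real:
  shows "integrable lborel (\<lambda>x::real. complex_of_real (exp (- x\<^sup>2 / 2)) * cis (x * t))"
    and "(LINT x|lborel. complex_of_real (exp (- x\<^sup>2 / 2)) * cis (x * t)) = of_real (sqrt (2 * pi) * exp (- t\<^sup>2 / 2))"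
proof -
  have e: "complex_of_real (exp (- x\<^sup>2 / 2)) * cis (x * t) = of_real (sqrt (2 * pi)) * (std_normal_density x *\<^sub>R iexp (t * x))" for x
    by (simp add: std_normal_density_def cis_conv_exp scaleR_conv_of_real mult_ac)
  have i: "integrable lborel (\<lambda>x. std_normal_density x *\<^sub>R iexp (t * x))"
  proof (rule Bochner_Integration.integrable_bound)
    show "integrable lborel std_normal_density" by (rule integrable_normal_density) simp
  qed (auto simp: norm_mult)
  then show "integrable lborel (\<lambda>x::real. complex_of_real (exp (- x\<^sup>2 / 2)) * cis (x * t))"
    unfolding e by (rule integrable_mult_right)
  have "(LINT x|lborel. std_normal_density x *\<^sub>R iexp (t * x)) = char std_normal_distribution t"
    unfolding char_def by (subst integral_density) auto
  then show "(LINT x|lborel. complex_of_real (exp (- x\<^sup>2 / 2)) * cis (x * t)) = of_real (sqrt (2 * pi) * exp (- t\<^sup>2 / 2))"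
    unfolding e by (simp only: integral_mult_right_zero char_std_normal_distribution) simp
qed

text \<open>Left unnormalised, so that \<open>gauss (e *\<^sub>R w)\<close> tends to 1 as
  \<open>e\<close> tends to 0 and can serve as a convergence factor.\<close>

definition gauss :: "'a::euclidean_space \<Rightarrow> real" where
  "gauss x = exp (- (norm x)\<^sup>2 / 2)"

lemma gauss_prod: "gauss x = (\<Prod>b\<in>Basis. exp (- (x \<bullet> b)\<^sup>2 / 2))"
proof -
  have "(norm x)\<^sup>2 = (\<Sum>b\<in>Basis. (x \<bullet> b)\<^sup>2)"
    unfolding power2_norm_eq_inner by (subst euclidean_inner) (simp add: power2_eq_square)
  then show ?thesis
    by (simp add: gauss_def exp_sum[symmetric] sum_negf sum_divide_distrib)
qed

lemma cis_inner_prod: "cis (x \<bullet> y) = (\<Prod>b\<in>Basis. cis ((x \<bullet> b) * (y \<bullet> b)))"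
  unfolding cis_conv_exp by (subst euclidean_inner) (simp add: exp_sum[symmetric] sum_distrib_left)

lemma gauss_measurable [measurable]: "gauss \<in> borel_measurable borel"
  unfolding gauss_def[abs_def] by measurable

lemma gauss_fourier:
  fixes y :: "'a::euclidean_space"
  shows "integrable lborel (\<lambda>x. complex_of_real (gauss x) * cis (x \<bullet> y))"
    and "(LINT x|lborel. complex_of_real (gauss x) * cis (x \<bullet> y)) = of_real (sqrt (2 * pi) ^ DIM('a) * gauss y)"
proof -
  have e: "complex_of_real (gauss x) * cis (x \<bullet> y) =
      (\<Prod>b\<in>Basis. complex_of_real (exp (- (x \<bullet> b)\<^sup>2 / 2)) * cis ((x \<bullet> b) * (y \<bullet> b)))" for x
    by (simp add: gauss_prod cis_inner_prod prod.distrib)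
  show "integrable lborel (\<lambda>x. complex_of_real (gauss x) * cis (x \<bullet> y))"
    unfolding e by (rule lborel_integral_prod(1)) (rule gauss_fourier_real(1))
  show "(LINT x|lborel. complex_of_real (gauss x) * cis (x \<bullet> y)) = of_real (sqrt (2 * pi) ^ DIM('a) * gauss y)"
    unfolding e by (subst lborel_integral_prod(2)[OF gauss_fourier_real(1)])
      (simp_all only: gauss_fourier_real(2), simp add: gauss_prod prod.distrib)
qed

lemma gauss_integrable: "integrable lborel (gauss :: 'a::euclidean_space \<Rightarrow> real)"
  using integrable_norm[OF gauss_fourier(1)[of "0::'a"]] by (simp add: norm_mult gauss_def[abs_def])

lemma gauss_integral: "(LINT x|lborel. complex_of_real (gauss (x :: 'a::euclidean_space))) = of_real (sqrt (2 * pi) ^ DIM('a))"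
  using gauss_fourier(2)[of "0::'a"] by (simp add: gauss_def)

text \<open>The Gaussian factor makes the double integral absolutely convergent, which allows
  Fubini; the inner integral over frequencies is then a Gaussian of width \<open>e\<close> centred
  at \<open>x\<close>.\<close>

lemma fourier_gauss_regularised:
  fixes f :: "real ^ 'n::finite \<Rightarrow> complex"
  assumes f: "test_function f" and e: "0 < e"
  shows "(LINT w|lborel. fourier f w * cis (x \<bullet> w) * of_real (gauss (e *\<^sub>R w))) =
    (LINT z|lborel. f (x + e *\<^sub>R z) * of_real (gauss z)) / of_real (sqrt (2 * pi) ^ CARD('n))"
proof -
  let ?E = "\<lambda>y w. cis ((x - y) \<bullet> w) * complex_of_real (gauss (e *\<^sub>R w))"
  define c where "c = complex_of_real ((1 / (2 * pi)) ^ CARD('n))"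
  have [measurable]: "f \<in> borel_measurable borel" using f by (rule test_function_measurable)
  have ge: "integrable lborel (\<lambda>w::real ^ 'n. gauss (e *\<^sub>R w))"
    using lborel_integrable_affine[OF gauss_integrable, of e 0] e by simp
  have I: "integrable (lborel \<Otimes>\<^sub>M lborel) (\<lambda>(y, w). f y * ?E y w)"
  proof (rule lborel_pair.Fubini_integrable)
    show "(\<lambda>(y, w). f y * ?E y w) \<in> borel_measurable (lborel \<Otimes>\<^sub>M lborel)"
      unfolding cis_conv_exp by measurable
    have "integrable lborel (\<lambda>y. cmod (f y) * (LINT w|lborel. gauss (e *\<^sub>R (w :: real ^ 'n))))"
      using test_function_integrable[OF f] by (intro integrable_mult_left integrable_norm)
    then show "integrable lborel (\<lambda>y. LINT w|lborel. norm (case (y, w) of (y, w) \<Rightarrow> f y * ?E y w))"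
      by (simp add: norm_mult gauss_def)
    show "AE y in lborel. integrable lborel (\<lambda>w. case (y, w) of (y, w) \<Rightarrow> f y * ?E y w)"
    proof (rule AE_I2)
      fix y
      have "integrable lborel (\<lambda>w. f y * (of_real (gauss (e *\<^sub>R w)) * cis ((x - y) \<bullet> w)))"
        by (intro integrable_mult_right integrable_mult_cis integrable_of_real ge) measurable
      then show "integrable lborel (\<lambda>w. case (y, w) of (y, w) \<Rightarrow> f y * ?E y w)"
        by (simp only: prod.case mult.commute[of "cis _"])
    qed
  qed
  have "(LINT w|lborel. fourier f w * cis (x \<bullet> w) * of_real (gauss (e *\<^sub>R w))) =
      (LINT w|lborel. c * (LINT y|lborel. f y * ?E y w))"
  proof (rule Bochner_Integration.integral_cong[OF refl])
    fix w
    have "fourier f w * cis (x \<bullet> w) * of_real (gauss (e *\<^sub>R w)) =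
       c * ((LINT y|lborel. f y * cis (- (y \<bullet> w))) * (cis (x \<bullet> w) * of_real (gauss (e *\<^sub>R w))))"
      by (simp add: fourier_def c_def)
    also have "(LINT y|lborel. f y * cis (- (y \<bullet> w))) * (cis (x \<bullet> w) * of_real (gauss (e *\<^sub>R w)))
      = (LINT y|lborel. f y * cis (- (y \<bullet> w)) * (cis (x \<bullet> w) * of_real (gauss (e *\<^sub>R w))))"
      by (rule integral_mult_left_zero[symmetric])
    also have "\<dots> = (LINT y|lborel. f y * ?E y w)"
    proof (rule Bochner_Integration.integral_cong[OF refl])
      fix y show "f y * cis (- (y \<bullet> w)) * (cis (x \<bullet> w) * of_real (gauss (e *\<^sub>R w))) =
          f y * ?E y w"
        by (simp only: mult.assoc[symmetric] cis_mult inner_diff_left) (simp only: mult.assoc cis_mult, simp)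
    qed
    finally show "fourier f w * cis (x \<bullet> w) * of_real (gauss (e *\<^sub>R w)) =
      c * (LINT y|lborel. f y * ?E y w)" .
  qed
  also have "\<dots> = c * (LINT y|lborel. LINT w|lborel. f y * ?E y w)"
    using lborel_pair.Fubini_integral[OF I] by simp
  also have "\<dots> = c * (LINT y|lborel. f y * (of_real (sqrt (2 * pi) ^ CARD('n) / e ^ CARD('n) * gauss ((x - y) /\<^sub>R e))))"
  proof -
    have "(LINT w|lborel. cis ((x - y) \<bullet> w) * of_real (gauss (e *\<^sub>R w))) = of_real (sqrt (2 * pi) ^ CARD('n) / e ^ CARD('n) * gauss ((x - y) /\<^sub>R e))" for y
    proof -
      have e': "inverse e * (e * t) = t" for t using e by simp
      have "of_real (sqrt (2 * pi) ^ CARD('n) * gauss ((x - y) /\<^sub>R e)) = (LINT \<eta>|lborel. complex_of_real (gauss \<eta>) * cis (\<eta> \<bullet> ((x - y) /\<^sub>R e)))"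
        by (subst gauss_fourier(2)) simp
      also have "\<dots> = \<bar>e\<bar> ^ CARD('n) *\<^sub>R (LINT w|lborel. cis ((x - y) \<bullet> w) * of_real (gauss (e *\<^sub>R w)))"
        using e by (subst lborel_integral_affine[of e _ 0]) (simp_all add: inner_commute mult.commute e')
      finally show ?thesis using e by (simp add: scaleR_conv_of_real field_simps)
    qed
    then show ?thesis by simp
  qed
  \<comment> \<open>Substitution \<open>y = x + e *\<^sub>R z\<close>; the sign of \<open>z\<close>
    disappears because \<open>gauss\<close> is even.\<close>
  also have "(LINT y|lborel. f y * (of_real (sqrt (2 * pi) ^ CARD('n) / e ^ CARD('n) * gauss ((x - y) /\<^sub>R e)))) =
     \<bar>e\<bar> ^ CARD('n) *\<^sub>R (LINT z|lborel. f (x + e *\<^sub>R z) * (of_real (sqrt (2 * pi) ^ CARD('n) / e ^ CARD('n) * gauss z)))"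
    using e by (subst lborel_integral_affine[of e _ x]) (simp_all add: gauss_def)
  also have "\<dots> = of_real (sqrt (2 * pi) ^ CARD('n)) * (LINT z|lborel. f (x + e *\<^sub>R z) * of_real (gauss z))"
  proof -
    have "f (x + e *\<^sub>R z) * (of_real (sqrt (2 * pi) ^ CARD('n) / e ^ CARD('n) * gauss z)) =
       of_real (sqrt (2 * pi) ^ CARD('n) / e ^ CARD('n)) * (f (x + e *\<^sub>R z) * of_real (gauss z))" for z
      by simp
    then show ?thesis using e by (simp only: integral_mult_right_zero) (simp add: scaleR_conv_of_real)
  qed
  also have "c * (of_real (sqrt (2 * pi) ^ CARD('n)) * (LINT z|lborel. f (x + e *\<^sub>R z) * of_real (gauss z)))
    = (LINT z|lborel. f (x + e *\<^sub>R z) * of_real (gauss z)) / of_real (sqrt (2 * pi) ^ CARD('n))"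
  proof -
    have "(1 / (2 * pi)) ^ CARD('n) * sqrt (2 * pi) ^ CARD('n) = 1 / sqrt (2 * pi) ^ CARD('n)"
    proof -
      have "(1 / (r * r)) ^ k * r ^ k = 1 / r ^ k" if "0 < r" for r :: real and k
        using that by (simp add: power_divide power_mult_distrib)
      from this[of "sqrt (2 * pi)" "CARD('n)"] show ?thesis by simp
    qed
    then have "complex_of_real ((1 / (2 * pi)) ^ CARD('n) * sqrt (2 * pi) ^ CARD('n)) = of_real (1 / sqrt (2 * pi) ^ CARD('n))"
      by (rule arg_cong)
    then have "c * of_real (sqrt (2 * pi) ^ CARD('n)) = 1 / of_real (sqrt (2 * pi) ^ CARD('n))"
      by (simp only: c_def of_real_mult of_real_divide of_real_1)
    then show ?thesis by (simp add: mult.assoc[symmetric])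
  qed
  finally show ?thesis .
qed

text \<open>As the regularisation is removed, the frequency side converges because
  \<open>fourier f\<close> is integrable, and the space side because \<open>f\<close> is continuous
  and bounded, with limit \<open>f x\<close> times the mass of the Gaussian.\<close>

lemma fourier_inversion:
  fixes f :: "real ^ 'n::finite \<Rightarrow> complex"
  assumes f: "test_function f"
  shows "(LINT y|lborel. fourier f y * cis (x \<bullet> y)) = f x"
proof -
  define h where "h k = inverse (real (Suc k))" for k
  have h: "0 < h k" for k by (simp add: h_def)
  have h0: "h \<longlonglongrightarrow> 0" unfolding h_def[abs_def] by (rule LIMSEQ_inverse_real_of_nat)
  have [measurable]: "f \<in> borel_measurable borel" using f by (rule test_function_measurable)
  have fi: "integrable lborel (fourier f)"
    using integrable_mult_fourier[OF _ poly_growth_bounded f, of "\<lambda>_. 1" 1] by simp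
  have "(\<lambda>k. LINT y|lborel. fourier f y * cis (x \<bullet> y) * of_real (gauss (h k *\<^sub>R y))) \<longlonglongrightarrow>
      (LINT y|lborel. fourier f y * cis (x \<bullet> y))"
  proof (rule integral_dominated_convergence[where w = "\<lambda>y. cmod (fourier f y)"])
    show "(\<lambda>y. fourier f y * cis (x \<bullet> y)) \<in> borel_measurable lborel"
      "(\<lambda>y. fourier f y * cis (x \<bullet> y) * of_real (gauss (h k *\<^sub>R y))) \<in> borel_measurable lborel" for k
      unfolding cis_conv_exp by measurable
    show "AE y in lborel. (\<lambda>k. fourier f y * cis (x \<bullet> y) * of_real (gauss (h k *\<^sub>R y))) \<longlonglongrightarrow> fourier f y * cis (x \<bullet> y)"
      unfolding gauss_def by (intro AE_I2) (auto intro!: tendsto_eq_intros h0)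
    show "AE y in lborel. norm (fourier f y * cis (x \<bullet> y) * of_real (gauss (h k *\<^sub>R y))) \<le> cmod (fourier f y)" for k
      by (intro AE_I2) (auto simp: norm_mult gauss_def intro!: mult_left_le)
  qed (use fi in simp)
  moreover have "(\<lambda>k. (LINT z|lborel. f (x + h k *\<^sub>R z) * of_real (gauss z)) / of_real (sqrt (2 * pi) ^ CARD('n))) \<longlonglongrightarrow>
      (LINT z|lborel. f x * of_real (gauss (z :: real ^ 'n))) / of_real (sqrt (2 * pi) ^ CARD('n))"
  proof (intro tendsto_divide tendsto_const)
    obtain M where M': "\<And>x. cmod (f x) \<le> M"
        using test_function_norm_le[OF f] by metis
    show "(\<lambda>k. LINT z|lborel. f (x + h k *\<^sub>R z) * of_real (gauss z)) \<longlonglongrightarrow> (LINT z|lborel. f x * of_real (gauss (z :: real ^ 'n)))"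
    proof (rule integral_dominated_convergence[where w = "\<lambda>z. M * gauss z"])
      show "AE z in lborel. (\<lambda>k. f (x + h k *\<^sub>R z) * of_real (gauss z)) \<longlonglongrightarrow> f x * of_real (gauss z)"
      proof (rule AE_I2)
        fix z :: "real ^ 'n"
        have "isCont f x" using test_function_continuous[OF f] by (simp add: continuous_on_eq_continuous_at)
        moreover have "(\<lambda>k. x + h k *\<^sub>R z) \<longlonglongrightarrow> x" by (auto intro!: tendsto_eq_intros h0)
        ultimately have "(\<lambda>k. f (x + h k *\<^sub>R z)) \<longlonglongrightarrow> f x" by (rule isCont_tendsto_compose)
        then show "(\<lambda>k. f (x + h k *\<^sub>R z) * of_real (gauss z)) \<longlonglongrightarrow> f x * of_real (gauss z)"
          by (intro tendsto_mult tendsto_const)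
      qed
      show "AE z in lborel. norm (f (x + h k *\<^sub>R z) * of_real (gauss z)) \<le> M * gauss z" for k
        using M' by (intro AE_I2) (auto simp: norm_mult gauss_def)
    qed (simp_all add: gauss_integrable)
  qed simp
  moreover have "(LINT z|lborel. f x * of_real (gauss (z :: real ^ 'n))) / of_real (sqrt (2 * pi) ^ CARD('n)) = f x"
    by (simp only: integral_mult_right_zero gauss_integral) simp
  ultimately show ?thesis
    unfolding fourier_gauss_regularised[OF f h] by (simp add: LIMSEQ_unique)
qed

lemma fourier_modulate: "fourier (\<lambda>x. cis (x \<bullet> v) * f x) \<xi> = fourier f (\<xi> - v)"
proof -
  have "cis (x \<bullet> v) * f x * cis (- (x \<bullet> \<xi>)) = f x * cis (- (x \<bullet> (\<xi> - v)))" for x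
    by (simp add: cis_mult mult_ac inner_diff_right)
  then show ?thesis by (simp only: fourier_def)
qed

lemma fourier_scale:
  fixes f :: "real ^ 'n::finite \<Rightarrow> complex"
  assumes k: "k \<noteq> 0"
  shows "fourier (\<lambda>x. f (k *\<^sub>R x)) (k *\<^sub>R \<xi>) = of_real (inverse (\<bar>k\<bar> ^ CARD('n))) * fourier f \<xi>"
proof -
  have "(LINT x|lborel. f x * cis (- (x \<bullet> \<xi>))) = \<bar>k\<bar> ^ CARD('n) *\<^sub>R (LINT x|lborel. f (k *\<^sub>R x) * cis (- (x \<bullet> (k *\<^sub>R \<xi>))))"
    using k by (subst lborel_integral_affine[of k _ 0]) simp_all
  then show ?thesis using k by (simp add: fourier_def scaleR_conv_of_real)
qed

section \<open>Dilations and constants as multipliers\<close>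

text \<open>A nonempty open set is not null. This upgrades bounds almost everywhere to pointwise
  bounds for continuous functions.\<close>

lemma AE_lborel_open:
  fixes P :: "'a::euclidean_space \<Rightarrow> bool"
  assumes "AE x in lborel. P x" and "open {x. \<not> P x}"
  shows "P x"
proof (rule ccontr)
  assume "\<not> P x"
  then have "\<not> negligible {x. \<not> P x}" using assms(2) by (intro open_not_negligible) auto
  moreover have "{x. \<not> P x} \<in> null_sets lborel"
    using assms by (subst AE_iff_null_sets) (auto simp: borel_open)
  then have "negligible {x. \<not> P x}"
    by (simp add: negligible_iff_null_sets null_sets_completionI)
  ultimately show False by simp
qed

lemma integrable_lborel_prod_mult:
  fixes a :: "'a::euclidean_space \<Rightarrow> 'c::{real_normed_field, banach, second_countable_topology}"
    and b :: "'b::euclidean_space \<Rightarrow> 'c"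
  assumes a: "integrable lborel a" and b: "integrable lborel b"
  shows "integrable (lborel \<Otimes>\<^sub>M lborel) (\<lambda>(x, y). a x * b y)"
proof (rule lborel_pair.Fubini_integrable)
  have [measurable]: "a \<in> borel_measurable borel" "b \<in> borel_measurable borel" using a b by auto
  show "(\<lambda>(x, y). a x * b y) \<in> borel_measurable (lborel \<Otimes>\<^sub>M lborel)" by measurable
qed (use a b in \<open>simp_all add: norm_mult\<close>)

lemma Lp_integral_scale:
  fixes f :: "real ^ 'n::finite \<Rightarrow> complex"
  assumes k: "k \<noteq> 0"
  shows "(LINT x|lborel. cmod (f x) powr p) = \<bar>k\<bar> ^ CARD('n) * (LINT x|lborel. cmod (f (k *\<^sub>R x)) powr p)"
  using lborel_integral_affine[OF k, of "\<lambda>x. cmod (f x) powr p" 0] by simp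

lemma Lp_scale:
  assumes "f \<in> Lp p" "k \<noteq> 0"
  shows "(\<lambda>x. f (k *\<^sub>R x)) \<in> Lp p"
proof -
  have [measurable]: "f \<in> borel_measurable borel" using assms by (simp add: Lp_def)
  show ?thesis
    using lborel_integrable_affine[of "\<lambda>x. cmod (f x) powr p" k 0] assms by (simp add: Lp_def)
qed

lemma multiplier_op_scale:
  fixes m :: "real ^ 'n::finite \<Rightarrow> complex"
  assumes k: "k \<noteq> 0"
  shows "multiplier_op m (\<lambda>y. f (k *\<^sub>R y)) x = multiplier_op (\<lambda>\<xi>. m (k *\<^sub>R \<xi>)) f (k *\<^sub>R x)"
proof -
  have "multiplier_op m (\<lambda>y. f (k *\<^sub>R y)) x = \<bar>k\<bar> ^ CARD('n) *\<^sub>R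
      (LINT \<xi>|lborel. m (k *\<^sub>R \<xi>) * fourier (\<lambda>y. f (k *\<^sub>R y)) (k *\<^sub>R \<xi>) * cis (x \<bullet> (k *\<^sub>R \<xi>)))"
    unfolding multiplier_op_def using k by (subst lborel_integral_affine[of k _ 0]) simp_all
  also have "\<dots> = \<bar>k\<bar> ^ CARD('n) *\<^sub>R (LINT \<xi>|lborel. of_real (inverse (\<bar>k\<bar> ^ CARD('n))) *
      (m (k *\<^sub>R \<xi>) * fourier f \<xi> * cis ((k *\<^sub>R x) \<bullet> \<xi>)))"
    by (simp add: fourier_scale[OF k] mult_ac)
  also have "\<dots> = multiplier_op (\<lambda>\<xi>. m (k *\<^sub>R \<xi>)) f (k *\<^sub>R x)"
    unfolding integral_mult_right_zero multiplier_op_def using k by (simp add: scaleR_conv_of_real)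
  finally show ?thesis .
qed

lemma multiplier_op_modulate:
  fixes m :: "real ^ 'n::finite \<Rightarrow> complex"
  shows "multiplier_op m (\<lambda>y. cis (y \<bullet> v) * f y) x = cis (x \<bullet> v) * multiplier_op (\<lambda>\<xi>. m (v + \<xi>)) f x"
proof -
  have "multiplier_op m (\<lambda>y. cis (y \<bullet> v) * f y) x =
      (LINT \<xi>|lborel. m (v + \<xi>) * fourier f \<xi> * cis (x \<bullet> (v + \<xi>)))"
    unfolding multiplier_op_def fourier_modulate
    by (subst lborel_integral_affine[of 1 _ v]) simp_all
  also have "\<dots> = (LINT \<xi>|lborel. cis (x \<bullet> v) * (m (v + \<xi>) * fourier f \<xi> * cis (x \<bullet> \<xi>)))"
    by (simp add: inner_add_right cis_mult[symmetric] mult_ac)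
  finally show ?thesis by (simp add: multiplier_op_def)
qed

text \<open>The dilated symbol belongs to the operator conjugated by a dilation. The Jacobian
  appears on both sides of the inequality between p-th powers and cancels. Negative \<open>k\<close>
  is allowed because the frequencies \<open>2 * real j - real n\<close> have both signs.\<close>

lemma Lp_bounds_scale:
  fixes m :: "real ^ 'n::finite \<Rightarrow> complex"
  assumes p: "0 < p" and k: "k \<noteq> 0" and C: "C \<in> Lp_bounds p (multiplier_op m)"
  shows "C \<in> Lp_bounds p (multiplier_op (\<lambda>\<xi>. m (k *\<^sub>R \<xi>)))"
proof -
  obtain S where S: "Lp_extension p (multiplier_op m) S" "\<And>f. f \<in> Lp p \<Longrightarrow> Lp_norm p (S f) \<le> C * Lp_norm p f"
    and C0: "0 \<le> C"
    using C by (auto simp: Lp_bounds_def)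
  define V where "V f x = S (\<lambda>y. f (k *\<^sub>R y)) (inverse k *\<^sub>R x)" for f x
  have k': "inverse k \<noteq> 0" using k by simp
  have "Lp_extension p (multiplier_op (\<lambda>\<xi>. m (k *\<^sub>R \<xi>))) V"
    unfolding Lp_extension_def
  proof (intro conjI ballI allI impI)
    show "V f \<in> Lp p" if f: "f \<in> Lp p" for f
    proof -
      have "S (\<lambda>y. f (k *\<^sub>R y)) \<in> Lp p" using S(1) Lp_scale[OF f k] by (auto simp: Lp_extension_def)
      from Lp_scale[OF this k'] show ?thesis by (simp add: V_def[abs_def])
    qed
    show "AE x in lborel. V (\<lambda>y. a * f y + b * g y) x = a * V f x + b * V g x"
      if f: "f \<in> Lp p" and g: "g \<in> Lp p" for f g a b
    proof -
      have "AE x in lborel. S (\<lambda>y. a * f (k *\<^sub>R y) + b * g (k *\<^sub>R y)) x = a * S (\<lambda>y. f (k *\<^sub>R y)) x + b * S (\<lambda>y. g (k *\<^sub>R y)) x"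
        using S(1) Lp_scale[OF f k] Lp_scale[OF g k] by (auto simp: Lp_extension_def)
      from AE_lborel_affine[OF k' this, of 0] show ?thesis by (simp add: V_def)
    qed
    show "AE x in lborel. V f x = multiplier_op (\<lambda>\<xi>. m (k *\<^sub>R \<xi>)) f x" if f: "test_function f" for f
    proof -
      have "AE x in lborel. S (\<lambda>y. f (k *\<^sub>R y)) x = multiplier_op m (\<lambda>y. f (k *\<^sub>R y)) x"
        using S(1) test_function_scale[OF f k] by (auto simp: Lp_extension_def)
      from AE_lborel_affine[OF k' this, of 0] show ?thesis
        using k by (simp add: V_def multiplier_op_scale[OF k])
    qed
  qed
  moreover have "Lp_norm p (V f) \<le> C * Lp_norm p f" if f: "f \<in> Lp p" for f
  proof -
    have "(LINT x|lborel. cmod (S (\<lambda>y. f (k *\<^sub>R y)) x) powr p) \<le> C powr p * (LINT x|lborel. cmod (f (k *\<^sub>R x)) powr p)"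
      using S(2)[OF Lp_scale[OF f k]] by (simp add: Lp_norm_le_iff[OF p C0])
    then have "\<bar>k\<bar> ^ CARD('n) * (LINT x|lborel. cmod (V f (k *\<^sub>R x)) powr p)
       \<le> \<bar>k\<bar> ^ CARD('n) * (C powr p * (LINT x|lborel. cmod (f (k *\<^sub>R x)) powr p))"
      using k by (intro mult_left_mono) (simp_all add: V_def)
    then show ?thesis
      unfolding Lp_norm_le_iff[OF p C0] Lp_integral_scale[OF k, of "V f"] Lp_integral_scale[OF k, of f]
      by (simp add: mult_ac)
  qed
  ultimately show ?thesis using C0 by (auto simp: Lp_bounds_def)
qed

text \<open>If the only test function were \<open>0\<close>, every bound would hold trivially. Carrying this case along
  makes the construction of a nonzero test function superfluous.\<close>

lemma Lp_bounds_const: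
  assumes p: "1 \<le> p" and C0: "0 \<le> C"
    and C: "\<And>f :: real ^ 'n::finite \<Rightarrow> complex. test_function f \<Longrightarrow> f \<noteq> (\<lambda>_. 0) \<Longrightarrow> cmod c \<le> C"
  shows "C \<in> Lp_bounds p (multiplier_op (\<lambda>_ :: real ^ 'n. c))"
proof -
  \<comment> \<open>If \<open>c\<close> violates the bound, the assumption leaves 0 as the only test
    function, and multiplication by 0 is an extension.\<close>
  define d where "d = (if cmod c \<le> C then c else 0)"
  have d: "cmod d \<le> C" using C0 by (simp add: d_def)
  have lin: "(\<lambda>x. d * f x) \<in> Lp p" if "f \<in> Lp p" for f :: "real ^ 'n \<Rightarrow> complex"
    using Lp_linear[OF p that that, of d 0] by simp
  have "multiplier_op (\<lambda>_. c) f x = d * f x" if f: "test_function f" for f :: "real ^ 'n \<Rightarrow> complex" and x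
  proof -
    have "multiplier_op (\<lambda>_. c) f x = c * f x"
      using fourier_inversion[OF f, of x] by (simp add: multiplier_op_def mult.assoc)
    then show ?thesis using C[OF f] by (cases "f = (\<lambda>_. 0)") (auto simp: d_def)
  qed
  then have "Lp_extension p (multiplier_op (\<lambda>_. c)) (\<lambda>(f :: real ^ 'n \<Rightarrow> complex) x. d * f x)"
    using lin by (simp add: Lp_extension_def algebra_simps)
  moreover have "Lp_norm p (\<lambda>x. d * f x) \<le> C * Lp_norm p f" for f :: "real ^ 'n \<Rightarrow> complex"
  proof -
    have "(LINT x|lborel. cmod (d * f x) powr p) = cmod d powr p * (LINT x|lborel. cmod (f x) powr p)"
      by (simp add: norm_mult powr_mult)
    also have "\<dots> \<le> C powr p * (LINT x|lborel. cmod (f x) powr p)"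
      using d p by (intro mult_right_mono powr_mono2) auto
    finally show ?thesis using p C0 by (subst Lp_norm_le_iff) auto
  qed
  ultimately show ?thesis using C0 by (auto simp: Lp_bounds_def)
qed

section \<open>Continuity of translations in a weighted L1 space\<close>

lemma one_plus_norm_add_le: "1 + norm (x + y) \<le> (1 + norm x) * (1 + norm y)"
proof -
  have "0 \<le> norm x * norm y" by simp
  then have "1 + norm (x + y) \<le> 1 + norm x + norm y + norm x * norm y"
    using norm_triangle_ineq[of x y] by linarith
  then show ?thesis by (simp add: algebra_simps)
qed

text \<open>\<open>N\<close> powers absorb the growth of the symbol, and the remaining
  \<open>2 * CARD('n)\<close> leave an integrable function.\<close>

definition weight :: "nat \<Rightarrow> real ^ 'n::finite \<Rightarrow> real" where
  "weight N x = 1 / (1 + norm x) ^ (N + 2 * CARD('n))"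

lemma weight_pos: "0 < weight N x"
  by (simp add: weight_def add_pos_nonneg)

lemma weight_measurable [measurable]: "weight N \<in> borel_measurable borel"
  unfolding weight_def[abs_def] by measurable

lemma weight_shift: "weight N (x - v) \<le> (1 + norm v) ^ (N + 2 * CARD('n)) * weight N (x :: real ^ 'n::finite)"
proof -
  have "(1 + norm x) ^ (N + 2 * CARD('n)) \<le> ((1 + norm (x - v)) * (1 + norm v)) ^ (N + 2 * CARD('n))"
    using one_plus_norm_add_le[of "x - v" v] by (intro power_mono) simp_all
  moreover have "0 < (1 + norm x) ^ (N + 2 * CARD('n))" "0 < (1 + norm (x - v)) ^ (N + 2 * CARD('n))"
    by (simp_all add: add_pos_nonneg)
  ultimately show ?thesis unfolding weight_def by (simp only: power_mult_distrib) (simp add: field_simps)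
qed

lemma growth_weight:
  fixes x v :: "real ^ 'n::finite"
  assumes "0 \<le> A"
  shows "A * (1 + norm (x + v)) ^ N * weight N x \<le> A * (1 + norm v) ^ N * (1 / (1 + norm x) ^ (2 * CARD('n)))"
proof -
  have p: "0 < (1 + norm x) ^ N" by (simp add: add_pos_nonneg)
  have "(1 + norm (x + v)) ^ N \<le> ((1 + norm x) * (1 + norm v)) ^ N"
    by (intro power_mono one_plus_norm_add_le) simp
  then have "A * (1 + norm (x + v)) ^ N * weight N x \<le> A * ((1 + norm x) * (1 + norm v)) ^ N * weight N x"
    using assms weight_pos[of N x] by (intro mult_right_mono mult_left_mono) auto
  also have "\<dots> = A * (1 + norm v) ^ N * (1 / (1 + norm x) ^ (2 * CARD('n)))"
    using p by (simp add: weight_def power_mult_distrib power_add)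
  finally show ?thesis .
qed

lemma integrable_weight_shift:
  fixes g :: "real ^ 'n::finite \<Rightarrow> complex"
  assumes [measurable]: "g \<in> borel_measurable borel" and A: "0 \<le> A" "\<And>x. cmod (g x) \<le> A * (1 + norm x) ^ N"
  shows "integrable lborel (\<lambda>x. cmod (g (x + v)) * weight N x)"
proof (rule Bochner_Integration.integrable_bound)
  show "integrable lborel (\<lambda>x::real ^ 'n. A * (1 + norm v) ^ N * (1 / (1 + norm x) ^ (2 * CARD('n))))"
    by (intro integrable_mult_right integrable_norm_decay)
  show "AE x in lborel. norm (cmod (g (x + v)) * weight N x) \<le> norm (A * (1 + norm v) ^ N * (1 / (1 + norm x) ^ (2 * CARD('n))))"
  proof (rule AE_I2)
    fix x
    have "cmod (g (x + v)) * weight N x \<le> A * (1 + norm (x + v)) ^ N * weight N x"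
      using A weight_pos[of N x] by (intro mult_right_mono) auto
    also note growth_weight[OF A(1)]
    finally show "norm (cmod (g (x + v)) * weight N x) \<le> norm (A * (1 + norm v) ^ N * (1 / (1 + norm x) ^ (2 * CARD('n))))"
      using weight_pos[of N x] A(1) by (simp add: abs_of_nonneg)
  qed
qed measurable

text \<open>A three-epsilon argument: \<open>m\<close> is approximated in weighted L1 by the
  continuous \<open>g k\<close>, for which dominated convergence applies. Shifting the approximation
  error costs at most the constant \<open>L\<close>, uniformly in \<open>j\<close>, because the
  weight varies slowly and the sequence \<open>v\<close> is bounded.\<close>

lemma translation_continuity:
  fixes m :: "real ^ 'n::finite \<Rightarrow> complex" and g :: "nat \<Rightarrow> real ^ 'n \<Rightarrow> complex"
  assumes g: "\<And>k. continuous_on UNIV (g k)" and A: "0 \<le> A" "\<And>k x. cmod (g k x) \<le> A * (1 + norm x) ^ N"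
    and lim: "\<And>x. (\<lambda>k. g k x) \<longlonglongrightarrow> m x"
    and v: "v \<longlonglongrightarrow> 0"
  shows "(\<lambda>j. LINT x|lborel. cmod (m (x + v j) - m x) * weight N x) \<longlonglongrightarrow> 0"
proof -
  let ?e0 = "\<lambda>k x. cmod (m x - g k x) * weight N x"
  let ?e1 = "\<lambda>k j x. cmod (m (x + v j) - g k (x + v j)) * weight N x"
  let ?dg = "\<lambda>k j x. cmod (g k (x + v j) - g k x) * weight N x"
  let ?dm = "\<lambda>j x. cmod (m (x + v j) - m x) * weight N x"
  let ?B = "\<lambda>x::real ^ 'n. 1 / (1 + norm x) ^ (2 * CARD('n))"
  have [measurable]: "g k \<in> borel_measurable borel" for k
    using g by (rule borel_measurable_continuous_onI)
  have [measurable]: "m \<in> borel_measurable borel"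
    using lim by (rule borel_measurable_LIMSEQ_metric[rotated]) measurable
  have mA: "cmod (m x) \<le> A * (1 + norm x) ^ N" for x
    by (rule LIMSEQ_le_const2[OF tendsto_norm[OF lim]]) (use A in auto)
  obtain V where V: "0 \<le> V" "\<And>j. norm (v j) \<le> V"
    using Bseq_def convergentI[THEN convergent_imp_Bseq, OF v] by (meson less_imp_le)
  define L where "L = (1 + V) ^ (N + 2 * CARD('n))"
  define e where "e k = (LINT x|lborel. ?e0 k x)" for k
  define d where "d k j = (LINT x|lborel. ?dg k j x)" for k j
  have im: "integrable lborel (\<lambda>x. cmod (m (x + u)) * weight N x)"
    and ig: "integrable lborel (\<lambda>x. cmod (g k (x + u)) * weight N x)" for k u
    using A mA by (intro integrable_weight_shift[where A = A]; simp)+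
  have diff: "integrable lborel (\<lambda>x. cmod (a x - b x) * weight N x)"
    if a: "integrable lborel (\<lambda>x. cmod (a x) * weight N x)" "integrable lborel (\<lambda>x. cmod (b x) * weight N x)"
      and [measurable]: "a \<in> borel_measurable borel" "b \<in> borel_measurable borel" for a b :: "real ^ 'n \<Rightarrow> complex"
  proof (rule Bochner_Integration.integrable_bound[OF Bochner_Integration.integrable_add[OF a]])
    show "AE x in lborel. norm (cmod (a x - b x) * weight N x) \<le> norm (cmod (a x) * weight N x + cmod (b x) * weight N x)"
    proof (rule AE_I2)
      fix x
      have "cmod (a x - b x) * weight N x \<le> (cmod (a x) + cmod (b x)) * weight N x"
        using weight_pos[of N x] by (intro mult_right_mono norm_triangle_ineq4) simp
      then show "norm (cmod (a x - b x) * weight N x) \<le> norm (cmod (a x) * weight N x + cmod (b x) * weight N x)"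
        using weight_pos[of N x] by (simp add: algebra_simps)
    qed
  qed measurable
  have i1: "integrable lborel (\<lambda>x. cmod (m (x + u) - g k (x + u)) * weight N x)" for k u
    by (rule diff[OF im ig]) measurable
  have i2: "integrable lborel (\<lambda>x. cmod (g k (x + u) - g k x) * weight N x)" for k u
    using ig[of k u] ig[of k 0] by (intro diff) auto
  have i3: "integrable lborel (\<lambda>x. cmod (m (x + u) - m x) * weight N x)" for u
    using im[of u] im[of 0] by (intro diff) auto
  have shift: "(LINT x|lborel. ?e1 k j x) \<le> L * e k" for j k
  proof -
    have "(LINT x|lborel. ?e1 k j x) =
       (LINT x|lborel. cmod (m x - g k x) * weight N (x - v j))"
      by (subst lborel_integral_affine[of 1 _ "- v j"]) simp_all
    also have "\<dots> \<le> (LINT x|lborel. L * (?e0 k x))"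
    proof (rule integral_mono)
      show "integrable lborel (\<lambda>x. cmod (m x - g k x) * weight N (x - v j))"
        using lborel_integrable_affine[OF i1[of "v j" k], of 1 "- v j"] by simp
      show "integrable lborel (\<lambda>x. L * (?e0 k x))"
        using i1[of 0 k] by simp
      fix x
      have "weight N (x - v j) \<le> (1 + norm (v j)) ^ (N + 2 * CARD('n)) * weight N x" by (rule weight_shift)
      also have "\<dots> \<le> L * weight N x"
        unfolding L_def using V weight_pos[of N x] by (intro mult_right_mono power_mono) auto
      finally show "cmod (m x - g k x) * weight N (x - v j) \<le> L * (?e0 k x)"
        by (subst mult.left_commute) (rule mult_left_mono, simp_all)
    qed
    finally show ?thesis by (simp add: e_def)
  qed
  have main: "(LINT x|lborel. ?dm j x) \<le> (L + 1) * e k + d k j" for j k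
  proof -
    have "(LINT x|lborel. ?dm j x) \<le>
      (LINT x|lborel. ?e1 k j x + ?dg k j x
        + ?e0 k x)"
    proof (rule integral_mono)
      show "integrable lborel (\<lambda>x. ?e1 k j x + ?dg k j x
        + ?e0 k x)"
        using i1[of 0 k] by (intro Bochner_Integration.integrable_add i1 i2) simp
      fix x
      have "cmod (m (x + v j) - m x) \<le> cmod (m (x + v j) - g k (x + v j)) + cmod (g k (x + v j) - g k x) + cmod (m x - g k x)"
        by norm
      from mult_right_mono[OF this, of "weight N x"] show "?dm j x \<le>
        ?e1 k j x + ?dg k j x + ?e0 k x"
        using weight_pos[of N x] by (simp add: algebra_simps)
    qed (rule i3)
    also have "\<dots> = (LINT x|lborel. ?e1 k j x) + d k j + e k"
      using i1[of 0 k] by (simp add: i1 i2 d_def e_def)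
    finally show ?thesis using shift[of j k] by (simp add: algebra_simps)
  qed
  have e0: "e \<longlonglongrightarrow> 0"
  proof -
    have "(\<lambda>k. LINT x|lborel. ?e0 k x) \<longlonglongrightarrow> (LINT x|(lborel :: (real ^ 'n) measure). 0)"
    proof (rule integral_dominated_convergence[where w = "\<lambda>x. 2 * A * ?B x"])
      show "AE x in lborel. (\<lambda>k. ?e0 k x) \<longlonglongrightarrow> 0"
        by (intro AE_I2) (auto intro!: tendsto_eq_intros lim)
      show "AE x in lborel. norm (?e0 k x) \<le> 2 * A * ?B x" for k
      proof (rule AE_I2)
        fix x
        have "cmod (m x - g k x) \<le> A * (1 + norm x) ^ N + A * (1 + norm x) ^ N"
          by (rule order_trans[OF norm_triangle_ineq4]) (intro add_mono mA A)
        then have "?e0 k x \<le> (A * (1 + norm x) ^ N + A * (1 + norm x) ^ N) * weight N x"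
          using weight_pos[of N x] by (intro mult_right_mono) auto
        also have "\<dots> = 2 * (A * (1 + norm x) ^ N * weight N x)" by simp
        also have "\<dots> \<le> 2 * (A * ?B x)"
          using growth_weight[OF A(1), of x 0 N] by (intro mult_left_mono) simp_all
        finally show "norm (?e0 k x) \<le> 2 * A * ?B x"
          using weight_pos[of N x] by simp
      qed
      show "integrable lborel (\<lambda>x::real ^ 'n. 2 * A * ?B x)"
        by (intro integrable_mult_right integrable_norm_decay)
    qed simp_all
    then show ?thesis by (simp add: e_def[abs_def])
  qed
  have d0: "d k \<longlonglongrightarrow> 0" for k
  proof -
    have "(\<lambda>j. LINT x|lborel. ?dg k j x) \<longlonglongrightarrow> (LINT x|(lborel :: (real ^ 'n) measure). 0)"
    proof (rule integral_dominated_convergence[where w = "\<lambda>x. (A * (1 + V) ^ N + A) * ?B x"])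
      show "AE x in lborel. (\<lambda>j. ?dg k j x) \<longlonglongrightarrow> 0"
      proof (rule AE_I2)
        fix x
        have "isCont (g k) x" using g by (simp add: continuous_on_eq_continuous_at)
        moreover have "(\<lambda>j. x + v j) \<longlonglongrightarrow> x" by (auto intro!: tendsto_eq_intros v)
        ultimately have "(\<lambda>j. g k (x + v j)) \<longlonglongrightarrow> g k x" by (rule isCont_tendsto_compose)
        then show "(\<lambda>j. ?dg k j x) \<longlonglongrightarrow> 0"
          by (auto intro!: tendsto_eq_intros)
      qed
      show "AE x in lborel. norm (?dg k j x) \<le> (A * (1 + V) ^ N + A) * ?B x" for j
      proof (rule AE_I2)
        fix x :: "real ^ 'n"
        have "?dg k j x \<le> (A * (1 + norm (x + v j)) ^ N + A * (1 + norm x) ^ N) * weight N x"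
          using weight_pos[of N x] by (intro mult_right_mono order_trans[OF norm_triangle_ineq4] add_mono A) auto
        also have "\<dots> \<le> A * (1 + norm (v j)) ^ N * ?B x + A * ?B x"
          using growth_weight[OF A(1), of x "v j" N] growth_weight[OF A(1), of x 0 N] by (simp add: algebra_simps)
        also have "\<dots> \<le> A * (1 + V) ^ N * ?B x + A * ?B x"
          using V A(1) by (intro add_right_mono mult_right_mono mult_left_mono power_mono) auto
        finally show "norm (?dg k j x) \<le> (A * (1 + V) ^ N + A) * ?B x"
          using weight_pos[of N x] by (simp add: add_divide_distrib)
      qed
      show "integrable lborel (\<lambda>x::real ^ 'n. (A * (1 + V) ^ N + A) * ?B x)"
        by (intro integrable_mult_right integrable_norm_decay)
    qed simp_all
    then show ?thesis by (simp add: d_def[abs_def])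
  qed
  show ?thesis
  proof (rule order_tendstoI)
    fix y :: real assume y: "0 < y"
    have "(\<lambda>k. (L + 1) * e k) \<longlonglongrightarrow> 0" by (auto intro!: tendsto_eq_intros e0)
    then have "eventually (\<lambda>k. (L + 1) * e k < y / 2) sequentially"
      using y by (intro order_tendstoD) auto
    then obtain k where k: "(L + 1) * e k < y / 2" by (auto simp: eventually_sequentially)
    have "eventually (\<lambda>j. d k j < y / 2) sequentially"
      using y by (intro order_tendstoD(2)[OF d0]) auto
    then show "eventually (\<lambda>j. (LINT x|lborel. ?dm j x) < y) sequentially"
      by eventually_elim (use k main[of _ k] in \<open>smt (verit) field_sum_of_halves\<close>)
  next
    fix y :: real assume y: "y < 0"
    have "0 \<le> (LINT x|lborel. ?dm j x)" for j
      by (intro integral_nonneg_AE AE_I2 mult_nonneg_nonneg norm_ge_zero less_imp_le[OF weight_pos])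
    then show "eventually (\<lambda>j. y < (LINT x|lborel. ?dm j x)) sequentially"
      using y by (auto intro!: always_eventually simp: less_le_trans)
  qed
qed

section \<open>Multipliers are essentially bounded\<close>

text \<open>The operator is applied to \<open>cis (x \<bullet> v) * \<phi> (h *\<^sub>R x)\<close>.
  The result is \<open>G (h *\<^sub>R x)\<close> up to a factor of modulus 1, and the Jacobian of
  the dilation cancels, so the bound does not depend on \<open>h\<close> and
  \<open>v\<close>.\<close>

lemma multiplier_op_dilated_bound:
  fixes m \<phi> :: "real ^ 'n::finite \<Rightarrow> complex" and v :: "real ^ 'n"
  assumes p: "0 < p" and C: "C \<in> Lp_bounds p (multiplier_op m)" and \<phi>: "test_function \<phi>" and h: "h \<noteq> 0"
    and [measurable]: "m \<in> borel_measurable borel"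
  defines "G \<equiv> multiplier_op (\<lambda>\<eta>. m (v + h *\<^sub>R \<eta>)) \<phi>"
  shows "integrable lborel (\<lambda>x. cmod (G x) powr p)"
    and "(LINT x|lborel. cmod (G x) powr p) \<le> C powr p * (LINT x|lborel. cmod (\<phi> x) powr p)"
proof -
  obtain S where S: "Lp_extension p (multiplier_op m) S" "\<And>f. f \<in> Lp p \<Longrightarrow> Lp_norm p (S f) \<le> C * Lp_norm p f"
    and C0: "0 \<le> C"
    using C by (auto simp: Lp_bounds_def)
  have [measurable]: "\<phi> \<in> borel_measurable borel" using \<phi> by (rule test_function_measurable)
  have [measurable]: "G \<in> borel_measurable borel"
    unfolding G_def multiplier_op_def cis_conv_exp by measurable
  define f where "f x = cis (x \<bullet> v) * \<phi> (h *\<^sub>R x)" for x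
  have f: "test_function f"
    unfolding f_def[abs_def] using \<phi> h by (intro test_function_modulate test_function_scale)
  have fL: "f \<in> Lp p" using f p by (rule test_function_Lp)
  then have SL: "S f \<in> Lp p" using S(1) by (simp add: Lp_extension_def)
  then have [measurable]: "S f \<in> borel_measurable borel" by (simp add: Lp_def)
  have "multiplier_op m f x = cis (x \<bullet> v) * G (h *\<^sub>R x)" for x
    unfolding f_def[abs_def] G_def multiplier_op_modulate multiplier_op_scale[OF h] ..
  then have ae: "AE x in lborel. cmod (S f x) powr p = cmod (G (h *\<^sub>R x)) powr p"
    using S(1) f unfolding Lp_extension_def by (auto elim!: eventually_mono simp: norm_mult)
  have "integrable lborel (\<lambda>x. cmod (S f x) powr p)" using SL by (simp add: Lp_def)
  then have "integrable lborel (\<lambda>x. cmod (G (h *\<^sub>R x)) powr p)"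
    using ae by (subst (asm) integrable_cong_AE) auto
  from lborel_integrable_affine[OF this, of "inverse h" 0] h
  show "integrable lborel (\<lambda>x. cmod (G x) powr p)" by simp
  have "(LINT x|lborel. cmod (S f x) powr p) = (LINT x|lborel. cmod (G (h *\<^sub>R x)) powr p)"
    using ae by (intro integral_cong_AE) auto
  moreover have "(LINT x|lborel. cmod (S f x) powr p) \<le> C powr p * (LINT x|lborel. cmod (f x) powr p)"
    using S(2)[OF fL] by (simp add: Lp_norm_le_iff[OF p C0])
  moreover have "cmod (f x) = cmod (\<phi> (h *\<^sub>R x))" for x by (simp add: f_def norm_mult)
  ultimately have "\<bar>h\<bar> ^ CARD('n) * (LINT x|lborel. cmod (G (h *\<^sub>R x)) powr p) \<le>
     \<bar>h\<bar> ^ CARD('n) * (C powr p * (LINT x|lborel. cmod (\<phi> (h *\<^sub>R x)) powr p))"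
    by (intro mult_left_mono) simp_all
  then show "(LINT x|lborel. cmod (G x) powr p) \<le> C powr p * (LINT x|lborel. cmod (\<phi> x) powr p)"
    unfolding Lp_integral_scale[OF h, of G] Lp_integral_scale[OF h, of \<phi>] by (simp add: mult_ac)
qed

lemma test_function_norm_pos:
  assumes \<phi>: "test_function \<phi>" "\<phi> \<noteq> (\<lambda>_. 0)" and p: "0 < p"
  shows "0 < (LINT x|lborel. cmod (\<phi> x) powr p)"
proof (rule ccontr)
  have i: "integrable lborel (\<lambda>x. cmod (\<phi> x) powr p)"
    using test_function_Lp[OF \<phi>(1) p] by (simp add: Lp_def)
  assume "\<not> 0 < (LINT x|lborel. cmod (\<phi> x) powr p)"
  moreover have "0 \<le> (LINT x|lborel. cmod (\<phi> x) powr p)" by simp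
  ultimately have "(LINT x|lborel. cmod (\<phi> x) powr p) = 0" by simp
  then have "AE x in lborel. cmod (\<phi> x) powr p = 0"
    using integral_nonneg_eq_0_iff_AE[OF i] by simp
  then have ae: "AE x in lborel. \<phi> x = 0" by simp
  have "open {x. \<phi> x \<noteq> 0}"
    using test_function_continuous[OF \<phi>(1)] by (intro open_Collect_neq continuous_on_const) auto
  then have "\<phi> x = 0" for x using AE_lborel_open[OF ae] by simp
  then show False using \<phi>(2) by auto
qed

text \<open>Test functions that are dilated by \<open>1 / h\<close> and modulated by \<open>v\<close> concentrate at the frequency
  \<open>v\<close>, so that in the limit \<open>h \<longlongrightarrow> 0\<close> the operator acts on them as multiplication by \<open>m v\<close>.\<close>

lemma multiplier_essentially_bounded:
  fixes m \<phi> :: "real ^ 'n::finite \<Rightarrow> complex" and g :: "nat \<Rightarrow> real ^ 'n \<Rightarrow> complex"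
  assumes p: "0 < p" and C: "C \<in> Lp_bounds p (multiplier_op m)"
    and \<phi>: "test_function \<phi>" "\<phi> \<noteq> (\<lambda>_. 0)"
    and g: "\<And>k. continuous_on UNIV (g k)" and A: "0 \<le> A" "\<And>k \<xi>. cmod (g k \<xi>) \<le> A * (1 + norm \<xi>) ^ N"
    and lim: "\<And>\<xi>. (\<lambda>k. g k \<xi>) \<longlonglongrightarrow> m \<xi>"
  shows "AE v in lborel. cmod (m v) \<le> C"
proof -
  let ?W = "\<lambda>y. 2 * A * (1 + norm y) ^ N * cmod (fourier \<phi> y)"
  have C0: "0 \<le> C" using C by (simp add: Lp_bounds_def)
  have [measurable]: "g k \<in> borel_measurable borel" for k
    using g by (rule borel_measurable_continuous_onI)
  have [measurable]: "m \<in> borel_measurable borel"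
    using lim by (rule borel_measurable_LIMSEQ_metric[rotated]) measurable
  have [measurable]: "\<phi> \<in> borel_measurable borel" using \<phi>(1) by (rule test_function_measurable)
  have mA: "cmod (m \<xi>) \<le> A * (1 + norm \<xi>) ^ N" for \<xi>
    by (rule LIMSEQ_le_const2[OF tendsto_norm[OF lim]]) (use A in auto)
  define h where "h k = inverse (real (Suc k))" for k
  have h: "0 < h k" "h k \<le> 1" for k by (simp_all add: h_def field_simps)
  have h0: "h \<longlonglongrightarrow> 0" unfolding h_def[abs_def] by (rule LIMSEQ_inverse_real_of_nat)
  \<comment> \<open>The error of replacing the dilated symbol by its value at \<open>v\<close>. The
    weight makes it integrable in \<open>v\<close>, the Fourier transform in \<open>y\<close>, which
    opens the way to Fubini.\<close>
  define F where "F j v y = cmod (m (v + h j *\<^sub>R y) - m v) * weight N v * cmod (fourier \<phi> y)" for j v y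
  define B where "B = (\<lambda>\<xi>::real ^ 'n. 1 / (1 + norm \<xi>) ^ (2 * CARD('n)))"
  have B: "integrable lborel B" unfolding B_def by (rule integrable_norm_decay)
  have F_bound: "cmod (m (v + h j *\<^sub>R y) - m v) * weight N v \<le> B v * (2 * A * (1 + norm y) ^ N)" for j v y
  proof -
    have "norm (h j *\<^sub>R y) \<le> norm y" using h[of j] by (simp add: mult_left_le_one_le)
    then have 1: "(1 + norm (h j *\<^sub>R y)) ^ N \<le> (1 + norm y) ^ N" by (intro power_mono) auto
    have "cmod (m (v + h j *\<^sub>R y) - m v) * weight N v \<le> (A * (1 + norm (v + h j *\<^sub>R y)) ^ N + A * (1 + norm (v + 0)) ^ N) * weight N v"
      using weight_pos[of N v] mA[of v] by (intro mult_right_mono order_trans[OF norm_triangle_ineq4] add_mono mA) auto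
    also have "\<dots> \<le> A * (1 + norm (h j *\<^sub>R y)) ^ N * B v + A * (1 + norm (0 :: real ^ 'n)) ^ N * B v"
      unfolding B_def distrib_right by (intro add_mono growth_weight A)
    also have "\<dots> \<le> A * (1 + norm y) ^ N * B v + A * (1 + norm y) ^ N * B v"
      using A(1) 1 by (intro add_mono mult_right_mono mult_left_mono) (auto simp: B_def)
    finally show ?thesis by (simp add: algebra_simps)
  qed
  have F_int: "integrable (lborel \<Otimes>\<^sub>M lborel) (\<lambda>(v, y). F j v y)" for j
  proof (rule Bochner_Integration.integrable_bound[OF integrable_lborel_prod_mult[OF B integrable_fourier[OF \<phi>(1), of "2 * A" N]]])
    show "(\<lambda>(v, y). F j v y) \<in> borel_measurable (lborel \<Otimes>\<^sub>M lborel)"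
      unfolding F_def by measurable
    show "AE x in lborel \<Otimes>\<^sub>M lborel. norm (case x of (v, y) \<Rightarrow> F j v y)
        \<le> norm (case x of (v, y) \<Rightarrow> B v * ?W y)"
    proof (rule AE_I2, clarify)
      fix v y
      have "F j v y \<le> B v * (2 * A * (1 + norm y) ^ N) * cmod (fourier \<phi> y)"
        unfolding F_def by (intro mult_right_mono F_bound) simp
      moreover have "0 \<le> F j v y" using weight_pos[of N v] by (simp add: F_def)
      ultimately show "norm (F j v y) \<le> norm (B v * ?W y)"
        by (simp add: mult.assoc)
    qed
  qed
  \<comment> \<open>Translation continuity controls the error only in the mean over
    \<open>v\<close>, so \<open>v\<close> is integrated first for fixed \<open>y\<close>; dominated
    convergence then handles \<open>y\<close>.\<close>
  have F0: "(\<lambda>j. LINT v|lborel. norm (LINT y|lborel. F j v y)) \<longlonglongrightarrow> 0"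
  proof -
    have "norm (LINT y|lborel. F j v y) = (LINT y|lborel. F j v y)" for j v
      using weight_pos[of N v] by (simp add: F_def)
    then have "(LINT v|lborel. norm (LINT y|lborel. F j v y)) = (LINT y|lborel. LINT v|lborel. F j v y)" for j
      using lborel_pair.Fubini_integral[OF F_int, of j] by simp
    moreover have "(\<lambda>j. LINT y|lborel. LINT v|lborel. F j v y) \<longlonglongrightarrow> (LINT y|(lborel :: (real ^ 'n) measure). 0)"
    proof (rule integral_dominated_convergence[where w = "\<lambda>y. (LINT v|lborel. B v) * ?W y"])
      show "(\<lambda>y. LINT v|lborel. F j v y) \<in> borel_measurable lborel" for j
        unfolding F_def by measurable
      show "integrable lborel (\<lambda>y. (LINT v|lborel. B v) * ?W y)"
        by (intro integrable_mult_right integrable_fourier \<phi>)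
      show "AE y in lborel. (\<lambda>j. LINT v|lborel. F j v y) \<longlonglongrightarrow> 0"
      proof (rule AE_I2)
        fix y :: "real ^ 'n"
        have "(\<lambda>j. h j *\<^sub>R y) \<longlonglongrightarrow> 0" using tendsto_scaleR[OF h0 tendsto_const, of y] by simp
        from translation_continuity[OF g A lim this]
        have "(\<lambda>j. (LINT v|lborel. cmod (m (v + h j *\<^sub>R y) - m v) * weight N v) * cmod (fourier \<phi> y)) \<longlonglongrightarrow> 0 * cmod (fourier \<phi> y)"
          by (intro tendsto_mult tendsto_const)
        then show "(\<lambda>j. LINT v|lborel. F j v y) \<longlonglongrightarrow> 0"
          unfolding F_def by simp
      qed
      show "AE y in lborel. norm (LINT v|lborel. F j v y) \<le> (LINT v|lborel. B v) * ?W y" for j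
      proof (rule AE_I2)
        fix y
        have nn: "0 \<le> F j v y" for v using weight_pos[of N v] by (simp add: F_def)
        have Fb: "F j v y \<le> B v * ?W y" for v
          unfolding F_def mult.assoc[symmetric] using F_bound[of v j y]
          by (intro mult_right_mono) (simp_all add: mult.assoc)
        have "norm (LINT v|lborel. F j v y) = (LINT v|lborel. F j v y)" using nn by simp
        also have "\<dots> \<le> (LINT v|lborel. B v * ?W y)"
        proof (rule integral_mono')
          show "integrable lborel (\<lambda>v. B v * ?W y)"
            by (intro integrable_mult_left B)
        qed (use Fb nn order_trans in blast)+
        finally show "norm (LINT v|lborel. F j v y) \<le> (LINT v|lborel. B v) * ?W y"
          by simp
      qed
    qed simp
    ultimately show ?thesis by simp
  qed
  \<comment> \<open>Convergence in the mean gives convergence at almost every \<open>v\<close> only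
    along a subsequence. That suffices, as the bound \<open>C\<close> is the same for all
    dilations.\<close>
  have "\<exists>r. strict_mono r \<and> (AE v in lborel. (\<lambda>j. LINT y|lborel. F (r j) v y) \<longlonglongrightarrow> 0)"
    by (rule tendsto_L1_AE_subseq[OF lborel_pair.integrable_fst[OF F_int] F0])
  then obtain r where r: "AE v in lborel. (\<lambda>j. LINT y|lborel. F (r j) v y) \<longlonglongrightarrow> 0" by blast
  then show ?thesis
  proof eventually_elim
    case (elim v)
    define G where "G j = multiplier_op (\<lambda>y. m (v + h (r j) *\<^sub>R y)) \<phi>" for j
    have [measurable]: "G j \<in> borel_measurable borel" for j
      unfolding G_def multiplier_op_def cis_conv_exp by measurable
    have hr: "h (r j) \<noteq> 0" for j using h[of "r j"] by simp
    note G = multiplier_op_dilated_bound[OF p C \<phi>(1) hr, where v = v, folded G_def]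
    \<comment> \<open>By Fourier inversion \<open>m v * \<phi> x\<close> is the result for the
      constant symbol \<open>m v\<close>, so the difference is an integral over the difference of
      the symbols, bounded uniformly in \<open>x\<close>.\<close>
    have Gb: "cmod (G j x - m v * \<phi> x) * weight N v \<le> (LINT y|lborel. F (r j) v y)" for j x
    proof -
      have pg: "poly_growth (\<lambda>y. m (v + h (r j) *\<^sub>R y))"
        unfolding poly_growth_def
      proof (intro exI allI)
        fix y
        have "1 + norm (v + h (r j) *\<^sub>R y) \<le> (1 + norm v) * (1 + norm y)"
          by (rule order_trans[OF one_plus_norm_add_le])
            (use h[of "r j"] in \<open>intro mult_left_mono, simp_all add: mult_left_le_one_le\<close>)
        then have "(1 + norm (v + h (r j) *\<^sub>R y)) ^ N \<le> (1 + norm v) ^ N * (1 + norm y) ^ N"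
          unfolding power_mult_distrib[symmetric] by (intro power_mono) auto
        then show "cmod (m (v + h (r j) *\<^sub>R y)) \<le> (A * (1 + norm v) ^ N) * (1 + norm y) ^ N"
          using mA[of "v + h (r j) *\<^sub>R y"] A(1) unfolding mult.assoc by (meson mult_left_mono order_trans)
      qed
      have i1: "integrable lborel (\<lambda>y. m (v + h (r j) *\<^sub>R y) * fourier \<phi> y)"
        by (rule integrable_mult_fourier[OF _ pg \<phi>(1)]) measurable
      have i2: "integrable lborel (\<lambda>y. m v * fourier \<phi> y)"
        by (rule integrable_mult_fourier[OF _ poly_growth_bounded[OF order_refl] \<phi>(1)]) simp
      have i3: "integrable lborel (\<lambda>y. m (v + h (r j) *\<^sub>R y) * fourier \<phi> y * cis (x \<bullet> y))"
        "integrable lborel (\<lambda>y. m v * fourier \<phi> y * cis (x \<bullet> y))"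
        by (intro integrable_mult_cis i1 i2; measurable)+
      have "m v * \<phi> x = (LINT y|lborel. m v * fourier \<phi> y * cis (x \<bullet> y))"
        using fourier_inversion[OF \<phi>(1), of x] by (simp add: mult.assoc)
      then have "cmod (G j x - m v * \<phi> x) = cmod (LINT y|lborel. m (v + h (r j) *\<^sub>R y) * fourier \<phi> y * cis (x \<bullet> y) - m v * fourier \<phi> y * cis (x \<bullet> y))"
        unfolding G_def multiplier_op_def by (simp only: Bochner_Integration.integral_diff[OF i3])
      also have "\<dots> \<le> (LINT y|lborel. cmod (m (v + h (r j) *\<^sub>R y) * fourier \<phi> y * cis (x \<bullet> y) - m v * fourier \<phi> y * cis (x \<bullet> y)))"
        by (rule integral_norm_bound)
      also have "\<dots> = (LINT y|lborel. cmod (m (v + h (r j) *\<^sub>R y) - m v) * cmod (fourier \<phi> y))"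
        by (simp add: norm_mult left_diff_distrib[symmetric])
      finally have "cmod (G j x - m v * \<phi> x) * weight N v \<le> (LINT y|lborel. cmod (m (v + h (r j) *\<^sub>R y) - m v) * cmod (fourier \<phi> y)) * weight N v"
        using weight_pos[of N v] by (intro mult_right_mono) auto
      also have "\<dots> = (LINT y|lborel. F (r j) v y)"
        unfolding F_def integral_mult_left_zero[symmetric] by (simp add: mult_ac)
      finally show ?thesis .
    qed
    have Gl: "(\<lambda>j. G j x) \<longlonglongrightarrow> m v * \<phi> x" for x
    proof -
      have "(\<lambda>j. cmod (G j x - m v * \<phi> x) * weight N v) \<longlonglongrightarrow> 0"
        by (rule tendsto_sandwich[OF _ _ tendsto_const elim])
           (use Gb weight_pos[of N v] in \<open>auto intro!: always_eventually\<close>)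
      then have "(\<lambda>j. cmod (G j x - m v * \<phi> x) * weight N v / weight N v) \<longlonglongrightarrow> 0 / weight N v"
        using weight_pos[of N v] by (intro tendsto_divide tendsto_const) auto
      then show ?thesis
        using weight_pos[of N v] by (simp add: tendsto_norm_zero_iff LIM_zero_cancel)
    qed
    define P where "P = (LINT x|lborel. cmod (\<phi> x) powr p)"
    have P: "0 < P" unfolding P_def by (rule test_function_norm_pos[OF \<phi> p])
    have i\<phi>: "integrable lborel (\<lambda>x. cmod (\<phi> x) powr p)" using test_function_Lp[OF \<phi>(1) p] by (simp add: Lp_def)
    have "ennreal (cmod (m v) powr p * P) = ennreal (LINT x|lborel. cmod (m v * \<phi> x) powr p)"
      by (simp add: P_def norm_mult powr_mult)
    also have "\<dots> = (\<integral>\<^sup>+x. ennreal (cmod (m v * \<phi> x) powr p) \<partial>lborel)"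
      using i\<phi> by (intro nn_integral_eq_integral[symmetric]) (auto simp: norm_mult powr_mult)
    \<comment> \<open>Fatou's lemma: the functions \<open>G j\<close> converge pointwise, and only
      their p-th power integrals are under control.\<close>
    also have "\<dots> = (\<integral>\<^sup>+x. liminf (\<lambda>j. ennreal (cmod (G j x) powr p)) \<partial>lborel)"
    proof (rule nn_integral_cong)
      fix x
      have "(\<lambda>j. ennreal (cmod (G j x) powr p)) \<longlonglongrightarrow> ennreal (cmod (m v * \<phi> x) powr p)"
        using p by (intro tendsto_ennrealI tendsto_powr2 tendsto_norm Gl tendsto_const) auto
      then show "ennreal (cmod (m v * \<phi> x) powr p) = liminf (\<lambda>j. ennreal (cmod (G j x) powr p))"
        by (rule lim_imp_Liminf[OF sequentially_bot, symmetric])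
    qed
    also have "\<dots> \<le> liminf (\<lambda>j. \<integral>\<^sup>+x. ennreal (cmod (G j x) powr p) \<partial>lborel)"
      by (rule nn_integral_liminf) measurable
    also have "\<dots> \<le> limsup (\<lambda>j. \<integral>\<^sup>+x. ennreal (cmod (G j x) powr p) \<partial>lborel)"
      by (rule Liminf_le_Limsup) simp
    also have "\<dots> \<le> ennreal (C powr p * P)"
    proof (rule Limsup_bounded, rule always_eventually, rule allI)
      fix j
      have "(\<integral>\<^sup>+x. ennreal (cmod (G j x) powr p) \<partial>lborel) = ennreal (LINT x|lborel. cmod (G j x) powr p)"
        by (intro nn_integral_eq_integral G(1)) auto
      also have "\<dots> \<le> ennreal (C powr p * P)"
        unfolding P_def by (intro ennreal_leI G(2)) auto
      finally show "(\<integral>\<^sup>+x. ennreal (cmod (G j x) powr p) \<partial>lborel) \<le> ennreal (C powr p * P)" .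
    qed
    finally have "cmod (m v) powr p * P \<le> C powr p * P"
      using P by (subst (asm) ennreal_le_iff) auto
    then have "cmod (m v) powr p \<le> C powr p" using P by simp
    then show "cmod (m v) \<le> C"
      using p C0 powr_less_mono2[of p C "cmod (m v)"] by (meson not_le)
  qed
qed

section \<open>Symbols of curve operators\<close>

lemma continuous_curve_symbol:
  fixes \<gamma> :: "real \<Rightarrow> real ^ 'n::finite"
  assumes \<gamma>: "continuous_on UNIV \<gamma>" and \<kappa>: "integrable lborel \<kappa>"
  shows "continuous_on UNIV (\<lambda>\<xi>. LINT u|lborel. cis (- (\<gamma> u \<bullet> \<xi>)) * \<kappa> u)"
  unfolding continuous_on_sequentially comp_def
proof (intro allI ballI impI)
  fix x :: "nat \<Rightarrow> real ^ 'n" and a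
  assume x: "(\<forall>n. x n \<in> UNIV) \<and> x \<longlonglongrightarrow> a"
  have [measurable]: "\<gamma> \<in> borel_measurable borel" using \<gamma> by (rule borel_measurable_continuous_onI)
  have [measurable]: "\<kappa> \<in> borel_measurable borel" using \<kappa> by auto
  show "(\<lambda>n. LINT u|lborel. cis (- (\<gamma> u \<bullet> x n)) * \<kappa> u) \<longlonglongrightarrow> (LINT u|lborel. cis (- (\<gamma> u \<bullet> a)) * \<kappa> u)"
  proof (rule integral_dominated_convergence[where w = "\<lambda>u. cmod (\<kappa> u)"])
    show "AE u in lborel. (\<lambda>n. cis (- (\<gamma> u \<bullet> x n)) * \<kappa> u) \<longlonglongrightarrow> cis (- (\<gamma> u \<bullet> a)) * \<kappa> u"
      using x unfolding cis_conv_exp by (intro AE_I2) (auto intro!: tendsto_intros)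
    show "(\<lambda>u. cis (- (\<gamma> u \<bullet> a)) * \<kappa> u) \<in> borel_measurable lborel"
      "(\<lambda>u. cis (- (\<gamma> u \<bullet> x n)) * \<kappa> u) \<in> borel_measurable lborel" for n
      unfolding cis_conv_exp by measurable
  qed (use \<kappa> in \<open>auto simp: norm_mult\<close>)
qed

text \<open>Inversion is inserted at the point \<open>x - \<gamma> u\<close>; Fubini applies because
  both the kernel and \<open>fourier f\<close> are integrable.\<close>

lemma curve_integral_eq_multiplier_op:
  fixes \<gamma> :: "real \<Rightarrow> real ^ 'n::finite"
  assumes \<gamma>: "continuous_on UNIV \<gamma>" and \<kappa>: "integrable lborel \<kappa>" and f: "test_function f"
  shows "(LINT u|lborel. f (x - \<gamma> u) * \<kappa> u) = multiplier_op (\<lambda>\<xi>. LINT u|lborel. cis (- (\<gamma> u \<bullet> \<xi>)) * \<kappa> u) f x"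
proof -
  let ?E = "\<lambda>u \<xi>. fourier f \<xi> * cis ((x - \<gamma> u) \<bullet> \<xi>)"
  have [measurable]: "\<gamma> \<in> borel_measurable borel" using \<gamma> by (rule borel_measurable_continuous_onI)
  have [measurable]: "\<kappa> \<in> borel_measurable borel" using \<kappa> by auto
  have [measurable]: "f \<in> borel_measurable borel" using f by (rule test_function_measurable)
  have fi: "integrable lborel (fourier f)"
    using integrable_mult_fourier[OF _ poly_growth_bounded f, of "\<lambda>_. 1" 1] by simp
  have I: "integrable (lborel \<Otimes>\<^sub>M lborel) (\<lambda>(u, \<xi>). \<kappa> u * ?E u \<xi>)"
  proof (rule Bochner_Integration.integrable_bound[OF integrable_lborel_prod_mult[OF \<kappa> fi]])
    show "(\<lambda>(u, \<xi>). \<kappa> u * ?E u \<xi>) \<in> borel_measurable (lborel \<Otimes>\<^sub>M lborel)"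
      unfolding cis_conv_exp by measurable
  qed (auto simp: norm_mult)
  have "multiplier_op (\<lambda>\<xi>. LINT u|lborel. cis (- (\<gamma> u \<bullet> \<xi>)) * \<kappa> u) f x =
     (LINT \<xi>|lborel. LINT u|lborel. \<kappa> u * ?E u \<xi>)"
    unfolding multiplier_op_def
  proof (rule Bochner_Integration.integral_cong[OF refl])
    fix \<xi>
    have e: "cis (- (\<gamma> u \<bullet> \<xi>)) * \<kappa> u * (fourier f \<xi> * cis (x \<bullet> \<xi>)) = \<kappa> u * ?E u \<xi>" for u
    proof -
      have "cis ((x - \<gamma> u) \<bullet> \<xi>) = cis (- (\<gamma> u \<bullet> \<xi>)) * cis (x \<bullet> \<xi>)"
        by (simp add: cis_mult inner_diff_left)
      then show ?thesis by simp
    qed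
    have "(LINT u|lborel. cis (- (\<gamma> u \<bullet> \<xi>)) * \<kappa> u) * fourier f \<xi> * cis (x \<bullet> \<xi>) =
       (LINT u|lborel. cis (- (\<gamma> u \<bullet> \<xi>)) * \<kappa> u) * (fourier f \<xi> * cis (x \<bullet> \<xi>))" by simp
    also have "\<dots> = (LINT u|lborel. cis (- (\<gamma> u \<bullet> \<xi>)) * \<kappa> u * (fourier f \<xi> * cis (x \<bullet> \<xi>)))"
      by (rule integral_mult_left_zero[symmetric])
    finally show "(LINT u|lborel. cis (- (\<gamma> u \<bullet> \<xi>)) * \<kappa> u) * fourier f \<xi> * cis (x \<bullet> \<xi>) =
       (LINT u|lborel. \<kappa> u * ?E u \<xi>)" unfolding e .
  qed
  also have "\<dots> = (LINT u|lborel. LINT \<xi>|lborel. \<kappa> u * ?E u \<xi>)"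
    by (rule lborel_pair.Fubini_integral[OF I])
  also have "\<dots> = (LINT u|lborel. f (x - \<gamma> u) * \<kappa> u)"
    unfolding integral_mult_right_zero fourier_inversion[OF f] by (simp add: mult.commute)
  finally show ?thesis ..
qed

lemma multiplier_op_cmult: "multiplier_op (\<lambda>\<xi>. c * m \<xi>) f x = c * multiplier_op m f x"
  unfolding multiplier_op_def mult.assoc integral_mult_right_zero ..

text \<open>The common exponent \<open>N\<close> lets the single integrable function
  \<open>(1 + norm \<xi>) ^ N * cmod (fourier f \<xi>)\<close>, with the summable factors
  \<open>a i\<close>, dominate all terms.\<close>

lemma multiplier_op_sums:
  fixes m :: "nat \<Rightarrow> real ^ 'n::finite \<Rightarrow> complex"
  assumes m: "\<And>i. m i \<in> borel_measurable borel" and a: "\<And>i \<xi>. cmod (m i \<xi>) \<le> a i * (1 + norm \<xi>) ^ N"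
    and sm: "summable a" and f: "test_function f"
  shows "(\<lambda>i. multiplier_op (m i) f x) sums multiplier_op (\<lambda>\<xi>. \<Sum>i. m i \<xi>) f x"
proof -
  have sm': "summable (\<lambda>i. cmod (m i \<xi>))" for \<xi>
    by (rule summable_comparison_test'[OF summable_mult2[OF sm, of "(1 + norm \<xi>) ^ N"], of 0]) (simp add: a)
  have im: "integrable lborel (\<lambda>\<xi>. m i \<xi> * fourier f \<xi> * cis (x \<bullet> \<xi>))" for i
    by (intro integrable_mult_cis integrable_mult_fourier m f) (auto simp: poly_growth_def intro!: a exI)
  have "(\<lambda>i. multiplier_op (m i) f x) sums (LINT \<xi>|lborel. (\<Sum>i. m i \<xi> * fourier f \<xi> * cis (x \<bullet> \<xi>)))"
    unfolding multiplier_op_def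
  proof (rule sums_integral[OF im])
    show "AE \<xi> in lborel. summable (\<lambda>i. norm (m i \<xi> * fourier f \<xi> * cis (x \<bullet> \<xi>)))"
      using sm' by (intro AE_I2) (simp add: norm_mult summable_mult2)
    define I where "I = (LINT \<xi>|lborel. (1 + norm \<xi>) ^ N * cmod (fourier f \<xi>))"
    show "summable (\<lambda>i. LINT \<xi>|lborel. norm (m i \<xi> * fourier f \<xi> * cis (x \<bullet> \<xi>)))"
    proof (rule summable_comparison_test'[OF summable_mult2[OF sm, of I], of 0])
      fix i
      have "(LINT \<xi>|lborel. norm (m i \<xi> * fourier f \<xi> * cis (x \<bullet> \<xi>))) \<le> (LINT \<xi>|lborel. a i * ((1 + norm \<xi>) ^ N * cmod (fourier f \<xi>)))"
        using integrable_fourier[OF f, of "a i" N] mult_right_mono[OF a norm_ge_zero]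
        by (intro integral_mono integrable_norm im) (simp_all add: norm_mult mult.assoc[symmetric])
      then show "norm (LINT \<xi>|lborel. norm (m i \<xi> * fourier f \<xi> * cis (x \<bullet> \<xi>))) \<le> a i * I"
        by (simp add: I_def)
    qed
  qed
  also have "(LINT \<xi>|lborel. (\<Sum>i. m i \<xi> * fourier f \<xi> * cis (x \<bullet> \<xi>))) = multiplier_op (\<lambda>\<xi>. \<Sum>i. m i \<xi>) f x"
    unfolding multiplier_op_def mult.assoc
    by (intro Bochner_Integration.integral_cong refl suminf_mult2[symmetric] summable_norm_cancel[OF sm'])
  finally show ?thesis .
qed

section \<open>Powers of trigonometric polynomials\<close>

definition trig_coeff :: "complex \<Rightarrow> complex \<Rightarrow> nat \<Rightarrow> nat \<Rightarrow> complex" where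
  "trig_coeff \<alpha> \<beta> n j = of_nat (n choose j) * \<alpha> ^ j * \<beta> ^ (n - j)"

lemma trig_power:
  "(\<alpha> * cis (- \<theta>) + \<beta> * cis \<theta>) ^ n = (\<Sum>j\<le>n. trig_coeff \<alpha> \<beta> n j * cis (- (\<theta> * (2 * real j - real n))))"
proof -
  have "(\<alpha> * cis (- \<theta>)) ^ j * (\<beta> * cis \<theta>) ^ (n - j) = \<alpha> ^ j * \<beta> ^ (n - j) * cis (- (\<theta> * (2 * real j - real n)))"
    if "j \<le> n" for j
    using that by (simp add: power_mult_distrib Complex.DeMoivre cis_mult of_nat_diff algebra_simps)
  then show ?thesis
    unfolding binomial_ring trig_coeff_def by (intro sum.cong refl) (simp add: mult.assoc)
qed

text \<open>Binomial theorem for \<open>(1 / 2 + 1 / 2) ^ n\<close>. That the mass does not depend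
  on \<open>n\<close> preserves multiplier bounds under powers and later makes the expansion through
  arcsin absolutely convergent.\<close>

lemma trig_coeff_norm:
  assumes "cmod \<alpha> = 1 / 2" "cmod \<beta> = 1 / 2"
  shows "(\<Sum>j\<le>n. cmod (trig_coeff \<alpha> \<beta> n j)) = 1"
proof -
  have "(\<Sum>j\<le>n. cmod (trig_coeff \<alpha> \<beta> n j)) = (1 / 2 + 1 / 2 :: real) ^ n"
    unfolding binomial_ring by (simp add: trig_coeff_def norm_mult norm_power assms)
  then show ?thesis by simp
qed

lemma trig_coeff_eq_0: "n < j \<Longrightarrow> trig_coeff \<alpha> \<beta> n j = 0"
  by (simp add: trig_coeff_def binomial_eq_0)

lemma trig_norm_le:
  assumes "cmod \<alpha> = 1 / 2" "cmod \<beta> = 1 / 2"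
  shows "cmod (\<alpha> * cis (- \<theta>) + \<beta> * cis \<theta>) \<le> 1"
  using norm_triangle_ineq[of "\<alpha> * cis (- \<theta>)" "\<beta> * cis \<theta>"] assms by (simp add: norm_mult)

text \<open>\<open>K k\<close> stands for a truncated kernel and \<open>m\<close> for the symbol of
  the principal value. The growth bound is uniform in \<open>k\<close>, whereas the L1 norms of the
  \<open>K k\<close> may be unbounded.\<close>

locale curve_symbol_approx =
  fixes \<gamma> :: "real \<Rightarrow> real ^ 'n::finite" and K :: "nat \<Rightarrow> real \<Rightarrow> complex" and m :: "real ^ 'n \<Rightarrow> complex"
    and A :: real and N :: nat
  assumes \<gamma>: "continuous_on UNIV \<gamma>" and K: "\<And>k. integrable lborel (K k)"
    and A: "0 \<le> A" "\<And>k \<xi>. cmod (LINT u|lborel. cis (- (\<gamma> u \<bullet> \<xi>)) * K k u) \<le> A * (1 + norm \<xi>) ^ N"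
    and lim: "\<And>\<xi>. (\<lambda>k. LINT u|lborel. cis (- (\<gamma> u \<bullet> \<xi>)) * K k u) \<longlonglongrightarrow> m \<xi>"
begin

definition trunc_symbol :: "nat \<Rightarrow> real ^ 'n \<Rightarrow> complex" where
  "trunc_symbol k \<xi> = (LINT u|lborel. cis (- (\<gamma> u \<bullet> \<xi>)) * K k u)"

lemma \<gamma>_measurable [measurable]: "\<gamma> \<in> borel_measurable borel"
  using \<gamma> by (rule borel_measurable_continuous_onI)

lemma K_measurable [measurable]: "K k \<in> borel_measurable borel"
  using K[of k] by auto

lemma continuous_trunc_symbol: "continuous_on UNIV (trunc_symbol k)"
  unfolding trunc_symbol_def[abs_def] by (rule continuous_curve_symbol[OF \<gamma> K])

lemma trunc_symbol_measurable [measurable]: "trunc_symbol k \<in> borel_measurable borel"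
  using continuous_trunc_symbol by (rule borel_measurable_continuous_onI)

lemma trunc_symbol_growth: "cmod (trunc_symbol k \<xi>) \<le> A * (1 + norm \<xi>) ^ N"
  unfolding trunc_symbol_def by (rule A)

lemma trunc_symbol_lim: "(\<lambda>k. trunc_symbol k \<xi>) \<longlonglongrightarrow> m \<xi>"
  unfolding trunc_symbol_def by (rule lim)

lemma m_measurable [measurable]: "m \<in> borel_measurable borel"
  using trunc_symbol_lim by (rule borel_measurable_LIMSEQ_metric[rotated]) measurable

lemma m_growth: "cmod (m \<xi>) \<le> A * (1 + norm \<xi>) ^ N"
  by (rule LIMSEQ_le_const2[OF tendsto_norm[OF trunc_symbol_lim]]) (use trunc_symbol_growth in auto)

lemma curve_integral_lim:
  assumes f: "test_function f"
  shows "(\<lambda>k. LINT u|lborel. f (x - \<gamma> u) * K k u) \<longlonglongrightarrow> multiplier_op m f x"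
  unfolding curve_integral_eq_multiplier_op[OF \<gamma> K f] trunc_symbol_def[symmetric] multiplier_op_def
proof (rule integral_dominated_convergence[where w = "\<lambda>\<xi>. A * (1 + norm \<xi>) ^ N * cmod (fourier f \<xi>)"])
  have [measurable]: "f \<in> borel_measurable borel" using f by (rule test_function_measurable)
  show "(\<lambda>\<xi>. m \<xi> * fourier f \<xi> * cis (x \<bullet> \<xi>)) \<in> borel_measurable lborel"
    "(\<lambda>\<xi>. trunc_symbol k \<xi> * fourier f \<xi> * cis (x \<bullet> \<xi>)) \<in> borel_measurable lborel" for k
    unfolding cis_conv_exp by measurable
  show "integrable lborel (\<lambda>\<xi>. A * (1 + norm \<xi>) ^ N * cmod (fourier f \<xi>))" by (rule integrable_fourier[OF f])
  show "AE \<xi> in lborel. (\<lambda>k. trunc_symbol k \<xi> * fourier f \<xi> * cis (x \<bullet> \<xi>)) \<longlonglongrightarrow> m \<xi> * fourier f \<xi> * cis (x \<bullet> \<xi>)"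
    by (intro AE_I2 tendsto_intros trunc_symbol_lim)
  show "AE \<xi> in lborel. norm (trunc_symbol k \<xi> * fourier f \<xi> * cis (x \<bullet> \<xi>)) \<le> A * (1 + norm \<xi>) ^ N * cmod (fourier f \<xi>)" for k
    using trunc_symbol_growth by (intro AE_I2) (simp add: norm_mult mult_right_mono)
qed

context
  fixes \<alpha> \<beta> :: complex
  assumes ab: "cmod \<alpha> = 1 / 2" "cmod \<beta> = 1 / 2"
begin

text \<open>The symbol belonging to the kernel multiplied by
  \<open>trig (\<gamma> u \<bullet> \<xi>) ^ n\<close>, written through dilations of
  \<open>m\<close>. For even \<open>n\<close> the middle term is the constant
  \<open>m 0\<close>.\<close>

definition power_symbol :: "nat \<Rightarrow> real ^ 'n \<Rightarrow> complex" where
  "power_symbol n \<xi> = (\<Sum>j\<le>n. trig_coeff \<alpha> \<beta> n j * m ((2 * real j - real n) *\<^sub>R \<xi>))"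

definition trig :: "real \<Rightarrow> complex" where
  "trig \<theta> = \<alpha> * cis (- \<theta>) + \<beta> * cis \<theta>"

text \<open>The cost \<open>(1 + real n) ^ N\<close> comes from
  \<open>\<bar>2 * real j - real n\<bar> \<le> real n\<close>. The function \<open>h\<close> is kept
  general because the growth estimates serve both \<open>m\<close> and the truncated
  symbols.\<close>

lemma term_growth:
  assumes h: "\<And>\<xi>. cmod (h \<xi>) \<le> A * (1 + norm \<xi>) ^ N"
  shows "cmod (trig_coeff \<alpha> \<beta> n j * h ((2 * real j - real n) *\<^sub>R \<xi>)) \<le>
    cmod (trig_coeff \<alpha> \<beta> n j) * (A * (1 + real n) ^ N) * (1 + norm \<xi>) ^ N"
proof (cases "j \<le> n")
  case True
  then have "\<bar>2 * real j - real n\<bar> * norm \<xi> \<le> real n * norm \<xi>" by (intro mult_right_mono) auto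
  moreover have "0 \<le> real n" "0 \<le> norm \<xi>" by auto
  ultimately have "1 + norm ((2 * real j - real n) *\<^sub>R \<xi>) \<le> (1 + real n) * (1 + norm \<xi>)"
    unfolding norm_scaleR ring_distribs by linarith
  then have "(1 + norm ((2 * real j - real n) *\<^sub>R \<xi>)) ^ N \<le> (1 + real n) ^ N * (1 + norm \<xi>) ^ N"
    unfolding power_mult_distrib[symmetric] by (intro power_mono) auto
  then have "cmod (h ((2 * real j - real n) *\<^sub>R \<xi>)) \<le> A * ((1 + real n) ^ N * (1 + norm \<xi>) ^ N)"
    using A(1) h by (meson mult_left_mono order_trans)
  then have "cmod (trig_coeff \<alpha> \<beta> n j) * cmod (h ((2 * real j - real n) *\<^sub>R \<xi>)) \<le>
     cmod (trig_coeff \<alpha> \<beta> n j) * (A * ((1 + real n) ^ N * (1 + norm \<xi>) ^ N))"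
    by (rule mult_left_mono) simp
  then show ?thesis by (simp add: norm_mult mult.assoc)
qed (simp add: trig_coeff_eq_0)

lemma sum_growth:
  assumes h: "\<And>\<xi>. cmod (h \<xi>) \<le> A * (1 + norm \<xi>) ^ N"
  shows "cmod (\<Sum>j\<le>n. trig_coeff \<alpha> \<beta> n j * h ((2 * real j - real n) *\<^sub>R \<xi>)) \<le> A * (1 + real n) ^ N * (1 + norm \<xi>) ^ N"
proof -
  have "cmod (\<Sum>j\<le>n. trig_coeff \<alpha> \<beta> n j * h ((2 * real j - real n) *\<^sub>R \<xi>)) \<le>
     (\<Sum>j\<le>n. cmod (trig_coeff \<alpha> \<beta> n j) * (A * (1 + real n) ^ N) * (1 + norm \<xi>) ^ N)"
    by (intro order_trans[OF norm_sum] sum_mono term_growth h)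
  also have "\<dots> = A * (1 + real n) ^ N * (1 + norm \<xi>) ^ N"
    by (simp add: sum_distrib_right[symmetric] trig_coeff_norm[OF ab])
  finally show ?thesis .
qed

lemma power_symbol_measurable [measurable]: "power_symbol n \<in> borel_measurable borel"
  unfolding power_symbol_def[abs_def] by measurable

text \<open>The polynomial loss is eventually below \<open>2 ^ n\<close>, which the exponential
  series at \<open>2 * \<bar>t\<bar>\<close> absorbs.\<close>

lemma summable_exp_growth: "summable (\<lambda>n. \<bar>t\<bar> ^ n / fact n * (B * (1 + real n) ^ N))"
proof -
  have "eventually (\<lambda>n. norm (\<bar>t\<bar> ^ n / fact n * (B * (1 + real n) ^ N)) \<le> \<bar>B\<bar> * ((2 * \<bar>t\<bar>) ^ n /\<^sub>R fact n)) sequentially"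
  proof -
    have "eventually (\<lambda>n. (1 + real n) ^ N \<le> 2 ^ n) sequentially" by real_asymp
    then show ?thesis
    proof eventually_elim
      case (elim n)
      have "norm (\<bar>t\<bar> ^ n / fact n * (B * (1 + real n) ^ N)) = \<bar>B\<bar> * (\<bar>t\<bar> ^ n / fact n) * (1 + real n) ^ N"
        by (simp add: abs_mult)
      also have "\<dots> \<le> \<bar>B\<bar> * (\<bar>t\<bar> ^ n / fact n) * 2 ^ n"
        using elim by (intro mult_left_mono) auto
      finally show ?case by (simp add: power_mult_distrib divide_inverse mult_ac)
    qed
  qed
  then show ?thesis
    by (rule summable_comparison_test_ev) (intro summable_mult summable_exp_generic)
qed

lemma summable_exp_power_symbol: "summable (\<lambda>n. cmod ((\<i> * of_real t) ^ n / fact n * power_symbol n \<xi>))"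
proof (rule summable_comparison_test'[OF summable_mult2[OF summable_exp_growth[of t A], of "(1 + norm \<xi>) ^ N"], of 0])
  fix n
  show "norm (cmod ((\<i> * of_real t) ^ n / fact n * power_symbol n \<xi>)) \<le> \<bar>t\<bar> ^ n / fact n * (A * (1 + real n) ^ N) * (1 + norm \<xi>) ^ N"
    using mult_left_mono[OF sum_growth[of m n \<xi>, OF m_growth], of "\<bar>t\<bar> ^ n / fact n"]
    by (simp add: norm_mult norm_divide norm_power power_symbol_def mult.assoc)
qed

text \<open>For fixed \<open>k\<close> the exponential series is integrated termwise, since
  \<open>trig\<close> is bounded by 1 and \<open>K k\<close> is integrable. The resulting majorant
  may blow up with \<open>k\<close>, so the limit in \<open>k\<close> relies on Tannery's theorem
  with the growth bound that is uniform in \<open>k\<close>.\<close>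

lemma exp_symbol_lim:
  "(\<lambda>k. LINT u|lborel. exp (\<i> * of_real t * trig (\<gamma> u \<bullet> \<xi>)) * K k u) \<longlonglongrightarrow> (\<Sum>n. (\<i> * of_real t) ^ n / fact n * power_symbol n \<xi>)"
proof -
  define Mk where "Mk k n = (\<Sum>j\<le>n. trig_coeff \<alpha> \<beta> n j * trunc_symbol k ((2 * real j - real n) *\<^sub>R \<xi>))" for k n
  define c where "c n = (\<i> * of_real t) ^ n / fact n" for n
  have Xm [measurable]: "trig \<in> borel_measurable borel"
    unfolding trig_def[abs_def] cis_conv_exp by measurable
  have X1: "cmod (trig \<theta> ^ n) \<le> 1" for \<theta> n
    unfolding norm_power trig_def by (intro power_le_one trig_norm_le ab) simp
  have int: "integrable lborel (\<lambda>u. c n * (trig (\<gamma> u \<bullet> \<xi>) ^ n * K k u))" for n k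
    by (intro integrable_mult_right, rule Bochner_Integration.integrable_bound[OF K[of k]])
       (simp_all add: norm_mult mult_left_le_one_le X1)
  have Mk: "(LINT u|lborel. c n * (trig (\<gamma> u \<bullet> \<xi>) ^ n * K k u)) = c n * Mk k n" for n k
  proof -
    have eq: "trig (\<gamma> u \<bullet> \<xi>) ^ n * K k u = (\<Sum>j\<le>n. trig_coeff \<alpha> \<beta> n j * (cis (- (\<gamma> u \<bullet> ((2 * real j - real n) *\<^sub>R \<xi>))) * K k u))" for u
      unfolding trig_def trig_power sum_distrib_right by (intro sum.cong refl) (simp add: mult.commute[of "\<gamma> u \<bullet> \<xi>"])
    have int_cis: "integrable lborel (\<lambda>u. trig_coeff \<alpha> \<beta> n j * (cis (- (\<gamma> u \<bullet> v)) * K k u))" for j v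
      using integrable_mult_cis[OF K, of "\<lambda>u. - (\<gamma> u \<bullet> v)" k] by (intro integrable_mult_right) (simp add: mult.commute)
    have "(LINT u|lborel. trig (\<gamma> u \<bullet> \<xi>) ^ n * K k u) = Mk k n"
      unfolding eq Bochner_Integration.integral_sum[OF int_cis] Mk_def trunc_symbol_def integral_mult_right_zero ..
    then show ?thesis by (simp only: integral_mult_right_zero)
  qed
  have "(LINT u|lborel. exp (\<i> * of_real t * trig (\<gamma> u \<bullet> \<xi>)) * K k u) = (\<Sum>n. c n * Mk k n)" for k
  proof -
    have e: "(\<lambda>n. c n * (trig (\<gamma> u \<bullet> \<xi>) ^ n * K k u)) sums (exp (\<i> * of_real t * trig (\<gamma> u \<bullet> \<xi>)) * K k u)" for u
    proof -
      have "(\<lambda>n. (\<i> * of_real t * trig (\<gamma> u \<bullet> \<xi>)) ^ n /\<^sub>R fact n * K k u) sums (exp (\<i> * of_real t * trig (\<gamma> u \<bullet> \<xi>)) * K k u)"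
        by (intro sums_mult2 exp_converges)
      then show ?thesis by (simp add: c_def power_mult_distrib scaleR_conv_of_real field_simps)
    qed
    have bd: "cmod (c n * (trig (\<gamma> u \<bullet> \<xi>) ^ n * K k u)) \<le> \<bar>t\<bar> ^ n /\<^sub>R fact n * cmod (K k u)" for n u
    proof -
      have "cmod (c n) = \<bar>t\<bar> ^ n /\<^sub>R fact n"
        by (simp add: c_def norm_mult norm_divide norm_power divide_inverse[where 'a = real] mult.commute)
      moreover have "cmod (trig (\<gamma> u \<bullet> \<xi>) ^ n * K k u) \<le> cmod (K k u)"
        unfolding norm_mult by (rule mult_left_le_one_le) (simp_all add: X1)
      ultimately show ?thesis unfolding norm_mult[of "c n"] by (simp add: mult_left_mono)
    qed
    have "(LINT u|lborel. (\<Sum>n. c n * (trig (\<gamma> u \<bullet> \<xi>) ^ n * K k u))) = (\<Sum>n. LINT u|lborel. c n * (trig (\<gamma> u \<bullet> \<xi>) ^ n * K k u))"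
    proof (rule integral_suminf[OF int])
      show "AE u in lborel. summable (\<lambda>n. norm (c n * (trig (\<gamma> u \<bullet> \<xi>) ^ n * K k u)))"
      proof (rule AE_I2)
        fix u
        show "summable (\<lambda>n. norm (c n * (trig (\<gamma> u \<bullet> \<xi>) ^ n * K k u)))"
          by (rule summable_comparison_test'[OF summable_mult2[OF summable_exp_generic[of "\<bar>t\<bar>"], of "cmod (K k u)"], of 0])
             (use bd in simp)
      qed
      show "summable (\<lambda>n. LINT u|lborel. norm (c n * (trig (\<gamma> u \<bullet> \<xi>) ^ n * K k u)))"
      proof (rule summable_comparison_test'[OF summable_mult2[OF summable_exp_generic[of "\<bar>t\<bar>"], of "LINT u|lborel. cmod (K k u)"], of 0])
        fix n
        have "(LINT u|lborel. norm (c n * (trig (\<gamma> u \<bullet> \<xi>) ^ n * K k u))) \<le> (LINT u|lborel. \<bar>t\<bar> ^ n /\<^sub>R fact n * cmod (K k u))"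
          by (intro integral_mono integrable_norm int integrable_mult_right K bd)
        then show "norm (LINT u|lborel. norm (c n * (trig (\<gamma> u \<bullet> \<xi>) ^ n * K k u))) \<le> \<bar>t\<bar> ^ n /\<^sub>R fact n * (LINT u|lborel. cmod (K k u))"
          by simp
      qed
    qed
    then show ?thesis by (simp only: Mk sums_unique[OF e, symmetric])
  qed
  moreover have "(\<lambda>k. \<Sum>n. c n * Mk k n) \<longlonglongrightarrow> (\<Sum>n. c n * power_symbol n \<xi>)"
  proof -
    have l: "(\<lambda>k. c n * Mk k n) \<longlonglongrightarrow> c n * power_symbol n \<xi>" for n
      unfolding Mk_def power_symbol_def by (intro tendsto_intros trunc_symbol_lim)
    have b: "norm (c n * Mk k n) \<le> \<bar>t\<bar> ^ n / fact n * (A * (1 + real n) ^ N) * (1 + norm \<xi>) ^ N" for n k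
      using mult_left_mono[OF sum_growth[of "trunc_symbol k" n \<xi>, OF trunc_symbol_growth], of "\<bar>t\<bar> ^ n / fact n"]
      by (simp add: c_def norm_mult norm_divide norm_power Mk_def mult.assoc)
    show ?thesis
      using tannerys_theorem[where a = "\<lambda>n k. c n * Mk k n" and b = "\<lambda>n. c n * power_symbol n \<xi>", OF l always_eventually summable_mult2[OF summable_exp_growth[of t A], of "(1 + norm \<xi>) ^ N"] sequentially_bot] b
      by auto
  qed
  ultimately show ?thesis by (simp add: c_def)
qed

text \<open>Dilations keep the bound \<open>C\<close>, and the coefficients have total mass 1. The
  term with \<open>2 * j = n\<close> is a constant instead of a dilation; it is the reason for the
  assumption on \<open>m 0\<close>.\<close>

lemma power_symbol_Lp_bounds:
  assumes p: "1 \<le> p" and C: "0 < C" "C \<in> Lp_bounds p (multiplier_op m)"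
    and m0: "\<And>f :: real ^ 'n \<Rightarrow> complex. test_function f \<Longrightarrow> f \<noteq> (\<lambda>_. 0) \<Longrightarrow> cmod (m 0) \<le> C"
  shows "C \<in> Lp_bounds p (multiplier_op (power_symbol n))"
proof -
  let ?c = "trig_coeff \<alpha> \<beta> n" and ?s = "\<lambda>j. 2 * real j - real n"
  have fin: "(\<lambda>j. cmod (?c j) * B) sums B" for B
    using sums_mult2[OF sums_finite[of "{..n}" "\<lambda>j. cmod (?c j)"], of B]
    by (auto simp: trig_coeff_norm[OF ab] trig_coeff_eq_0)
  have Mn: "(\<Sum>j. ?c j * m (?s j *\<^sub>R \<xi>)) = power_symbol n \<xi>" for \<xi>
    unfolding power_symbol_def by (rule suminf_finite) (auto simp: trig_coeff_eq_0)
  have "(\<Sum>j. cmod (?c j) * C) \<in> Lp_bounds p (multiplier_op (power_symbol n))"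
  proof (rule Lp_bounds_sums[OF p])
    show "C \<in> Lp_bounds p (multiplier_op (\<lambda>\<xi>. m (?s j *\<^sub>R \<xi>)))" for j
    proof (cases "?s j = 0")
      case True
      then show ?thesis using Lp_bounds_const[OF p less_imp_le[OF C(1)] m0] by simp
    next
      case False
      then show ?thesis using Lp_bounds_scale[OF _ False C(2)] p by simp
    qed
    show "summable (\<lambda>j. cmod (?c j) * C)" using fin by (rule sums_summable)
    fix f :: "real ^ 'n \<Rightarrow> complex" and x assume f: "test_function f"
    have "(\<lambda>j. multiplier_op (\<lambda>\<xi>. ?c j * m (?s j *\<^sub>R \<xi>)) f x) sums multiplier_op (\<lambda>\<xi>. \<Sum>j. ?c j * m (?s j *\<^sub>R \<xi>)) f x"
      by (rule multiplier_op_sums[OF _ term_growth[OF m_growth] sums_summable[OF fin] f]) measurable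
    then show "(\<lambda>j. ?c j * multiplier_op (\<lambda>\<xi>. m (?s j *\<^sub>R \<xi>)) f x) sums multiplier_op (power_symbol n) f x"
      by (simp add: multiplier_op_cmult Mn)
  qed (rule C)
  then show ?thesis using fin[of C] by (simp add: sums_iff)
qed

lemma exp_symbol_Lp_bounds:
  assumes p: "1 \<le> p" and C: "0 < C" "C \<in> Lp_bounds p (multiplier_op m)"
    and m0: "\<And>f :: real ^ 'n \<Rightarrow> complex. test_function f \<Longrightarrow> f \<noteq> (\<lambda>_. 0) \<Longrightarrow> cmod (m 0) \<le> C"
  shows "C * exp \<bar>t\<bar> \<in> Lp_bounds p (multiplier_op (\<lambda>\<xi>. \<Sum>n. (\<i> * of_real t) ^ n / fact n * power_symbol n \<xi>))"
proof -
  let ?c = "\<lambda>n. (\<i> * of_real t) ^ n / fact n"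
  have s: "(\<lambda>n. cmod (?c n) * C) sums (exp \<bar>t\<bar> * C)"
    using sums_mult2[OF exp_converges[of "\<bar>t\<bar>"], of C]
    by (simp add: norm_mult norm_divide norm_power divide_inverse[where 'a = real] mult_ac)
  have "(\<Sum>n. cmod (?c n) * C) \<in> Lp_bounds p (multiplier_op (\<lambda>\<xi>. \<Sum>n. ?c n * power_symbol n \<xi>))"
  proof (rule Lp_bounds_sums[OF p _ power_symbol_Lp_bounds[OF p C m0]])
    fix f :: "real ^ 'n \<Rightarrow> complex" and x assume f: "test_function f"
    have "(\<lambda>n. multiplier_op (\<lambda>\<xi>. ?c n * power_symbol n \<xi>) f x) sums multiplier_op (\<lambda>\<xi>. \<Sum>n. ?c n * power_symbol n \<xi>) f x"
    proof (rule multiplier_op_sums[OF _ _ summable_exp_growth[of t A] f])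
      show "cmod (?c n * power_symbol n \<xi>) \<le> \<bar>t\<bar> ^ n / fact n * (A * (1 + real n) ^ N) * (1 + norm \<xi>) ^ N" for n \<xi>
        using mult_left_mono[OF sum_growth[of m n \<xi>, OF m_growth], of "\<bar>t\<bar> ^ n / fact n"]
        by (simp add: norm_mult norm_divide norm_power power_symbol_def mult.assoc)
    qed measurable
    then show "(\<lambda>n. ?c n * multiplier_op (power_symbol n) f x) sums multiplier_op (\<lambda>\<xi>. \<Sum>n. ?c n * power_symbol n \<xi>) f x"
      by (simp only: multiplier_op_cmult)
  qed (use s C in \<open>auto simp: sums_iff\<close>)
  then show ?thesis using s by (simp add: sums_iff mult.commute)
qed

lemma exp_symbol_measurable: "(\<lambda>\<xi>. \<Sum>n. (\<i> * of_real t) ^ n / fact n * power_symbol n \<xi>) \<in> borel_measurable borel"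
  by measurable

lemma exp_symbol_growth: "poly_growth (\<lambda>\<xi>. \<Sum>n. (\<i> * of_real t) ^ n / fact n * power_symbol n \<xi>)"
  unfolding poly_growth_def
proof (intro exI allI)
  fix \<xi>
  have "cmod (\<Sum>n. (\<i> * of_real t) ^ n / fact n * power_symbol n \<xi>) \<le> (\<Sum>n. cmod ((\<i> * of_real t) ^ n / fact n * power_symbol n \<xi>))"
    by (rule summable_norm[OF summable_exp_power_symbol])
  also have "\<dots> \<le> (\<Sum>n. \<bar>t\<bar> ^ n / fact n * (A * (1 + real n) ^ N) * (1 + norm \<xi>) ^ N)"
    using mult_left_mono[OF sum_growth[of m _ \<xi>, OF m_growth], of "\<bar>t\<bar> ^ _ / fact _"]
    by (intro suminf_le summable_exp_power_symbol summable_mult2 summable_exp_growth)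
       (simp add: norm_mult norm_divide norm_power power_symbol_def mult.assoc)
  finally show "cmod (\<Sum>n. (\<i> * of_real t) ^ n / fact n * power_symbol n \<xi>) \<le> (\<Sum>n. \<bar>t\<bar> ^ n / fact n * (A * (1 + real n) ^ N)) * (1 + norm \<xi>) ^ N"
    by (simp only: suminf_mult2[OF summable_exp_growth])
qed

end

end

section \<open>Principal values\<close>

text \<open>Truncation at \<open>1 / (k + 1)\<close> turns the limit at 0 into a sequential one, as
  needed for dominated convergence.\<close>

lemma pv_sequentially:
  assumes "pv_exists g"
  shows "integrable lborel (\<lambda>u. indicator (annulus (inverse (real (Suc k)))) u *\<^sub>R g u)"
    and "(\<lambda>k. LINT u|lborel. indicator (annulus (inverse (real (Suc k)))) u *\<^sub>R g u) \<longlonglongrightarrow> pv_integral g"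
proof -
  show "integrable lborel (\<lambda>u. indicator (annulus (inverse (real (Suc k)))) u *\<^sub>R g u)"
    using assms by (simp add: pv_exists_def set_integrable_def del: of_nat_Suc)
  obtain l where l: "((\<lambda>\<epsilon>. LINT u:annulus \<epsilon>|lborel. g u) \<longlongrightarrow> l) (at_right 0)"
    using assms by (auto simp: pv_exists_def)
  then have "pv_integral g = l" unfolding pv_integral_def by (intro tendsto_Lim) auto
  moreover have "filterlim (\<lambda>k. inverse (real (Suc k))) (at_right 0) sequentially"
    unfolding filterlim_at using LIMSEQ_inverse_real_of_nat by (auto intro!: always_eventually)
  ultimately show "(\<lambda>k. LINT u|lborel. indicator (annulus (inverse (real (Suc k)))) u *\<^sub>R g u) \<longlonglongrightarrow> pv_integral g"
    using filterlim_compose[OF l] by (simp add: set_lebesgue_integral_def)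
qed

lemma integrable_bounded_mult:
  fixes h K :: "'a \<Rightarrow> complex"
  assumes K: "integrable M K" and h: "h \<in> borel_measurable M" "\<And>u. cmod (h u) \<le> B"
  shows "integrable M (\<lambda>u. h u * K u)"
proof (rule Bochner_Integration.integrable_bound)
  show "integrable M (\<lambda>u. B * cmod (K u))" using K by simp
  show "(\<lambda>u. h u * K u) \<in> borel_measurable M" using K h by simp
  show "AE u in M. norm (h u * K u) \<le> norm (B * cmod (K u))"
  proof (rule AE_I2)
    fix u
    have "norm (h u * K u) \<le> B * cmod (K u)" by (simp add: norm_mult mult_right_mono h(2))
    also have "\<dots> \<le> norm (B * cmod (K u))" by simp
    finally show "norm (h u * K u) \<le> norm (B * cmod (K u))" .
  qed
qed

text \<open>Reduces integrable kernels to the principal value case: the L1 norm bounds all truncated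
  symbols, and the symbol is continuous, so a bound almost everywhere also holds at 0.\<close>

lemma integrable_kernel_admissible:
  fixes \<gamma> :: "real \<Rightarrow> real ^ 'n::finite"
  assumes \<gamma>: "continuous_on UNIV \<gamma>" and K: "integrable lborel K"
  shows "pv_integrals_exist \<gamma> K" and "pv_symbol_regular \<gamma> K"
proof -
  have [measurable]: "\<gamma> \<in> borel_measurable borel" using \<gamma> by (rule borel_measurable_continuous_onI)
  have [measurable]: "K \<in> borel_measurable borel" using K by auto
  have ex: "integrable lborel (\<lambda>u. h u * K u)" if "h \<in> borel_measurable borel" "\<And>u. cmod (h u) \<le> B" for h B
    using that by (intro integrable_bounded_mult[OF K, of _ B]) simp_all
  have ci: "integrable lborel (\<lambda>u. cis (- (\<gamma> u \<bullet> \<xi>)) * K u)" for \<xi>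
  proof (rule ex[of _ 1])
    show "(\<lambda>u. cis (- (\<gamma> u \<bullet> \<xi>))) \<in> borel_measurable borel" unfolding cis_conv_exp by measurable
  qed simp
  show "pv_integrals_exist \<gamma> K"
    unfolding pv_integrals_exist_def
  proof (intro conjI allI impI pv_of_integrable(1) ci)
    show "integrable lborel (\<lambda>u. f (x - \<gamma> u) * K u)" if f: "test_function f" for f x
    proof -
      obtain M where M': "\<And>x. cmod (f x) \<le> M"
        using test_function_norm_le[OF f] by metis
      have [measurable]: "f \<in> borel_measurable borel" using f by (rule test_function_measurable)
      show ?thesis by (rule ex[of _ M]) (measurable, rule M')
    qed
    show "integrable lborel (\<lambda>u. exp (\<i> * of_real (t * cos (\<gamma> u \<bullet> \<xi>))) * K u)" for t \<xi>
    proof (rule ex[of _ 1])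
      have [measurable]: "(\<lambda>\<theta>. exp (\<i> * of_real (t * cos \<theta>))) \<in> borel_measurable borel"
        by (intro borel_measurable_continuous_onI continuous_intros)
      show "(\<lambda>u. exp (\<i> * of_real (t * cos (\<gamma> u \<bullet> \<xi>)))) \<in> borel_measurable borel" by measurable
    qed simp
    show "integrable lborel (\<lambda>u. exp (\<i> * of_real (t * sin (\<gamma> u \<bullet> \<xi>))) * K u)" for t \<xi>
    proof (rule ex[of _ 1])
      have [measurable]: "(\<lambda>\<theta>. exp (\<i> * of_real (t * sin \<theta>))) \<in> borel_measurable borel"
        by (intro borel_measurable_continuous_onI continuous_intros)
      show "(\<lambda>u. exp (\<i> * of_real (t * sin (\<gamma> u \<bullet> \<xi>)))) \<in> borel_measurable borel" by measurable
    qed simp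
  qed
  show "pv_symbol_regular \<gamma> K"
    unfolding pv_symbol_regular_def
  proof (intro conjI exI allI impI)
    fix \<epsilon> :: real and \<xi> assume "0 < \<epsilon>"
    have "cmod (LINT u:annulus \<epsilon>|lborel. cis (- (\<gamma> u \<bullet> \<xi>)) * K u) \<le> (LINT u|lborel. cmod (K u))"
      unfolding set_lebesgue_integral_def
    proof (rule order_trans[OF integral_norm_bound integral_mono])
      show "integrable lborel (\<lambda>u. norm (indicator (annulus \<epsilon>) u *\<^sub>R (cis (- (\<gamma> u \<bullet> \<xi>)) * K u)))"
        by (intro integrable_norm integrable_mult_indicator ci) simp
    qed (use K in \<open>auto simp: norm_mult indicator_def\<close>)
    then show "cmod (LINT u:annulus \<epsilon>|lborel. cis (- (\<gamma> u \<bullet> \<xi>)) * K u) \<le> (LINT u|lborel. cmod (K u)) * (1 + norm \<xi>) ^ 0"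
      by simp
  next
    fix A assume ae: "AE \<xi> in lborel. cmod (curve_symbol \<gamma> K \<xi>) \<le> A"
    have c: "continuous_on UNIV (curve_symbol \<gamma> K)"
      using continuous_curve_symbol[OF \<gamma> K] by (simp add: curve_symbol_def[abs_def] pv_of_integrable(2)[OF ci])
    show "cmod (curve_symbol \<gamma> K 0) \<le> A"
      by (rule AE_lborel_open[OF ae]) (simp add: not_le, intro open_Collect_less continuous_intros c)
  qed
qed

lemma curve_multipliers_bounded:
  fixes \<gamma> :: "real \<Rightarrow> real ^ 'n::finite"
  assumes p: "1 \<le> p" and \<gamma>: "continuous_on UNIV \<gamma>" and K: "admissible_kernel \<gamma> K"
    and bd: "bounded_on_Lp p (curve_op \<gamma> K)" "Lp_opnorm p (curve_op \<gamma> K) \<le> B"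
  shows "cos_mult \<gamma> K t \<in> Mp p \<and> Mp_norm p (cos_mult \<gamma> K t) \<le> B * exp \<bar>t\<bar> \<and>
         sin_mult \<gamma> K t \<in> Mp p \<and> Mp_norm p (sin_mult \<gamma> K t) \<le> B * exp \<bar>t\<bar>"
proof -
  have pv: "pv_integrals_exist \<gamma> K" and reg: "pv_symbol_regular \<gamma> K"
    using K integrable_kernel_admissible[OF \<gamma>] by (auto simp: admissible_kernel_def)
  have B0: "0 \<le> B" using Lp_opnorm_nonneg[OF bd(1)] bd(2) by simp
  define \<kappa> where "\<kappa> k u = indicator (annulus (inverse (real (Suc k)))) u *\<^sub>R K u" for k u
  have \<kappa>_mult: "a * \<kappa> k u = indicator (annulus (inverse (real (Suc k)))) u *\<^sub>R (a * K u)" for a k u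
    by (simp add: \<kappa>_def)
  \<comment> \<open>At \<open>t = 0\<close> the exponential is 1, so the assumed principal values
    include that of \<open>K\<close> itself; in particular its truncations are integrable.\<close>
  have "pv_exists (\<lambda>u. exp (\<i> * of_real (0 * cos (\<gamma> u \<bullet> 0))) * K u)"
    using pv unfolding pv_integrals_exist_def by blast
  then have "pv_exists K" by simp
  then have \<kappa>: "integrable lborel (\<kappa> k)" for k
    unfolding \<kappa>_def[abs_def] by (rule pv_sequentially(1))
  obtain A0 N where A0: "\<And>\<epsilon> \<xi>. 0 < \<epsilon> \<Longrightarrow> cmod (LINT u:annulus \<epsilon>|lborel. cis (- (\<gamma> u \<bullet> \<xi>)) * K u) \<le> A0 * (1 + norm \<xi>) ^ N"
    using reg unfolding pv_symbol_regular_def by blast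
  have "curve_symbol_approx \<gamma> \<kappa> (curve_symbol \<gamma> K) \<bar>A0\<bar> N"
  proof
    fix k \<xi>
    have "cmod (LINT u|lborel. cis (- (\<gamma> u \<bullet> \<xi>)) * \<kappa> k u) \<le> A0 * (1 + norm \<xi>) ^ N"
      using A0[of "inverse (real (Suc k))" \<xi>] unfolding \<kappa>_mult set_lebesgue_integral_def by simp
    also have "\<dots> \<le> \<bar>A0\<bar> * (1 + norm \<xi>) ^ N" by (intro mult_right_mono) auto
    finally show "cmod (LINT u|lborel. cis (- (\<gamma> u \<bullet> \<xi>)) * \<kappa> k u) \<le> \<bar>A0\<bar> * (1 + norm \<xi>) ^ N" .
  next
    fix \<xi>
    show "(\<lambda>k. LINT u|lborel. cis (- (\<gamma> u \<bullet> \<xi>)) * \<kappa> k u) \<longlonglongrightarrow> curve_symbol \<gamma> K \<xi>"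
      unfolding curve_symbol_def \<kappa>_mult using pv by (intro pv_sequentially(2)) (simp add: pv_integrals_exist_def)
  qed (use \<gamma> \<kappa> in auto)
  then interpret curve_symbol_approx \<gamma> \<kappa> "curve_symbol \<gamma> K" "\<bar>A0\<bar>" N .
  have "curve_op \<gamma> K f x = multiplier_op (curve_symbol \<gamma> K) f x" if f: "test_function f" for f x
  proof (rule LIMSEQ_unique)
    show "(\<lambda>k. LINT u|lborel. f (x - \<gamma> u) * \<kappa> k u) \<longlonglongrightarrow> curve_op \<gamma> K f x"
      unfolding curve_op_def \<kappa>_mult using pv f by (intro pv_sequentially(2)) (simp add: pv_integrals_exist_def)
  qed (rule curve_integral_lim[OF f])
  then have "Lp_bounds p (curve_op \<gamma> K) = Lp_bounds p (multiplier_op (curve_symbol \<gamma> K))"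
    by (rule Lp_bounds_cong)
  then have C: "C \<in> Lp_bounds p (multiplier_op (curve_symbol \<gamma> K))" if "B < C" for C
    using Lp_bounds_of_opnorm_less[OF bd(1)] bd(2) that by force
  \<comment> \<open>The essential bound says nothing about the single frequency 0; the second half
    of \<open>pv_symbol_regular\<close> carries it there.\<close>
  have C0: "cmod (curve_symbol \<gamma> K 0) \<le> C"
    if "B < C" and "test_function f" "f \<noteq> (\<lambda>_. 0)" for C and f :: "real ^ 'n \<Rightarrow> complex"
  proof -
    have "AE \<xi> in lborel. cmod (curve_symbol \<gamma> K \<xi>) \<le> C"
      using multiplier_essentially_bounded[OF _ C[OF that(1)] that(2,3) continuous_trunc_symbol abs_ge_zero trunc_symbol_growth trunc_symbol_lim] p by simp
    then show ?thesis using reg by (simp add: pv_symbol_regular_def)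
  qed
  \<comment> \<open>Treats cos (\<open>\<alpha> = \<beta> = 1 / 2\<close>) and sin
    (\<open>\<alpha> = \<i> / 2\<close>, \<open>\<beta> = - \<i> / 2\<close>) together.\<close>
  have main: "mu \<in> Mp p \<and> Mp_norm p mu \<le> B * exp \<bar>t\<bar>"
    if ab: "cmod \<alpha> = 1 / 2" "cmod \<beta> = 1 / 2" and h: "\<And>\<theta>. \<alpha> * cis (- \<theta>) + \<beta> * cis \<theta> = of_real (h \<theta>)"
      and mu: "mu = (\<lambda>\<xi>. pv_integral (\<lambda>u. exp (\<i> * of_real (t * h (\<gamma> u \<bullet> \<xi>))) * K u))"
      and ex: "\<And>\<xi>. pv_exists (\<lambda>u. exp (\<i> * of_real (t * h (\<gamma> u \<bullet> \<xi>))) * K u)" for \<alpha> \<beta> mu h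
  proof -
    have "mu \<xi> = (\<Sum>n. (\<i> * of_real t) ^ n / fact n * power_symbol \<alpha> \<beta> n \<xi>)" for \<xi>
    proof (rule LIMSEQ_unique)
      show "(\<lambda>k. LINT u|lborel. exp (\<i> * of_real t * trig \<alpha> \<beta> (\<gamma> u \<bullet> \<xi>)) * \<kappa> k u) \<longlonglongrightarrow> mu \<xi>"
        using pv_sequentially(2)[OF ex[of \<xi>]] unfolding mu \<kappa>_mult trig_def[OF ab] h by (simp add: mult.assoc)
    qed (rule exp_symbol_lim[OF ab])
    then have mu': "mu = (\<lambda>\<xi>. \<Sum>n. (\<i> * of_real t) ^ n / fact n * power_symbol \<alpha> \<beta> n \<xi>)" by auto
    have "C * exp \<bar>t\<bar> \<in> Lp_bounds p (multiplier_op mu)" if "B < C" for C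
      unfolding mu' using B0 that by (intro exp_symbol_Lp_bounds[OF ab p] C C0) auto
    moreover have "mu \<in> borel_measurable borel" "poly_growth mu"
      unfolding mu' by (rule exp_symbol_measurable[OF ab], rule exp_symbol_growth[OF ab])
    ultimately show ?thesis
      using Lp_opnorm_le[of B "exp \<bar>t\<bar>" p "multiplier_op mu"]
      by (auto simp: Mp_def Mp_norm_def intro: integrable_mult_fourier)
  qed
  have "cos_mult \<gamma> K t \<in> Mp p \<and> Mp_norm p (cos_mult \<gamma> K t) \<le> B * exp \<bar>t\<bar>"
    by (rule main[of "1 / 2" "1 / 2" cos])
       (use pv in \<open>auto simp: cos_mult_def[abs_def] pv_integrals_exist_def complex_eq_iff\<close>)
  moreover have "sin_mult \<gamma> K t \<in> Mp p \<and> Mp_norm p (sin_mult \<gamma> K t) \<le> B * exp \<bar>t\<bar>"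
    by (rule main[of "\<i> / 2" "- \<i> / 2" sin])
       (use pv in \<open>auto simp: sin_mult_def[abs_def] pv_integrals_exist_def complex_eq_iff norm_divide\<close>)
  ultimately show ?thesis by blast
qed

section \<open>A non-quasianalytic trigonometric expansion of the identity\<close>

text \<open>Termwise integration of the binomial series of the derivative of arcsin. Because the
  coefficients are nonnegative, the bound \<open>arcsin y \<le> pi / 2\<close> for \<open>y\<close>
  below 1 passes to their partial sums as \<open>y\<close> tends to 1.\<close>

lemma arcsin_series:
  obtains a :: "nat \<Rightarrow> real" where "\<And>k. 0 \<le> a k" "summable a"
    "\<And>y. \<bar>y\<bar> < 1 \<Longrightarrow> (\<lambda>k. a k * y ^ Suc k) sums arcsin y"
proof -
  define d where "d n = pochhammer (1 / 2 :: real) n / fact n" for n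
  \<comment> \<open>Only even powers occur in the derivative, hence the interleaved zeros; the
    division by \<open>Suc k\<close> is the integration.\<close>
  define a where "a k = (if even k then d (k div 2) else 0) / real (Suc k)" for k
  have d0: "0 \<le> d n" for n by (simp add: d_def pochhammer_nonneg)
  have a0: "0 \<le> a k" for k using d0 by (simp add: a_def)
  have D: "(\<lambda>k. a k * real (Suc k) * x ^ k) sums inverse (sqrt (1 - x\<^sup>2))" if x: "\<bar>x\<bar> < 1" for x
  proof -
    have x2: "x\<^sup>2 < 1" using x by (simp add: abs_square_less_1)
    then have "(\<lambda>n. ((- 1 / 2) gchoose n) * (- x\<^sup>2) ^ n) sums (1 + - x\<^sup>2) powr (- 1 / 2)"
      by (intro gen_binomial_real) simp
    moreover have "((- 1 / 2) gchoose n) * (- x\<^sup>2) ^ n = d n * x ^ (2 * n)" for n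
    proof -
      have "(- 1 :: real) ^ n * (- 1) ^ n = 1" by (simp add: power_mult_distrib[symmetric])
      then show ?thesis
        by (simp add: gbinomial_pochhammer d_def power_minus[of "x\<^sup>2"] power_mult)
    qed
    moreover have "(1 + - x\<^sup>2) powr (- 1 / 2) = inverse (sqrt (1 - x\<^sup>2))"
      using x2 by (simp add: powr_minus powr_half_sqrt)
    ultimately have "(\<lambda>n. d n * x ^ (2 * n)) sums inverse (sqrt (1 - x\<^sup>2))" by simp
    from sums_if[OF sums_zero this] have "(\<lambda>n. if even n then d (n div 2) * x ^ (2 * (n div 2)) else 0) sums inverse (sqrt (1 - x\<^sup>2))"
      by simp
    moreover have "(if even n then d (n div 2) * x ^ (2 * (n div 2)) else 0) = a n * real (Suc n) * x ^ n" for n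
      by (simp add: a_def)
    ultimately show ?thesis by simp
  qed
  have deriv: "((\<lambda>x. (\<Sum>k. a k * x ^ Suc k) - arcsin x) has_real_derivative 0) (at x)" if x: "\<bar>x\<bar> < 1" for x
  proof -
    have "((\<lambda>x. \<Sum>k. a k * x ^ Suc k) has_real_derivative (\<Sum>k. a k * real (Suc k) * x ^ k)) (at x)"
      using x D by (intro DERIV_power_series'[where R = 1]) (auto simp: sums_iff abs_less_iff)
    moreover have "(arcsin has_real_derivative inverse (sqrt (1 - x\<^sup>2))) (at x)"
      using x by (intro DERIV_arcsin) auto
    ultimately have "((\<lambda>x. (\<Sum>k. a k * x ^ Suc k) - arcsin x) has_real_derivative
        (\<Sum>k. a k * real (Suc k) * x ^ k) - inverse (sqrt (1 - x\<^sup>2))) (at x)"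
      by (rule DERIV_diff)
    then show ?thesis using D[OF x] by (simp add: sums_iff)
  qed
  have eq: "(\<Sum>k. a k * x ^ Suc k) = arcsin x" if x: "\<bar>x\<bar> < 1" for x
  proof -
    have "(\<Sum>k. a k * x ^ Suc k) - arcsin x = (\<Sum>k. a k * 0 ^ Suc k) - arcsin 0"
      by (rule DERIV_isconst3[of "-1" 1]) (use x deriv in auto)
    then show ?thesis by simp
  qed
  have sums: "(\<lambda>k. a k * y ^ Suc k) sums arcsin y" if y: "\<bar>y\<bar> < 1" for y
  proof -
    have "summable (\<lambda>k. a k * y ^ Suc k)"
    proof (rule summable_comparison_test'[of "\<lambda>k. a k * real (Suc k) * \<bar>y\<bar> ^ k" 0])
      show "summable (\<lambda>k. a k * real (Suc k) * \<bar>y\<bar> ^ k)" using D[of "\<bar>y\<bar>"] y by (simp add: sums_iff)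
      fix k
      have "\<bar>y\<bar> * \<bar>y\<bar> ^ k \<le> real (Suc k) * \<bar>y\<bar> ^ k" using y by (intro mult_right_mono) auto
      then show "norm (a k * y ^ Suc k) \<le> a k * real (Suc k) * \<bar>y\<bar> ^ k"
        using a0[of k] by (simp add: abs_mult power_abs mult_left_mono mult.assoc)
    qed
    then show ?thesis using eq[OF y] by (simp add: sums_iff)
  qed
  have "summable a"
  proof (rule summableI_nonneg_bounded)
    fix n
    have ev: "eventually (\<lambda>y. (\<Sum>k<n. a k * y ^ Suc k) \<le> pi / 2) (at_left 1)"
    proof (rule eventually_at_leftI[of 0])
      fix y :: real assume y: "y \<in> {0<..<1}"
      have "(\<Sum>k<n. a k * y ^ Suc k) \<le> (\<Sum>k. a k * y ^ Suc k)"
        using sums[of y] y a0 by (intro sum_le_suminf) (auto simp: sums_iff)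
      also have "\<dots> = arcsin y" using eq[of y] y by simp
      also have "\<dots> \<le> pi / 2" using arcsin_ubound[of y] y by simp
      finally show "(\<Sum>k<n. a k * y ^ Suc k) \<le> pi / 2" .
    qed simp
    have "((\<lambda>y. \<Sum>k<n. a k * y ^ Suc k) \<longlongrightarrow> (\<Sum>k<n. a k * 1 ^ Suc k)) (at_left 1)"
      by (intro tendsto_intros)
    from tendsto_upperbound[OF this ev] show "(\<Sum>k<n. a k) \<le> pi / 2" by simp
  qed (rule a0)
  then show ?thesis using that a0 sums by blast
qed

text \<open>Each power of \<open>sin x\<close> is a trigonometric polynomial of coefficient mass 1,
  so the double series has total mass \<open>(\<Sum>k. a k)\<close> and may be flattened by
  \<open>prod_decode\<close>.\<close>

lemma trigonometric_series_identity:
  obtains c :: "nat \<Rightarrow> complex" and \<tau> :: "nat \<Rightarrow> real" where "summable (\<lambda>i. cmod (c i))"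
    "\<And>x. \<bar>x\<bar> < pi / 2 \<Longrightarrow> (\<lambda>i. c i * cis (\<tau> i * x)) sums of_real x"
proof -
  obtain a where a: "\<And>k. 0 \<le> a k" "summable a" "\<And>y. \<bar>y\<bar> < 1 \<Longrightarrow> (\<lambda>k. a k * y ^ Suc k) sums arcsin y"
    using arcsin_series by blast
  define w where "w = trig_coeff (\<i> / 2) (- \<i> / 2)"
  have ab: "cmod (\<i> / 2) = 1 / 2" "cmod (- \<i> / 2) = 1 / 2" by (simp_all add: norm_divide)
  define e where "e = (\<lambda>(k, j). of_real (a k) * w (Suc k) j)"
  define \<sigma> where "\<sigma> = (\<lambda>(k, j). real (Suc k) - 2 * real j)"
  have fin: "((\<lambda>j. f j) has_sum (\<Sum>j\<le>n. f j)) UNIV" if "\<And>j. n < j \<Longrightarrow> f j = 0" for f :: "nat \<Rightarrow> 'a::{comm_monoid_add, topological_space}" and n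
    using has_sum_finite[of "{..n}" f] that by (subst has_sum_cong_neutral[of "{..n}" UNIV]) auto
  have sn: "(\<lambda>z. cmod (e z)) summable_on (UNIV \<times> UNIV)"
  proof (rule summable_on_SigmaI)
    show "((\<lambda>j. cmod (e (k, j))) has_sum a k) UNIV" for k
    proof -
      have "((\<lambda>j. a k * cmod (w (Suc k) j)) has_sum (\<Sum>j\<le>Suc k. a k * cmod (w (Suc k) j))) UNIV"
        by (rule fin) (simp add: w_def trig_coeff_eq_0)
      moreover have "(\<Sum>j\<le>Suc k. a k * cmod (w (Suc k) j)) = a k"
        unfolding w_def sum_distrib_left[symmetric] trig_coeff_norm[OF ab] by simp
      ultimately show ?thesis using a(1)[of k] by (simp add: e_def norm_mult)
    qed
    show "a summable_on UNIV" using a by (simp add: summable_on_UNIV_nonneg_real_iff)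
  qed auto
  have hs: "((\<lambda>z. e z * cis (\<sigma> z * x)) has_sum of_real x) (UNIV \<times> UNIV)" if x: "\<bar>x\<bar> < pi / 2" for x
  proof (rule has_sum_SigmaI)
    show "((\<lambda>j. e (k, j) * cis (\<sigma> (k, j) * x)) has_sum of_real (a k * sin x ^ Suc k)) UNIV" for k
    proof -
      have "((\<lambda>j. e (k, j) * cis (\<sigma> (k, j) * x)) has_sum (\<Sum>j\<le>Suc k. e (k, j) * cis (\<sigma> (k, j) * x))) UNIV"
        by (rule fin) (simp add: e_def w_def trig_coeff_eq_0)
      moreover have "(\<Sum>j\<le>Suc k. e (k, j) * cis (\<sigma> (k, j) * x)) = of_real (a k * sin x ^ Suc k)"
      proof -
        have "complex_of_real (sin x) = (\<i> / 2) * cis (- x) + (- \<i> / 2) * cis x"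
          by (simp add: complex_eq_iff)
        then have "of_real (a k * sin x ^ Suc k) = of_real (a k) * (\<Sum>j\<le>Suc k. w (Suc k) j * cis (- (x * (2 * real j - real (Suc k)))))"
          unfolding of_real_mult of_real_power w_def by (simp only: trig_power)
        also have "\<dots> = (\<Sum>j\<le>Suc k. e (k, j) * cis (\<sigma> (k, j) * x))"
          unfolding sum_distrib_left
          by (intro sum.cong refl) (simp add: e_def \<sigma>_def algebra_simps)
        finally show ?thesis ..
      qed
      ultimately show ?thesis by simp
    qed
    show "((\<lambda>k. complex_of_real (a k * sin x ^ Suc k)) has_sum of_real x) UNIV"
    proof (rule norm_summable_imp_has_sum)
      have "\<bar>sin x\<bar> < 1"
        using x sin_monotone_2pi[of x "pi / 2"] sin_monotone_2pi[of "- (pi / 2)" x] by (simp add: abs_less_iff)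
      then have "(\<lambda>k. a k * sin x ^ Suc k) sums arcsin (sin x)" by (rule a(3))
      then show "(\<lambda>k. complex_of_real (a k * sin x ^ Suc k)) sums of_real x"
        using x arcsin_sin[of x] by (simp add: abs_less_iff sums_of_real_iff del: of_real_mult of_real_power power_Suc)
      show "summable (\<lambda>k. norm (complex_of_real (a k * sin x ^ Suc k)))"
      proof (rule summable_comparison_test'[OF a(2), of 0])
        fix k
        have le: "\<bar>sin x\<bar> ^ Suc k \<le> 1" by (rule power_le_one) auto
        show "norm (norm (complex_of_real (a k * sin x ^ Suc k))) \<le> a k"
          using mult_left_le[OF le a(1)[of k]]
          by (simp only: real_norm_def norm_of_real abs_mult power_abs abs_abs abs_of_nonneg[OF a(1)])
      qed
    qed
    show "(\<lambda>z. e z * cis (\<sigma> z * x)) summable_on (UNIV \<times> UNIV)"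
      by (rule abs_summable_summable) (use sn in \<open>simp add: norm_mult\<close>)
  qed
  show ?thesis
  proof
    have "(\<lambda>i. cmod (e (prod_decode i))) summable_on UNIV"
      using sn summable_on_reindex_bij_betw[OF bij_prod_decode, of "\<lambda>z. cmod (e z)"] by simp
    then show "summable (\<lambda>i. cmod ((e \<circ> prod_decode) i))"
      by (simp add: summable_on_UNIV_nonneg_real_iff)
    fix x :: real assume x: "\<bar>x\<bar> < pi / 2"
    have "((\<lambda>i. e (prod_decode i) * cis (\<sigma> (prod_decode i) * x)) has_sum of_real x) UNIV"
      using hs[OF x] has_sum_reindex_bij_betw[OF bij_prod_decode, of "\<lambda>z. e z * cis (\<sigma> z * x)"] by simp
    then show "(\<lambda>i. (e \<circ> prod_decode) i * cis ((\<sigma> \<circ> prod_decode) i * x)) sums of_real x"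
      by (simp add: has_sum_imp_sums)
  qed
qed

section \<open>Averages over intervals and infinite products of sinc factors\<close>

definition sinc_fun :: "real \<Rightarrow> real" where
  "sinc_fun x = (if x = 0 then 1 else sin x / x)"

lemma integral_cis_Icc:
  assumes a: "0 < a"
  shows "(LINT y|lborel. indicator {x - a..x + a} y *\<^sub>R cis (t * y)) = 2 * of_real a * of_real (sinc_fun (a * t)) * cis (t * x)"
proof (cases "t = 0")
  case True
  have "(LINT y|lborel. indicator {x - a..x + a} y *\<^sub>R (1 :: complex)) = of_real (x + a) - of_real (x - a)"
    using a by (intro integral_FTC_Icc) (auto intro!: derivative_eq_intros simp: has_vector_derivative_of_real)
  then show ?thesis using True by (simp add: sinc_fun_def)
next
  case False
  have "(LINT y|lborel. indicator {x - a..x + a} y *\<^sub>R cis (t * y)) = cis (t * (x + a)) / (\<i> * of_real t) - cis (t * (x - a)) / (\<i> * of_real t)"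
  proof (rule integral_FTC_Icc)
    fix y
    have "((\<lambda>y. cis (t * y)) has_vector_derivative \<i> * of_real t * cis (t * y)) (at y within {x - a..x + a})"
      unfolding has_vector_derivative_def
      by (auto intro!: derivative_eq_intros simp: scaleR_conv_of_real algebra_simps)
    from has_vector_derivative_divide[OF this, of "\<i> * of_real t"] False
    show "((\<lambda>y. cis (t * y) / (\<i> * of_real t)) has_vector_derivative cis (t * y)) (at y within {x - a..x + a})" by simp
  qed (use a in \<open>auto simp: cis_conv_exp intro!: continuous_intros\<close>)
  also have "\<dots> = (cis (t * a) - cis (- (t * a))) * cis (t * x) / (\<i> * of_real t)"
    by (simp add: diff_divide_distrib[symmetric] left_diff_distrib cis_mult algebra_simps)
  also have "cis (t * a) - cis (- (t * a)) = 2 * \<i> * of_real (sin (a * t))"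
    by (simp add: complex_eq_iff mult.commute)
  finally show ?thesis using False a by (simp add: sinc_fun_def)
qed

text \<open>Averaging over \<open>[x - a, x + a]\<close> preserves the function \<open>x\<close> and multiplies the coefficient of
  \<open>cis (\<tau> x)\<close> by \<open>sinc (a \<tau>)\<close>.\<close>

lemma average_trigonometric_series:
  assumes c: "summable (\<lambda>i. cmod (c i))" and a: "0 < a"
    and r: "\<And>x. \<bar>x\<bar> < r \<Longrightarrow> (\<lambda>i. c i * cis (\<tau> i * x)) sums of_real x"
    and x: "\<bar>x\<bar> < r - a"
  shows "(\<lambda>i. c i * of_real (sinc_fun (a * \<tau> i)) * cis (\<tau> i * x)) sums of_real x"
proof -
  let ?s = "\<lambda>i y. indicator {x - a..x + a} y *\<^sub>R (c i * cis (\<tau> i * y))"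
  let ?I = "{x - a..x + a}"
  have int1: "integrable lborel (\<lambda>y. indicator ?I y *\<^sub>R cis (\<tau> i * y))" for i
    unfolding cis_conv_exp by (intro borel_integrable_compact compact_Icc continuous_intros)
  have int: "integrable lborel (\<lambda>y. ?s i y)" for i
    using integrable_mult_right[OF int1[of i], of "c i"] by simp
  have "(\<lambda>i. LINT y|lborel. ?s i y) sums
      (LINT y|lborel. (\<Sum>i. ?s i y))"
  proof (rule sums_integral[OF int])
    show "AE y in lborel. summable (\<lambda>i. norm (?s i y))"
      using c by (intro AE_I2) (auto simp: norm_mult indicator_def)
    have "(LINT y|lborel. norm (?s i y)) = cmod (c i) * (2 * a)" for i
      using a by (simp add: norm_mult)
    then show "summable (\<lambda>i. LINT y|lborel. norm (?s i y))"
      using c by (simp add: summable_mult2)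
  qed
  moreover have "(LINT y|lborel. ?s i y) = c i * (2 * of_real a * of_real (sinc_fun (a * \<tau> i)) * cis (\<tau> i * x))" for i
    unfolding integral_cis_Icc[OF a, symmetric] integral_mult_right_zero[symmetric] by simp
  moreover have "(LINT y|lborel. (\<Sum>i. ?s i y)) = of_real (2 * a * x)"
  proof -
    have "(\<Sum>i. ?s i y) = indicator ?I y *\<^sub>R complex_of_real y" for y
    proof (cases "y \<in> ?I")
      case True
      then have "\<bar>y\<bar> < r" using x by auto
      then show ?thesis using r True by (simp add: sums_iff)
    qed simp
    moreover have "(LINT y|lborel. indicator ?I y *\<^sub>R complex_of_real y) = of_real ((x + a)\<^sup>2 / 2) - of_real ((x - a)\<^sup>2 / 2)"
    proof (rule integral_FTC_Icc)
      show "((\<lambda>y. complex_of_real (y\<^sup>2 / 2)) has_vector_derivative complex_of_real y) (at y within ?I)" for y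
        by (rule has_vector_derivative_of_real) (auto intro!: derivative_eq_intros)
    qed (use a in \<open>auto intro!: continuous_intros\<close>)
    moreover have "(x + a)\<^sup>2 / 2 - (x - a)\<^sup>2 / 2 = 2 * a * x" by (simp add: power2_eq_square field_simps)
    ultimately show ?thesis by (simp only: of_real_diff[symmetric])
  qed
  ultimately have "(\<lambda>i. c i * (2 * of_real a * of_real (sinc_fun (a * \<tau> i)) * cis (\<tau> i * x))) sums of_real (2 * a * x)"
    by simp
  from sums_mult[OF this, of "1 / (2 * of_real a)"] show ?thesis using a by (simp add: mult_ac)
qed

lemma abs_sinc_fun_le_1: "\<bar>sinc_fun x\<bar> \<le> 1"
  using abs_sin_x_le_abs_x[of x] by (auto simp: sinc_fun_def divide_simps)

lemma abs_sinc_fun_le: "x \<noteq> 0 \<Longrightarrow> \<bar>sinc_fun x\<bar> \<le> 1 / \<bar>x\<bar>"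
  using abs_sin_le_one[of x] by (auto simp: sinc_fun_def intro!: divide_right_mono)

lemma abs_sinc_fun_minus_1: "\<bar>sinc_fun x - 1\<bar> \<le> \<bar>x\<bar>"
proof (cases "x = 0")
  case False
  have "\<bar>sin x - x\<bar> \<le> x\<^sup>2 / 2"
    using Maclaurin_sin_bound[of x 2] by (simp add: numeral_2_eq_2 sin_coeff_def)
  also have "\<dots> \<le> x\<^sup>2" by simp
  finally have "\<bar>sin x - x\<bar> / \<bar>x\<bar> \<le> x\<^sup>2 / \<bar>x\<bar>" by (intro divide_right_mono) auto
  also have "x\<^sup>2 / \<bar>x\<bar> = \<bar>x\<bar>" using False by (simp add: power2_eq_square abs_if)
  finally show ?thesis using False by (simp add: sinc_fun_def diff_divide_distrib abs_divide[symmetric])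
qed (simp add: sinc_fun_def)

text \<open>Partial products stay within [-1, 1] and change by at most
  \<open>a J * \<bar>t\<bar>\<close> in a step, so their increments are summable. The limit, which
  may be 0, is the characteristic function of a sum of independent uniform variables on
  \<open>[- a j, a j]\<close>.\<close>

lemma sinc_product_convergent:
  assumes a: "\<And>j. 0 < a j" "summable a"
  shows "convergent (\<lambda>J. \<Prod>j<J. sinc_fun (a j * t))"
proof -
  define p where "p J = (\<Prod>j<J. sinc_fun (a j * t))" for J :: nat
  have p1: "\<bar>p J\<bar> \<le> 1" for J
    unfolding p_def abs_prod by (intro prod_le_1) (auto simp: abs_sinc_fun_le_1)
  have "summable (\<lambda>J. p (Suc J) - p J)"
  proof (rule summable_comparison_test'[OF summable_mult2[OF a(2), of "\<bar>t\<bar>"], of 0])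
    fix J
    have "\<bar>p (Suc J) - p J\<bar> = \<bar>p J\<bar> * \<bar>sinc_fun (a J * t) - 1\<bar>"
      by (simp add: p_def abs_mult[symmetric] algebra_simps)
    also have "\<dots> \<le> 1 * \<bar>a J * t\<bar>"
      by (intro mult_mono p1 abs_sinc_fun_minus_1) auto
    finally show "norm (p (Suc J) - p J) \<le> a J * \<bar>t\<bar>" using a(1)[of J] by (simp add: abs_mult)
  qed
  then have "convergent (\<lambda>J. \<Sum>j<J. p (Suc j) - p j)" by (simp add: summable_iff_convergent)
  then have "convergent (\<lambda>J. p J - p 0)" by (simp add: sum_lessThan_telescope)
  then have "convergent (\<lambda>J. p J - p 0 + p 0)" by (intro convergent_add convergent_const)
  then show ?thesis by (simp add: p_def)
qed

lemma powr_diff_bounded: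
  fixes b s v :: real
  assumes "0 < b" "0 < s" "s < v"
  obtains M where "\<And>T. 0 \<le> T \<Longrightarrow> T powr s - b * T powr v \<le> M"
proof
  fix T :: real assume T: "0 \<le> T"
  \<comment> \<open>The point where \<open>b * T powr (v - s)\<close> equals 1; beyond it the
    subtracted term dominates.\<close>
  define T0 where "T0 = (1 / b) powr (1 / (v - s))"
  show "T powr s - b * T powr v \<le> T0 powr s"
  proof (cases "T \<le> T0")
    case True
    have "T powr s \<le> T0 powr s" using True T assms by (intro powr_mono2) auto
    moreover have "0 \<le> b * T powr v" using assms by simp
    ultimately show ?thesis by linarith
  next
    case False
    have T0: "0 < T0" using assms by (simp add: T0_def)
    have "1 / b = T0 powr (v - s)" using assms by (simp add: T0_def powr_powr)
    also have "\<dots> \<le> T powr (v - s)" using False T0 assms by (intro powr_mono2) auto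
    finally have "1 \<le> b * T powr (v - s)" using assms by (simp add: field_simps)
    then have "T powr s * 1 \<le> T powr s * (b * T powr (v - s))" by (intro mult_left_mono) auto
    also have "\<dots> = b * T powr v" by (simp add: powr_add[symmetric] mult.left_commute)
    finally have "T powr s \<le> b * T powr v" by simp
    moreover have "0 \<le> T0 powr s" by simp
    ultimately show ?thesis by linarith
  qed
qed

text \<open>The widths \<open>a j\<close> of the averages decay like \<open>(j + 1) powr (- q)\<close>. They are summable because
  \<open>q > 1\<close>, so that the identity survives on \<open>[-1, 1]\<close>; about \<open>\<bar>t\<bar> powr (1 / q)\<close> of the factors
  \<open>sinc_fun (a j * t)\<close> are at most \<open>exp (- 1)\<close>, which beats \<open>exp (\<bar>t\<bar> powr s)\<close> because
  \<open>s < 1 / q\<close>.\<close>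

lemma gevrey_expansion:
  assumes s: "0 < s" "s < 1"
  obtains c :: "nat \<Rightarrow> complex" and \<tau> :: "nat \<Rightarrow> real" where
    "summable (\<lambda>i. cmod (c i) * exp (\<bar>\<tau> i\<bar> powr s))"
    "\<And>x. \<bar>x\<bar> \<le> 1 \<Longrightarrow> (\<lambda>i. c i * cis (\<tau> i * x)) sums of_real x"
proof -
  obtain c :: "nat \<Rightarrow> complex" and \<tau> where c: "summable (\<lambda>i. cmod (c i))"
    "\<And>x. \<bar>x\<bar> < pi / 2 \<Longrightarrow> (\<lambda>i. c i * cis (\<tau> i * x)) sums of_real x"
    using trigonometric_series_identity by blast
  \<comment> \<open>The midpoint of 1 and \<open>1 / s\<close>: above 1 for summable half-widths,
    below \<open>1 / s\<close> for sufficient decay.\<close>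
  define q where "q = (1 + 1 / s) / 2"
  have q: "1 < q" "s < 1 / q" using s by (auto simp: q_def field_simps)
  have sq: "summable (\<lambda>j. real (Suc j) powr (- q))"
    using summable_real_powr_iff[of "- q"] q summable_Suc_iff[of "\<lambda>j. real j powr (- q)"] by simp
  define Z where "Z = (\<Sum>j. real (Suc j) powr (- q))"
  have Z0: "0 \<le> Z" unfolding Z_def using sq by (intro suminf_nonneg) auto
  \<comment> \<open>Scales the total half-width of the averages to at most \<open>1 / 2\<close>;
    \<open>Z + 1\<close> avoids division by 0.\<close>
  define b where "b = 1 / (2 * (Z + 1))"
  have b: "0 < b" using Z0 by (simp add: b_def)
  define a where "a j = b * real (Suc j) powr (- q)" for j
  have a0: "0 < a j" for j using b by (simp add: a_def)
  have sa: "summable a" unfolding a_def[abs_def] by (intro summable_mult sq)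
  have a_sum: "(\<Sum>j<J. a j) \<le> 1 / 2" for J
  proof -
    have "(\<Sum>j<J. a j) \<le> (\<Sum>j. a j)" using sa a0 by (intro sum_le_suminf) (auto simp: less_imp_le)
    also have "\<dots> = b * Z" unfolding a_def Z_def by (rule suminf_mult[OF sq])
    also have "\<dots> \<le> 1 / 2" using Z0 by (simp add: b_def field_simps)
    finally show ?thesis .
  qed
  define p where "p J t = (\<Prod>j<J. sinc_fun (a j * t))" for J :: nat and t
  define P where "P t = lim (\<lambda>J. p J t)" for t
  have pP: "(\<lambda>J. p J t) \<longlonglongrightarrow> P t" for t
    using sinc_product_convergent[OF a0 sa, of t] by (simp add: P_def p_def convergent_LIMSEQ_iff)
  have p1: "\<bar>p J t\<bar> \<le> 1" for J t
    unfolding p_def abs_prod by (intro prod_le_1) (auto simp: abs_sinc_fun_le_1)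
  have partial: "\<bar>x\<bar> < pi / 2 - (\<Sum>j<J. a j) \<Longrightarrow> (\<lambda>i. c i * of_real (p J (\<tau> i)) * cis (\<tau> i * x)) sums of_real x" for J x
  proof (induction J arbitrary: x)
    case 0
    then show ?case using c(2)[of x] by (simp add: p_def)
  next
    case (Suc J)
    have "(\<lambda>i. (c i * of_real (p J (\<tau> i))) * of_real (sinc_fun (a J * \<tau> i)) * cis (\<tau> i * x)) sums of_real x"
    proof (rule average_trigonometric_series[where r = "pi / 2 - (\<Sum>j<J. a j)"])
      show "summable (\<lambda>i. cmod (c i * of_real (p J (\<tau> i))))"
        by (rule summable_comparison_test'[OF c(1), of 0]) (simp add: norm_mult mult_left_le p1)
    qed (use Suc a0 in auto)
    then show ?case by (simp add: p_def mult.assoc)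
  qed
  have sums: "(\<lambda>i. c i * of_real (P (\<tau> i)) * cis (\<tau> i * x)) sums of_real x" if x: "\<bar>x\<bar> \<le> 1" for x
  proof -
    have "3 < pi" by (rule pi_gt3)
    then have px: "(\<lambda>i. c i * of_real (p J (\<tau> i)) * cis (\<tau> i * x)) sums of_real x" for J
      using x a_sum[of J] by (intro partial) linarith
    have b1: "norm (c i * of_real (p J (\<tau> i)) * cis (\<tau> i * x)) \<le> cmod (c i)" for i J
      by (simp add: norm_mult mult_left_le p1)
    have T: "(\<lambda>J. c i * of_real (p J (\<tau> i)) * cis (\<tau> i * x)) \<longlonglongrightarrow> c i * of_real (P (\<tau> i)) * cis (\<tau> i * x)" for i
      by (intro tendsto_intros pP)
    have "summable (\<lambda>i. norm (c i * of_real (P (\<tau> i)) * cis (\<tau> i * x)))"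
      "(\<lambda>J. \<Sum>i. c i * of_real (p J (\<tau> i)) * cis (\<tau> i * x)) \<longlonglongrightarrow> (\<Sum>i. c i * of_real (P (\<tau> i)) * cis (\<tau> i * x))"
      using tannerys_theorem[OF T always_eventually c(1) sequentially_bot] b1 by auto
    moreover have "(\<Sum>i. c i * of_real (p J (\<tau> i)) * cis (\<tau> i * x)) = of_real x" for J
      using px by (simp add: sums_iff)
    ultimately show ?thesis
      by (auto simp: sums_iff intro: summable_norm_cancel LIMSEQ_unique[OF _ tendsto_const])
  qed
  define v where "v = 1 / q"
  have v: "s < v" "0 < v" using q s by (auto simp: v_def)
  \<comment> \<open>Chosen so that \<open>real (Suc j) \<le> d * \<bar>t\<bar> powr v\<close> forces
    \<open>\<bar>a j * t\<bar> \<ge> exp 1\<close>, whence the factor is at most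
    \<open>exp (- 1)\<close>.\<close>
  define d where "d = (b / exp 1) powr v"
  have d: "0 < d" using b by (simp add: d_def)
  have decay: "\<bar>P t\<bar> \<le> exp (1 - d * \<bar>t\<bar> powr v)" for t
  proof -
    \<comment> \<open>The number of factors known to be small; rounding down loses at most one,
      which accounts for the \<open>1\<close> in the exponent of the bound.\<close>
    define J where "J = nat \<lfloor>d * \<bar>t\<bar> powr v\<rfloor>"
    have J: "real J \<le> d * \<bar>t\<bar> powr v" "d * \<bar>t\<bar> powr v \<le> real J + 1"
      using d by (auto simp: J_def)
    have small: "\<bar>sinc_fun (a j * t)\<bar> \<le> exp (- 1)" if j: "j < J" for j
    proof -
      have t0: "t \<noteq> 0" using j J(1) by auto
      have "real (Suc j) \<le> d * \<bar>t\<bar> powr v" using j J(1) by linarith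
      also have "\<dots> = (b * \<bar>t\<bar> / exp 1) powr v"
        using b by (simp add: d_def powr_mult[symmetric])
      finally have "real (Suc j) powr q \<le> ((b * \<bar>t\<bar> / exp 1) powr v) powr q"
        using q by (intro powr_mono2) auto
      also have "\<dots> = b * \<bar>t\<bar> / exp 1" using b q by (simp add: powr_powr v_def)
      finally have "exp 1 * real (Suc j) powr q \<le> b * \<bar>t\<bar>" by (simp add: field_simps)
      then have "exp 1 \<le> \<bar>a j * t\<bar>"
        using b by (simp add: a_def abs_mult powr_minus field_simps)
      moreover have "\<bar>sinc_fun (a j * t)\<bar> \<le> 1 / \<bar>a j * t\<bar>" using t0 a0[of j] by (intro abs_sinc_fun_le) auto
      moreover have "1 / \<bar>a j * t\<bar> \<le> 1 / exp 1" using calculation(1) by (intro frac_le) auto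
      ultimately show ?thesis by (simp add: exp_minus divide_inverse)
    qed
    have "\<bar>p J' t\<bar> \<le> exp (- real J)" if "J \<le> J'" for J'
    proof -
      have "\<bar>p J' t\<bar> = (\<Prod>j<J. \<bar>sinc_fun (a j * t)\<bar>) * (\<Prod>j\<in>{J..<J'}. \<bar>sinc_fun (a j * t)\<bar>)"
        unfolding p_def abs_prod using that by (simp add: lessThan_atLeast0 prod.atLeastLessThan_concat)
      also have "\<dots> \<le> (\<Prod>j<J. exp (- 1)) * 1"
        using small by (intro mult_mono prod_mono prod_le_1) (auto simp: abs_sinc_fun_le_1 intro!: prod_nonneg)
      also have "\<dots> = exp (- real J)" by (simp add: exp_of_nat_mult[symmetric])
      finally show ?thesis .
    qed
    then have "\<bar>P t\<bar> \<le> exp (- real J)"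
      by (intro LIMSEQ_le_const2[OF tendsto_rabs[OF pP]]) auto
    also have "\<dots> \<le> exp (1 - d * \<bar>t\<bar> powr v)" using J by simp
    finally show ?thesis .
  qed
  obtain M where M: "\<And>T. 0 \<le> T \<Longrightarrow> T powr s - d * T powr v \<le> M"
    using powr_diff_bounded[OF d s(1) v(1)] by blast
  have "\<bar>P t\<bar> * exp (\<bar>t\<bar> powr s) \<le> exp (1 + M)" for t
  proof -
    have "\<bar>P t\<bar> * exp (\<bar>t\<bar> powr s) \<le> exp (1 - d * \<bar>t\<bar> powr v) * exp (\<bar>t\<bar> powr s)"
      by (intro mult_right_mono decay) simp
    also have "\<dots> \<le> exp (1 + M)" unfolding exp_add[symmetric] using M[of "\<bar>t\<bar>"] by simp
    finally show ?thesis .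
  qed
  then have "summable (\<lambda>i. cmod (c i * of_real (P (\<tau> i))) * exp (\<bar>\<tau> i\<bar> powr s))"
    by (intro summable_comparison_test'[OF summable_mult2[OF c(1), of "exp (1 + M)"], of 0])
       (simp add: norm_mult mult.assoc mult_left_mono)
  then show ?thesis using sums by (rule that)
qed

section \<open>From the oscillating multipliers to the curve operator\<close>

lemma Lp_bounds_diff:
  fixes m\<^sub>1 m\<^sub>2 :: "real ^ 'n::finite \<Rightarrow> complex"
  assumes p: "1 \<le> p" and C: "0 < C" "C \<in> Lp_bounds p (multiplier_op m\<^sub>1)" "C \<in> Lp_bounds p (multiplier_op m\<^sub>2)"
    and a: "cmod a = 1"
    and i: "\<And>f. test_function f \<Longrightarrow> integrable lborel (\<lambda>\<xi>. m\<^sub>1 \<xi> * fourier f \<xi>)"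
      "\<And>f. test_function f \<Longrightarrow> integrable lborel (\<lambda>\<xi>. m\<^sub>2 \<xi> * fourier f \<xi>)"
  shows "2 * C \<in> Lp_bounds p (multiplier_op (\<lambda>\<xi>. m\<^sub>1 \<xi> + a * m\<^sub>2 \<xi>))"
proof -
  define c where "c i = (if i = 0 then 1 else if i = 1 then a else 0)" for i :: nat
  define T where "T i = multiplier_op (if i = 0 then m\<^sub>1 else m\<^sub>2)" for i :: nat
  have fin: "(\<lambda>i. g i) sums (g 0 + g 1)" if "\<And>i. 2 \<le> i \<Longrightarrow> g i = 0" for g :: "nat \<Rightarrow> 'b::{comm_monoid_add, t2_space}"
    using sums_finite[of "{0, 1}" g] that by force
  have s: "(\<lambda>i. cmod (c i) * C) sums (2 * C)"
    using fin[of "\<lambda>i. cmod (c i) * C"] a by (simp add: c_def)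
  have "(\<Sum>i. cmod (c i) * C) \<in> Lp_bounds p (multiplier_op (\<lambda>\<xi>. m\<^sub>1 \<xi> + a * m\<^sub>2 \<xi>))"
  proof (rule Lp_bounds_sums[OF p C(1)])
    show "C \<in> Lp_bounds p (T i)" for i using C by (simp add: T_def)
    fix f :: "real ^ 'n \<Rightarrow> complex" and x assume f: "test_function f"
    have "integrable lborel (\<lambda>\<xi>. m\<^sub>1 \<xi> * fourier f \<xi> * cis (x \<bullet> \<xi>))" "integrable lborel (\<lambda>\<xi>. m\<^sub>2 \<xi> * fourier f \<xi> * cis (x \<bullet> \<xi>))"
      by (intro integrable_mult_cis i f; measurable)+
    then have "multiplier_op (\<lambda>\<xi>. m\<^sub>1 \<xi> + a * m\<^sub>2 \<xi>) f x = multiplier_op m\<^sub>1 f x + a * multiplier_op m\<^sub>2 f x"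
      by (simp add: multiplier_op_def distrib_right mult.assoc)
    then show "(\<lambda>i. c i * T i f x) sums multiplier_op (\<lambda>\<xi>. m\<^sub>1 \<xi> + a * m\<^sub>2 \<xi>) f x"
      using fin[of "\<lambda>i. c i * T i f x"] by (simp add: c_def T_def)
  qed (use s in \<open>simp add: sums_iff\<close>)
  then show ?thesis using s by (simp add: sums_iff)
qed

lemma integral_trigonometric_sums:
  assumes K: "integrable M K" and c: "summable (\<lambda>i. cmod (c i))"
    and y: "y \<in> borel_measurable M" "\<And>u. (\<lambda>i. c i * cis (\<tau> i * y u)) sums of_real (y u)"
  shows "(\<lambda>i. c i * (LINT u|M. exp (\<i> * of_real (\<tau> i * y u)) * K u)) sums (LINT u|M. of_real (y u) * K u)"
proof -
  have e: "(\<lambda>u. c i * (cis (\<tau> i * y u) * K u)) = (\<lambda>u. c i * (K u * cis (\<tau> i * y u)))" for i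
    by (simp add: mult_ac)
  have int: "integrable M (\<lambda>u. c i * (cis (\<tau> i * y u) * K u))" for i
    unfolding e using y(1) by (intro integrable_mult_right integrable_mult_cis K) measurable
  have "(\<lambda>i. LINT u|M. c i * (cis (\<tau> i * y u) * K u)) sums (LINT u|M. (\<Sum>i. c i * (cis (\<tau> i * y u) * K u)))"
  proof (rule sums_integral[OF int])
    show "AE u in M. summable (\<lambda>i. norm (c i * (cis (\<tau> i * y u) * K u)))"
      using c by (intro AE_I2) (simp add: norm_mult summable_mult2)
    show "summable (\<lambda>i. LINT u|M. norm (c i * (cis (\<tau> i * y u) * K u)))"
      using c by (simp add: norm_mult summable_mult2)
  qed
  moreover have "(\<Sum>i. c i * (cis (\<tau> i * y u) * K u)) = of_real (y u) * K u" for u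
    using sums_mult2[OF y(2)[of u], of "K u"] by (simp add: sums_iff mult.assoc)
  ultimately show ?thesis by (simp add: cis_conv_exp)
qed

text \<open>The norm of \<open>K\<close> enters only through the termwise integration.
  \<open>B + 1\<close> replaces \<open>B\<close> because membership in \<open>Lp_bounds\<close>
  needs a constant strictly above the operator norm; \<open>1 \<le> w i\<close> gives summability of
  the unweighted coefficients.\<close>

lemma Lp_bounds_trigonometric:
  fixes \<gamma> :: "real \<Rightarrow> real ^ 'n::finite" and \<mu> :: "nat \<Rightarrow> real ^ 'n \<Rightarrow> complex"
  assumes p: "1 \<le> p" and K: "integrable lborel K" and B: "0 \<le> B"
    and c: "summable (\<lambda>i. cmod (c i) * w i)" "\<And>i. 1 \<le> w i"
    and cx: "\<And>x. \<bar>x\<bar> \<le> 1 \<Longrightarrow> (\<lambda>i. c i * cis (\<tau> i * x)) sums of_real x"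
    and y: "\<And>\<xi>. (\<lambda>u. y (\<gamma> u \<bullet> \<xi>)) \<in> borel_measurable borel" "\<And>\<theta>. \<bar>y \<theta>\<bar> \<le> 1"
    and \<mu>: "\<And>i. \<mu> i \<in> Mp p" "\<And>i. Mp_norm p (\<mu> i) \<le> B * w i"
      "\<And>i \<xi>. \<mu> i \<xi> = (LINT u|lborel. exp (\<i> * of_real (\<tau> i * y (\<gamma> u \<bullet> \<xi>))) * K u)"
  shows "(B + 1) * (\<Sum>i. cmod (c i) * w i) \<in>
    Lp_bounds p (multiplier_op (\<lambda>\<xi>. LINT u|lborel. of_real (y (\<gamma> u \<bullet> \<xi>)) * K u))"
proof -
  have w: "0 < w i" for i using c(2)[of i] by simp
  have sc: "summable (\<lambda>i. cmod (c i))"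
    by (rule summable_comparison_test'[OF c(1), of 0]) (use mult_left_mono[OF c(2) norm_ge_zero] in simp)
  have [measurable]: "\<mu> i \<in> borel_measurable borel" for i using \<mu>(1) by (simp add: Mp_def)
  have s: "(\<lambda>i. cmod (c i) * ((B + 1) * w i)) sums ((B + 1) * (\<Sum>i. cmod (c i) * w i))"
    using sums_mult[OF summable_sums[OF c(1)], of "B + 1"] by (simp add: mult.left_commute)
  have sum: "(\<lambda>i. c i * \<mu> i \<xi>) sums (LINT u|lborel. of_real (y (\<gamma> u \<bullet> \<xi>)) * K u)" for \<xi>
    unfolding \<mu>(3) using y cx by (intro integral_trigonometric_sums K sc) auto
  have "(\<Sum>i. cmod (c i) * ((B + 1) * w i)) \<in> Lp_bounds p (multiplier_op (\<lambda>\<xi>. LINT u|lborel. of_real (y (\<gamma> u \<bullet> \<xi>)) * K u))"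
  proof (rule Lp_bounds_sums[OF p])
    show "0 < (B + 1) * w i" for i using B w[of i] by simp
    show "(B + 1) * w i \<in> Lp_bounds p (multiplier_op (\<mu> i))" for i
    proof (rule Lp_bounds_of_opnorm_less)
      show "bounded_on_Lp p (multiplier_op (\<mu> i))" using \<mu>(1) by (simp add: Mp_def)
      show "Lp_opnorm p (multiplier_op (\<mu> i)) < (B + 1) * w i"
        using \<mu>(2)[of i] w[of i] by (simp add: Mp_norm_def distrib_right)
    qed
    show "summable (\<lambda>i. cmod (c i) * ((B + 1) * w i))" using s by (rule sums_summable)
    fix f :: "real ^ 'n \<Rightarrow> complex" and x assume f: "test_function f"
    have "(\<lambda>i. multiplier_op (\<lambda>\<xi>. c i * \<mu> i \<xi>) f x) sums multiplier_op (\<lambda>\<xi>. \<Sum>i. c i * \<mu> i \<xi>) f x"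
    proof (rule multiplier_op_sums[OF _ _ summable_mult2[OF sc, of "LINT u|lborel. cmod (K u)"] f])
      show "cmod (c i * \<mu> i \<xi>) \<le> cmod (c i) * (LINT u|lborel. cmod (K u)) * (1 + norm \<xi>) ^ 0" for i \<xi>
      proof -
        have "cmod (\<mu> i \<xi>) \<le> (LINT u|lborel. cmod (exp (\<i> * of_real (\<tau> i * y (\<gamma> u \<bullet> \<xi>))) * K u))"
          unfolding \<mu>(3) by (rule integral_norm_bound)
        then show ?thesis by (simp add: norm_mult mult_left_mono)
      qed
    qed measurable
    then show "(\<lambda>i. c i * multiplier_op (\<mu> i) f x) sums multiplier_op (\<lambda>\<xi>. LINT u|lborel. of_real (y (\<gamma> u \<bullet> \<xi>)) * K u) f x"
      using sum by (simp only: multiplier_op_cmult sums_unique[OF sum, symmetric])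
  qed
  then show ?thesis using s by (simp add: sums_iff)
qed

text \<open>The symbol is the cosine part minus \<open>\<i>\<close> times the sine part, hence the
  factor 2. The \<open>+ 1\<close> after the sum only makes the common constant positive.\<close>

lemma curve_op_bounded:
  fixes \<gamma> :: "real \<Rightarrow> real ^ 'n::finite"
  assumes p: "1 \<le> p" and \<gamma>: "continuous_on UNIV \<gamma>" and K: "integrable lborel K" and B: "0 \<le> B"
    and c: "summable (\<lambda>i. cmod (c i) * w i)" "\<And>i. 1 \<le> w i"
    and cx: "\<And>x. \<bar>x\<bar> \<le> 1 \<Longrightarrow> (\<lambda>i. c i * cis (\<tau> i * x)) sums of_real x"
    and cos: "\<And>i. cos_mult \<gamma> K (\<tau> i) \<in> Mp p" "\<And>i. Mp_norm p (cos_mult \<gamma> K (\<tau> i)) \<le> B * w i"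
    and sin: "\<And>i. sin_mult \<gamma> K (\<tau> i) \<in> Mp p" "\<And>i. Mp_norm p (sin_mult \<gamma> K (\<tau> i)) \<le> B * w i"
  shows "2 * ((B + 1) * ((\<Sum>i. cmod (c i) * w i) + 1)) \<in> Lp_bounds p (curve_op \<gamma> K)"
proof -
  have [measurable]: "\<gamma> \<in> borel_measurable borel" using \<gamma> by (rule borel_measurable_continuous_onI)
  have [measurable]: "K \<in> borel_measurable borel" using K by auto
  have osc: "integrable lborel (\<lambda>u. exp (\<i> * of_real (h u)) * K u)" if "h \<in> borel_measurable borel" for h
    using integrable_mult_cis[OF K, of h] that by (simp add: mult.commute cis_conv_exp)
  have cosm: "cos_mult \<gamma> K t \<xi> = (LINT u|lborel. exp (\<i> * of_real (t * cos (\<gamma> u \<bullet> \<xi>))) * K u)" for t \<xi>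
    unfolding cos_mult_def by (intro pv_of_integrable(2) osc) measurable
  have sinm: "sin_mult \<gamma> K t \<xi> = (LINT u|lborel. exp (\<i> * of_real (t * sin (\<gamma> u \<bullet> \<xi>))) * K u)" for t \<xi>
    unfolding sin_mult_def by (intro pv_of_integrable(2) osc) measurable
  have D: "0 \<le> (\<Sum>i. cmod (c i) * w i)"
    using c(2) by (intro suminf_nonneg c(1) mult_nonneg_nonneg) (auto intro: order_trans[OF zero_le_one])
  define C where "C = (B + 1) * ((\<Sum>i. cmod (c i) * w i) + 1)"
  have C: "0 < C" "(B + 1) * (\<Sum>i. cmod (c i) * w i) \<le> C" using B D by (simp_all add: C_def)
  define mc where "mc \<xi> = (LINT u|lborel. of_real (cos (\<gamma> u \<bullet> \<xi>)) * K u)" for \<xi>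
  define ms where "ms \<xi> = (LINT u|lborel. of_real (sin (\<gamma> u \<bullet> \<xi>)) * K u)" for \<xi>
  have 1: "C \<in> Lp_bounds p (multiplier_op mc)" "C \<in> Lp_bounds p (multiplier_op ms)"
    unfolding mc_def[abs_def] ms_def[abs_def]
    by (rule Lp_bounds_mono[OF Lp_bounds_trigonometric[OF p K B c cx _ _ cos cosm] C(2)]; simp)
       (rule Lp_bounds_mono[OF Lp_bounds_trigonometric[OF p K B c cx _ _ sin sinm] C(2)]; simp)
  have meas: "mc \<in> borel_measurable borel" "ms \<in> borel_measurable borel"
    unfolding mc_def[abs_def] ms_def[abs_def] by measurable
  have iy: "integrable lborel (\<lambda>u. of_real (y u) * K u)" "cmod (LINT u|lborel. of_real (y u) * K u) \<le> (LINT u|lborel. cmod (K u))"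
    if y: "y \<in> borel_measurable borel" "\<And>u. \<bar>y u\<bar> \<le> 1" for y :: "real \<Rightarrow> real"
  proof -
    show i: "integrable lborel (\<lambda>u. of_real (y u) * K u)"
      using y by (intro integrable_bounded_mult[OF K, of _ 1]) auto
    show "cmod (LINT u|lborel. of_real (y u) * K u) \<le> (LINT u|lborel. cmod (K u))"
      by (rule order_trans[OF integral_norm_bound integral_mono])
         (use integrable_norm[OF i] K y(2) in \<open>auto simp: norm_mult mult_left_le_one_le\<close>)
  qed
  have gr: "poly_growth mc" "poly_growth ms"
    unfolding mc_def[abs_def] ms_def[abs_def] by (rule poly_growth_bounded[OF iy(2)]; simp)+
  have "2 * C \<in> Lp_bounds p (multiplier_op (\<lambda>\<xi>. mc \<xi> + (- \<i>) * ms \<xi>))"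
    by (rule Lp_bounds_diff[OF p C(1) 1]) (auto intro: integrable_mult_fourier meas gr)
  moreover have "mc \<xi> + (- \<i>) * ms \<xi> = (LINT u|lborel. cis (- (\<gamma> u \<bullet> \<xi>)) * K u)" for \<xi>
  proof -
    have i1: "integrable lborel (\<lambda>u. of_real (cos (\<gamma> u \<bullet> \<xi>)) * K u)" and i2: "integrable lborel (\<lambda>u. of_real (sin (\<gamma> u \<bullet> \<xi>)) * K u)"
      by (rule iy(1); simp)+
    have "cis (- (\<gamma> u \<bullet> \<xi>)) * K u = of_real (cos (\<gamma> u \<bullet> \<xi>)) * K u + (- \<i>) * (of_real (sin (\<gamma> u \<bullet> \<xi>)) * K u)" for u
      by (simp add: complex_eq_iff)
    then show ?thesis
      unfolding mc_def ms_def integral_mult_right_zero[symmetric]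
      by (simp only: Bochner_Integration.integral_add[OF i1 integrable_mult_right[OF i2]])
  qed
  moreover have "curve_op \<gamma> K f x = multiplier_op (\<lambda>\<xi>. LINT u|lborel. cis (- (\<gamma> u \<bullet> \<xi>)) * K u) f x" if f: "test_function f" for f x
  proof -
    obtain M where M': "\<And>x. cmod (f x) \<le> M"
        using test_function_norm_le[OF f] by metis
    have [measurable]: "f \<in> borel_measurable borel" using f by (rule test_function_measurable)
    have "integrable lborel (\<lambda>u. f (x - \<gamma> u) * K u)"
      by (rule integrable_bounded_mult[OF K _ M']) measurable
    then show ?thesis
      unfolding curve_op_def by (simp add: pv_of_integrable(2) curve_integral_eq_multiplier_op[OF \<gamma> K f])
  qed
  ultimately show ?thesis
    using Lp_bounds_cong[of "curve_op \<gamma> K" "multiplier_op (\<lambda>\<xi>. LINT u|lborel. cis (- (\<gamma> u \<bullet> \<xi>)) * K u)" p]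
    by (simp add: C_def)
qed

theorem theorem1p4:
  fixes p :: real and \<gamma> :: "real \<Rightarrow> real ^ 'n::finite"
  assumes "1 \<le> p" and "continuous_on UNIV \<gamma>"
  shows
    "(\<forall>(K :: real \<Rightarrow> complex) (B :: real).
        admissible_kernel \<gamma> K \<and>
        bounded_on_Lp p (curve_op \<gamma> K) \<and> Lp_opnorm p (curve_op \<gamma> K) \<le> B \<longrightarrow>
        (\<forall>t :: real.
           cos_mult \<gamma> K t \<in> Mp p \<and> Mp_norm p (cos_mult \<gamma> K t) \<le> B * exp \<bar>t\<bar> \<and>
           sin_mult \<gamma> K t \<in> Mp p \<and> Mp_norm p (sin_mult \<gamma> K t) \<le> B * exp \<bar>t\<bar>))
     \<and>
     (\<forall>(s :: real) (B :: real). 0 < s \<and> s < 1 \<longrightarrow>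
        (\<exists>C :: real. \<forall>K :: real \<Rightarrow> complex.
           integrable lborel K \<and>
           (\<forall>t :: real.
              cos_mult \<gamma> K t \<in> Mp p \<and> Mp_norm p (cos_mult \<gamma> K t) \<le> B * exp (\<bar>t\<bar> powr s) \<and>
              sin_mult \<gamma> K t \<in> Mp p \<and> Mp_norm p (sin_mult \<gamma> K t) \<le> B * exp (\<bar>t\<bar> powr s)) \<longrightarrow>
           bounded_on_Lp p (curve_op \<gamma> K) \<and> Lp_opnorm p (curve_op \<gamma> K) \<le> C))"
proof (intro conjI allI impI)
  fix K B t
  assume K: "admissible_kernel \<gamma> K \<and> bounded_on_Lp p (curve_op \<gamma> K) \<and> Lp_opnorm p (curve_op \<gamma> K) \<le> B"
  show "cos_mult \<gamma> K t \<in> Mp p" "Mp_norm p (cos_mult \<gamma> K t) \<le> B * exp \<bar>t\<bar>"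
    "sin_mult \<gamma> K t \<in> Mp p" "Mp_norm p (sin_mult \<gamma> K t) \<le> B * exp \<bar>t\<bar>"
    using curve_multipliers_bounded[OF assms, of K B t] K by auto
next
  fix s B :: real assume s: "0 < s \<and> s < 1"
  obtain c :: "nat \<Rightarrow> complex" and \<tau> where c: "summable (\<lambda>i. cmod (c i) * exp (\<bar>\<tau> i\<bar> powr s))"
    "\<And>x. \<bar>x\<bar> \<le> 1 \<Longrightarrow> (\<lambda>i. c i * cis (\<tau> i * x)) sums of_real x"
    using gevrey_expansion s by blast
  \<comment> \<open>Built from \<open>B\<close> and an expansion that depends on \<open>s\<close>
    alone, hence fixed before \<open>K\<close> is chosen.\<close>
  define C where "C = 2 * ((B + 1) * ((\<Sum>i. cmod (c i) * exp (\<bar>\<tau> i\<bar> powr s)) + 1))"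
  show "\<exists>C. \<forall>K. integrable lborel K \<and>
      (\<forall>t. cos_mult \<gamma> K t \<in> Mp p \<and> Mp_norm p (cos_mult \<gamma> K t) \<le> B * exp (\<bar>t\<bar> powr s) \<and>
           sin_mult \<gamma> K t \<in> Mp p \<and> Mp_norm p (sin_mult \<gamma> K t) \<le> B * exp (\<bar>t\<bar> powr s)) \<longrightarrow>
      bounded_on_Lp p (curve_op \<gamma> K) \<and> Lp_opnorm p (curve_op \<gamma> K) \<le> C"
  proof (intro exI[of _ C] allI impI)
    fix K
    assume K: "integrable lborel K \<and>
      (\<forall>t. cos_mult \<gamma> K t \<in> Mp p \<and> Mp_norm p (cos_mult \<gamma> K t) \<le> B * exp (\<bar>t\<bar> powr s) \<and>
           sin_mult \<gamma> K t \<in> Mp p \<and> Mp_norm p (sin_mult \<gamma> K t) \<le> B * exp (\<bar>t\<bar> powr s))"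
    \<comment> \<open>The sign of \<open>B\<close> is not assumed; the hypothesis at
      \<open>t = 0\<close> forces it, as an operator norm is nonnegative.\<close>
    have "0 \<le> Mp_norm p (cos_mult \<gamma> K 0)"
      using K Lp_opnorm_nonneg by (auto simp: Mp_norm_def Mp_def)
    also have "\<dots> \<le> B * exp (\<bar>0\<bar> powr s)" using K by blast
    finally have B: "0 \<le> B" by (simp add: zero_le_mult_iff)
    have "C \<in> Lp_bounds p (curve_op \<gamma> K)"
      unfolding C_def by (rule curve_op_bounded[OF assms _ B c(1) _ c(2)]) (use K in auto)
    then show "bounded_on_Lp p (curve_op \<gamma> K) \<and> Lp_opnorm p (curve_op \<gamma> K) \<le> C"
      unfolding bounded_on_Lp_def Lp_opnorm_def
      by (auto intro!: cInf_lower bdd_belowI[of _ 0] simp: Lp_bounds_def)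
  qed
qed

end
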